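(* Let $G$ be a Polish group that admits a faithful action of one of the following kinds: (1) a locally finite Polish (measure preserving) action; (2) a locally finite Polish nonsingular action with continuous Radon–Nikodym cocycle. Then $G$ admits a free probability preserving spatial action.
   Context: A standard measure space $(X,\mathcal{B},\mu)$ is a standard Borel space with a non-atomic Borel measure that is either a probability measure or an infinite $\sigma$-finite measure. A Borel action of a Polish group $G$ on a standard Borel space $(X,\mathcal{B})$ is a jointly Borel map $G\times X\to X$, $(g,x)\mapsto T_g(x)$, with $T_e=\mathrm{Id}_X$ and $T_g\circ T_h=T_{gh}$ for all $g,h\in G$; it is $\tau$-Polish, for a Polish topology $\tau$ on $X$ generating $\mathcal{B}$, if this map is jointly continuous. A (measure preserving) spatial action on $(X,\mathcal{B},\mu)$ is a Borel action with $\mu\circ T_g^{-1}=\mu$ for every $g\in G$; it is probability preserving if $\mu(X)=1$. A nonsingular spatial action on $(X,\mathcal{B},\mu)$ is a Borel action such that $\mu\circ T_g^{-1}$ and $\mu$ are mutually absolutely continuous for every $g\in G$. A locally finite Polish action (respectively, locally finite Polish nonsingular action) is a measure preserving (respectively, nonsingular) action on $(X,\mathcal{B},\mu)$ with a Polish topology $\tau$ on $X$ (generating $\mathcal{B}$) for which, simultaneously, the action is $\tau$-Polish and $\mu$ is $\tau$-locally finite, i.e. every point of $X$ has a $\tau$-neighborhood of finite measure. The Radon–Nikodym cocycle of a nonsingular action is $\nabla_g=\frac{d\mu\circ T_g^{-1}}{d\mu}$, $g\in G$; it is said to be continuous (with respect to the topology $\tau$ of the locally finite Polish nonsingular action) if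 for each $g\in G$ the Radon–Nikodym derivative $x\mapsto\nabla_g(x)\in(0,\infty)$ is $\tau$-continuous. An action is faithful if each $g\in G$ other than the identity acts nontrivially on a set of positive measure, i.e. $\mu(\{x:T_g(x)\neq x\})>0$. A spatial action is free if $T_g(x)\ne x$ for every $x$ in the space and every $g\ne e$ (obtained, if necessary, by restricting to an invariant conull Borel set). *)

theory Defs
  imports "HOL-Probability.Probability" "HOL-Algebra.Group"
begin

definition polish_topology :: "'a topology \<Rightarrow> bool" where
  "polish_topology \<tau> \<longleftrightarrow> completely_metrizable_space \<tau> \<and> second_countable \<tau>"

definition borel_of_top :: "'a topology \<Rightarrow> 'a measure" where
  "borel_of_top \<tau> = sigma (topspace \<tau>) {U. openin \<tau> U}"

definition polish_group :: "('g, 'm) monoid_scheme \<Rightarrow> 'g topology \<Rightarrow> bool" where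
  "polish_group G \<tau>G \<longleftrightarrow>
     group G \<and> topspace \<tau>G = carrier G \<and> polish_topology \<tau>G \<and>
     continuous_map (prod_topology \<tau>G \<tau>G) \<tau>G (\<lambda>(g, h). g \<otimes>\<^bsub>G\<^esub> h) \<and>
     continuous_map \<tau>G \<tau>G (\<lambda>g. inv\<^bsub>G\<^esub> g)"


subsection \<open>Standard measure spaces\<close>

definition generates_borel :: "'x topology \<Rightarrow> 'x measure \<Rightarrow> bool" where
  "generates_borel \<tau> M \<longleftrightarrow>
     topspace \<tau> = space M \<and> sets M = sets (borel_of_top \<tau>)"

definition standard_borel_space :: "'x measure \<Rightarrow> bool" where
  "standard_borel_space M \<longleftrightarrow> (\<exists>\<tau>. polish_topology \<tau> \<and> generates_borel \<tau> M)"

definition non_atomic :: "'x measure \<Rightarrow> bool" where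
  "non_atomic M \<longleftrightarrow>
     (\<forall>A\<in>sets M. emeasure M A > 0 \<longrightarrow>
        (\<exists>B\<in>sets M. B \<subseteq> A \<and> 0 < emeasure M B \<and> emeasure M B < emeasure M A))"

definition standard_measure_space :: "'x measure \<Rightarrow> bool" where
  "standard_measure_space M \<longleftrightarrow>
     standard_borel_space M \<and> non_atomic M \<and>
     (prob_space M \<or> (sigma_finite_measure M \<and> emeasure M (space M) = \<infinity>))"


subsection \<open>Actions\<close>

text \<open>
  An action is a function \<open>T\<close> of a group element and a point; only its values on
  \<open>carrier G\<close> and \<open>space M\<close> matter.
  As the topologies involved are second countable, the product of the Borel sigma-algebras
  is the Borel sigma-algebra of the product, so the measurability condition is joint
  Borel measurability.
\<close>

definition borel_action ::
    "('g, 'm) monoid_scheme \<Rightarrow> 'g topology \<Rightarrow> 'x measure \<Rightarrow> ('g \<Rightarrow> 'x \<Rightarrow> 'x) \<Rightarrow> bool" where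
  "borel_action G \<tau>G M T \<longleftrightarrow>
     (\<lambda>(g, x). T g x) \<in> measurable (borel_of_top \<tau>G \<Otimes>\<^sub>M M) M \<and>
     (\<forall>x\<in>space M. T \<one>\<^bsub>G\<^esub> x = x) \<and>
     (\<forall>g\<in>carrier G. \<forall>h\<in>carrier G. \<forall>x\<in>space M. T g (T h x) = T (g \<otimes>\<^bsub>G\<^esub> h) x)"

definition polish_action ::
    "('g, 'm) monoid_scheme \<Rightarrow> 'g topology \<Rightarrow> 'x measure \<Rightarrow> 'x topology \<Rightarrow> ('g \<Rightarrow> 'x \<Rightarrow> 'x) \<Rightarrow> bool" where
  "polish_action G \<tau>G M \<tau> T \<longleftrightarrow>
     borel_action G \<tau>G M T \<and> polish_topology \<tau> \<and> generates_borel \<tau> M \<and>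
     continuous_map (prod_topology \<tau>G \<tau>) \<tau> (\<lambda>(g, x). T g x)"

text \<open>\<open>distr M M (T g)\<close> is the push-forward of the measure, \<open>A \<mapsto> \<mu> (T\<^sub>g\<^sup>-\<^sup>1 A)\<close>.\<close>

definition spatial_action ::
    "('g, 'm) monoid_scheme \<Rightarrow> 'g topology \<Rightarrow> 'x measure \<Rightarrow> ('g \<Rightarrow> 'x \<Rightarrow> 'x) \<Rightarrow> bool" where
  "spatial_action G \<tau>G M T \<longleftrightarrow>
     standard_measure_space M \<and> borel_action G \<tau>G M T \<and>
     (\<forall>g\<in>carrier G. distr M M (T g) = M)"

definition prob_preserving_spatial_action ::
    "('g, 'm) monoid_scheme \<Rightarrow> 'g topology \<Rightarrow> 'x measure \<Rightarrow> ('g \<Rightarrow> 'x \<Rightarrow> 'x) \<Rightarrow> bool" where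
  "prob_preserving_spatial_action G \<tau>G M T \<longleftrightarrow>
     spatial_action G \<tau>G M T \<and> emeasure M (space M) = 1"

definition nonsingular_spatial_action ::
    "('g, 'm) monoid_scheme \<Rightarrow> 'g topology \<Rightarrow> 'x measure \<Rightarrow> ('g \<Rightarrow> 'x \<Rightarrow> 'x) \<Rightarrow> bool" where
  "nonsingular_spatial_action G \<tau>G M T \<longleftrightarrow>
     standard_measure_space M \<and> borel_action G \<tau>G M T \<and>
     (\<forall>g\<in>carrier G. absolutely_continuous M (distr M M (T g)) \<and>
                      absolutely_continuous (distr M M (T g)) M)"

definition locally_finite_measure :: "'x topology \<Rightarrow> 'x measure \<Rightarrow> bool" where
  "locally_finite_measure \<tau> M \<longleftrightarrow>
     (\<forall>x\<in>topspace \<tau>. \<exists>U. openin \<tau> U \<and> x \<in> U \<and> emeasure M U < \<infinity>)"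

definition locally_finite_polish_action ::
    "('g, 'm) monoid_scheme \<Rightarrow> 'g topology \<Rightarrow> 'x measure \<Rightarrow> 'x topology \<Rightarrow> ('g \<Rightarrow> 'x \<Rightarrow> 'x) \<Rightarrow> bool" where
  "locally_finite_polish_action G \<tau>G M \<tau> T \<longleftrightarrow>
     spatial_action G \<tau>G M T \<and> polish_action G \<tau>G M \<tau> T \<and> locally_finite_measure \<tau> M"

definition locally_finite_polish_nonsingular_action ::
    "('g, 'm) monoid_scheme \<Rightarrow> 'g topology \<Rightarrow> 'x measure \<Rightarrow> 'x topology \<Rightarrow> ('g \<Rightarrow> 'x \<Rightarrow> 'x) \<Rightarrow> bool" where
  "locally_finite_polish_nonsingular_action G \<tau>G M \<tau> T \<longleftrightarrow>
     nonsingular_spatial_action G \<tau>G M T \<and> polish_action G \<tau>G M \<tau> T \<and>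
     locally_finite_measure \<tau> M"

text \<open>
  A Radon--Nikodym derivative is determined only up to null sets, and \<^const>\<open>RN_deriv\<close> is an
  arbitrary version of it.  Continuity of the cocycle therefore means that, for each group
  element, some version is continuous with values in \<open>(0, \<infinity>)\<close>.
\<close>

definition continuous_RN_cocycle ::
    "('g, 'm) monoid_scheme \<Rightarrow> 'x measure \<Rightarrow> 'x topology \<Rightarrow> ('g \<Rightarrow> 'x \<Rightarrow> 'x) \<Rightarrow> bool" where
  "continuous_RN_cocycle G M \<tau> T \<longleftrightarrow>
     (\<forall>g\<in>carrier G. \<exists>f :: 'x \<Rightarrow> real.
        continuous_map \<tau> euclideanreal f \<and> (\<forall>x\<in>topspace \<tau>. 0 < f x) \<and>
        (AE x in M. RN_deriv M (distr M M (T g)) x = ennreal (f x)))"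

definition faithful_action ::
    "('g, 'm) monoid_scheme \<Rightarrow> 'x measure \<Rightarrow> ('g \<Rightarrow> 'x \<Rightarrow> 'x) \<Rightarrow> bool" where
  "faithful_action G M T \<longleftrightarrow>
     (\<forall>g\<in>carrier G. g \<noteq> \<one>\<^bsub>G\<^esub> \<longrightarrow> emeasure M {x \<in> space M. T g x \<noteq> x} > 0)"

definition free_action ::
    "('g, 'm) monoid_scheme \<Rightarrow> 'x measure \<Rightarrow> ('g \<Rightarrow> 'x \<Rightarrow> 'x) \<Rightarrow> bool" where
  "free_action G M T \<longleftrightarrow>
     (\<forall>g\<in>carrier G. g \<noteq> \<one>\<^bsub>G\<^esub> \<longrightarrow> (\<forall>x\<in>space M. T g x \<noteq> x))"

text \<open>
  To say that a group has a free probability preserving action on some standard probability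
  space, a type for the points has to be fixed.  The type below loses no generality: every
  Polish space is homeomorphic to a closed subspace of the countable power of the reals, and
  the carrier \<open>space N\<close> may be any subset of the type.
\<close>

definition admits_free_prob_preserving_action ::
    "('g, 'm) monoid_scheme \<Rightarrow> 'g topology \<Rightarrow> bool" where
  "admits_free_prob_preserving_action G \<tau>G \<longleftrightarrow>
     (\<exists>(N :: (nat \<Rightarrow> real) measure) S.
        prob_preserving_spatial_action G \<tau>G N S \<and> free_action G N S)"

end

theory Submission
  imports Defs
begin

text \<open>
  The proof replaces the given action by a measure preserving one and then lets \<open>G\<close> act on a
  random closed set. A point configuration remembers enough of the space on which \<open>G\<close> acts
  that almost every one has trivial stabilizer, and closed subsets of a Polish space form a
  standard Borel space on which a group of homeomorphisms acts pointwise, so that no null sets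
  have to be discarded for individual group elements.

  \<^emph>\<open>From nonsingular to measure preserving.\<close> A measure preserving action is nonsingular with
  cocycle 1. For a nonsingular action with continuous cocycle \<open>f\<close>, let \<open>S\<close> be the support of \<open>M\<close>.
  On \<open>S\<close> the cocycle identity holds at every point, because it holds almost everywhere and both
  sides are continuous (\<open>cocycle\<close>). Hence \<open>g \<cdot> (x, s) = (T g x, s * f g (T g x))\<close> is
  an action on \<open>S \<times> {0<..}\<close>, the Maharam extension. It preserves \<open>M \<Otimes>\<^sub>M lborel\<close>
  (\<open>ext_action_preserves\<close>) and acts by homeomorphisms. For each point it is Borel measurable in \<open>g\<close>,
  because \<open>f g x\<close> is obtained by comparing the measures \<open>distr M M (T g)\<close> and \<open>M\<close> on small
  neighbourhoods of \<open>x\<close> (\<open>f_group_measurable\<close>).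

  \<^emph>\<open>From measure preserving to probability preserving.\<close> Let \<open>G\<close> act by homeomorphisms on a
  Polish space \<open>Y\<close>, preserving a locally finite measure \<open>\<mu>\<close> of full support without point masses.
  Take a sequence of independent Poisson random sets \<open>F j\<close> in \<open>Y\<close> with intensity \<open>\<mu>\<close>. Each is
  locally finite, hence closed and discrete. The law of the sequence is determined by the
  probabilities \<open>exp (- (\<Sum>j. \<mu> (U j)))\<close> that every \<open>F j\<close> misses the open set \<open>U j\<close>, and these do
  not change when \<open>U\<close> is replaced by its preimage under a group element; so the law is invariant
  (\<open>distr_rigid_law_push\<close>).

  \<^emph>\<open>Freeness.\<close> Suppose that \<open>g\<close> maps every \<open>F j\<close> to itself and moves some point. The points of the
  \<open>F j\<close> are dense, so \<open>g\<close> moves some \<open>x \<in> F i\<close> to another point \<open>z \<in> F i\<close>. If \<open>W\<close> is a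
  neighbourhood of \<open>z\<close> of finite measure, then for each \<open>V\<close> around \<open>x\<close> disjoint from \<open>W\<close> some \<open>F j\<close>
  meets \<open>V\<close> and misses \<open>W\<close>, by independence (\<open>AE_hits_and_misses\<close>). With \<open>V\<close> so small that \<open>g\<close> maps
  \<open>V\<close> into \<open>W\<close> this contradicts the invariance of \<open>F j\<close>. The property used here, \<open>rigid_family\<close>, is
  formulated with isolated points only. In this form it is invariant under all homeomorphisms,
  and it can be tested on a countable base, so that it defines an invariant Borel set of full
  measure (\<open>rigid_codes_borel\<close>, \<open>AE_rigid\<close>). Restricting to this set gives the free action.
\<close>


section \<open>Borel subsets of Polish spaces are standard Borel spaces\<close>

text \<open>
  A Borel map \<open>f\<close> with closed graph makes \<open>B\<close> closed: over the graph, which is a closed subset of a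
  Polish space, \<open>B\<close> is described by \<open>1 \<le> y 0\<close> and its complement by \<open>y 0 = 0\<close>. Leaving out the
  values strictly between 0 and 1 makes both conditions closed.
\<close>

definition has_closed_graph_flag :: "'a::polish_space set \<Rightarrow> bool" where
  "has_closed_graph_flag B \<longleftrightarrow>
     (\<exists>f::'a \<Rightarrow> nat \<Rightarrow> real. f \<in> borel_measurable borel \<and> closed {(x, y). y = f x} \<and>
        (\<forall>x. if x \<in> B then 1 \<le> f x 0 else f x 0 = 0))"

text \<open>
  The reciprocal of the distance to the complement of \<open>U\<close> tends to infinity at the boundary of \<open>U\<close>,
  so that it has a closed graph when it is extended by 0. Truncating the distance at 1 keeps the
  reciprocal away from the interval between 0 and 1.
\<close>

lemma has_closed_graph_flag_open:
  fixes U :: "'a::polish_space set"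
  assumes "open U"
  shows "has_closed_graph_flag U"
proof (cases "U = UNIV")
  case True
  have "closed {(x::'a, y::nat \<Rightarrow> real). y = (\<lambda>_. 1)}"
    unfolding case_prod_beta by (intro closed_Collect_eq continuous_intros)
  then show ?thesis
    unfolding has_closed_graph_flag_def by (intro exI[of _ "\<lambda>_ _. 1"]) (auto simp: True)
next
  case False
  define d where "d x = infdist x (- U)" for x
  define f :: "'a \<Rightarrow> nat \<Rightarrow> real" where "f x = (\<lambda>_. if x \<in> U then 1 / min 1 (d x) else 0)" for x
  have d0: "d x = 0 \<longleftrightarrow> x \<notin> U" for x
    unfolding d_def using False assms by (subst in_closed_iff_infdist_zero[symmetric]) auto
  have dpos: "x \<in> U \<Longrightarrow> 0 < d x" for x
    using d0[of x] infdist_nonneg[of x "- U"] by (auto simp: d_def less_le)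
  have cd: "continuous_on UNIV d" unfolding d_def by (intro continuous_intros)
  have [measurable]: "d \<in> borel_measurable borel"
    using cd by (intro borel_measurable_continuous_onI)
  have [measurable]: "U \<in> sets borel" using assms by simp
  have "closed {p::'a \<times> (nat \<Rightarrow> real). (\<forall>n. snd p n = snd p 0) \<and>
      (min 1 (d (fst p)) * snd p 0 = 1 \<or> (snd p 0 = 0 \<and> d (fst p) = 0))}"
    by (intro closed_Collect_conj closed_Collect_all closed_Collect_disj closed_Collect_eq
        continuous_intros continuous_on_compose2[OF cd]
        continuous_on_compose2[OF continuous_on_product_coordinates continuous_on_snd]) auto
  also have "{p::'a \<times> (nat \<Rightarrow> real). (\<forall>n. snd p n = snd p 0) \<and>
      (min 1 (d (fst p)) * snd p 0 = 1 \<or> (snd p 0 = 0 \<and> d (fst p) = 0))} = {(x, y). y = f x}"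
  proof -
    have "y = f x" if c: "\<forall>n. y n = y 0" and "min 1 (d x) * y 0 = 1 \<or> y 0 = 0 \<and> d x = 0"
      for x and y :: "nat \<Rightarrow> real"
    proof -
      from that have "y 0 = f x 0" using d0[of x] dpos[of x]
        by (cases "x \<in> U") (auto simp: f_def field_simps)
      then show "y = f x" using c by (auto simp: f_def fun_eq_iff)
    qed
    moreover have "(\<forall>n. f x n = f x 0) \<and> (min 1 (d x) * f x 0 = 1 \<or> f x 0 = 0 \<and> d x = 0)" for x
      using d0[of x] dpos[of x] by (auto simp: f_def)
    ultimately have "(\<forall>n. y n = y 0) \<and> (min 1 (d x) * y 0 = 1 \<or> y 0 = 0 \<and> d x = 0) \<longleftrightarrow> y = f x"
      for x y by blast
    then show ?thesis by (simp add: set_eq_iff)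
  qed
  finally have cl: "closed {(x, y). y = f x}" .
  have "f \<in> borel_measurable borel"
    unfolding f_def by (intro measurable_coordinatewise_then_product) measurable
  moreover have "x \<in> U \<Longrightarrow> 1 \<le> f x 0" for x
    using dpos[of x] by (auto simp: f_def field_simps)
  ultimately show ?thesis
    unfolding has_closed_graph_flag_def using cl by (intro exI[of _ f]) (auto simp: f_def)
qed

lemma measurable_coordinate_nat_real [measurable]:
  "(\<lambda>c::nat \<Rightarrow> real. c k) \<in> borel_measurable borel"
  by (intro borel_measurable_continuous_onI continuous_on_product_coordinates)

lemma has_closed_graph_flag_Compl:
  fixes B :: "'a::polish_space set"
  assumes "has_closed_graph_flag B"
  shows "has_closed_graph_flag (- B)"
proof -
  obtain f :: "'a \<Rightarrow> nat \<Rightarrow> real" where f [measurable]: "f \<in> borel_measurable borel"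
    and cl: "closed {(x, y). y = f x}" and fB: "\<And>x. if x \<in> B then 1 \<le> f x 0 else f x 0 = 0"
    using assms unfolding has_closed_graph_flag_def by auto
  define g :: "'a \<Rightarrow> nat \<Rightarrow> real" where
    "g x n = (case n of 0 \<Rightarrow> if f x 0 = 0 then 1 else 0 | Suc m \<Rightarrow> f x m)" for x n
  have [measurable]: "(\<lambda>x. f x n) \<in> borel_measurable borel" for n
    using measurable_compose[OF f measurable_coordinate_nat_real] .
  have meas: "g \<in> borel_measurable borel"
  proof (intro measurable_coordinatewise_then_product)
    fix n show "(\<lambda>x. g x n) \<in> borel_measurable borel"
      by (cases n) (simp_all add: g_def)
  qed
  have cc: "continuous_on UNIV (\<lambda>p::'a \<times> (nat \<Rightarrow> real). snd p n)" for n
    by (rule continuous_on_compose2[OF continuous_on_product_coordinates continuous_on_snd]) (auto intro: continuous_on_id)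
  have "closed ((\<lambda>p::'a \<times> (nat \<Rightarrow> real). (fst p, \<lambda>m. snd p (Suc m))) -` {(x, y). y = f x}
      \<inter> {p. (snd p 0 = 0 \<and> 1 \<le> snd p 1) \<or> (snd p 0 = 1 \<and> snd p 1 = 0)})"
    by (intro closed_Int closed_vimage cl closed_Collect_disj closed_Collect_conj closed_Collect_eq
        closed_Collect_le continuous_on_Pair continuous_on_coordinatewise_then_product cc
        continuous_on_fst continuous_on_id continuous_on_const)
  also have "((\<lambda>p::'a \<times> (nat \<Rightarrow> real). (fst p, \<lambda>m. snd p (Suc m))) -` {(x, y). y = f x}
      \<inter> {p. (snd p 0 = 0 \<and> 1 \<le> snd p 1) \<or> (snd p 0 = 1 \<and> snd p 1 = 0)}) = {(x, y). y = g x}"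
  proof -
    have "y n = g x n" if e: "(\<lambda>m. y (Suc m)) = f x"
      and y: "y 0 = 0 \<and> 1 \<le> y (Suc 0) \<or> y 0 = 1 \<and> y (Suc 0) = 0"
      for x n and y :: "nat \<Rightarrow> real"
      using fun_cong[OF e, of "n - 1"] fun_cong[OF e, of 0] y
      by (cases n) (auto simp: g_def)
    then have "y = g x" if "(\<lambda>m. y (Suc m)) = f x"
      and "y 0 = 0 \<and> 1 \<le> y (Suc 0) \<or> y 0 = 1 \<and> y (Suc 0) = 0"
      for x and y :: "nat \<Rightarrow> real" using that by (intro ext) blast
    moreover have "(\<lambda>m. g x (Suc m)) = f x \<and>
         (g x 0 = 0 \<and> 1 \<le> g x (Suc 0) \<or> g x 0 = 1 \<and> g x (Suc 0) = 0)" for x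
      using fB[of x] by (auto simp: g_def split: if_splits)
    ultimately have "(\<lambda>m. y (Suc m)) = f x \<and>
         (y 0 = 0 \<and> 1 \<le> y (Suc 0) \<or> y 0 = 1 \<and> y (Suc 0) = 0) \<longleftrightarrow> y = g x" for x y by blast
    then show ?thesis by (simp add: set_eq_iff)
  qed
  finally have cl': "closed {(x, y). y = g x}" .
  have "if x \<in> - B then 1 \<le> g x 0 else g x 0 = 0" for x
    using fB[of x] by (auto simp: g_def split: if_splits)
  then show ?thesis
    unfolding has_closed_graph_flag_def using meas cl' by (intro exI[of _ g]) auto
qed

text \<open>
  The new map stores all given maps and, as its flag, one more than the least index of a set that
  contains the point, or 0 outside the union. For a fixed value of the flag its correctness is a closed condition on the
  stored values, and these countably many conditions combine to a closed one since the flag is an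
  integer and distinct integers have distance at least 1.
\<close>

lemma has_closed_graph_flag_UN:
  fixes B :: "nat \<Rightarrow> 'a::polish_space set"
  assumes "\<And>i. has_closed_graph_flag (B i)"
  shows "has_closed_graph_flag (\<Union>i. B i)"
proof -
  have "\<forall>i. \<exists>f::'a \<Rightarrow> nat \<Rightarrow> real. f \<in> borel_measurable borel \<and> closed {(x, y). y = f x} \<and>
        (\<forall>x. if x \<in> B i then 1 \<le> f x 0 else f x 0 = 0)"
    using assms unfolding has_closed_graph_flag_def by auto
  then obtain f :: "nat \<Rightarrow> 'a \<Rightarrow> nat \<Rightarrow> real" where f [measurable]: "\<And>i. f i \<in> borel_measurable borel"
    and cl: "\<And>i. closed {(x, y). y = f i x}"
    and fB: "\<And>i x. if x \<in> B i then 1 \<le> f i x 0 else f i x 0 = 0"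
    by metis
  have [measurable]: "(\<lambda>x. f i x n) \<in> borel_measurable borel" for i n
    using measurable_compose[OF f measurable_coordinate_nat_real] .
  have iff: "x \<in> B i \<longleftrightarrow> f i x 0 \<noteq> 0" "x \<in> B i \<longleftrightarrow> 1 \<le> f i x 0" for x i
    using fB[of x i] by (auto split: if_splits)
  define w :: "'a \<Rightarrow> nat" where
    "w x = (if \<exists>i. f i x 0 \<noteq> 0 then Suc (LEAST i. f i x 0 \<noteq> 0) else 0)" for x
  define g :: "'a \<Rightarrow> nat \<Rightarrow> real" where
    "g x n = (case n of 0 \<Rightarrow> real (w x)
       | Suc k \<Rightarrow> f (fst (prod_decode k)) x (snd (prod_decode k)))" for x n
  have [measurable]: "w \<in> borel \<rightarrow>\<^sub>M count_space UNIV"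
    unfolding w_def by measurable
  have meas: "g \<in> borel_measurable borel"
  proof (intro measurable_coordinatewise_then_product)
    fix n show "(\<lambda>x. g x n) \<in> borel_measurable borel"
      by (cases n) (simp_all add: g_def)
  qed
  define e where "e i m = Suc (prod_encode (i, m))" for i m
  have ge: "g x (e i m) = f i x m" for x i m by (simp add: g_def e_def)
  \<comment> \<open>\<open>P k y\<close> says that \<open>k\<close> is the correct flag for the stored values \<open>y\<close>.\<close>
  define P :: "nat \<Rightarrow> (nat \<Rightarrow> real) \<Rightarrow> bool" where
    "P k y = (case k of 0 \<Rightarrow> (\<forall>i. y (e i 0) = 0)
        | Suc k \<Rightarrow> 1 \<le> y (e k 0) \<and> (\<forall>i. i < k \<longrightarrow> y (e i 0) = 0))" for k y
  have cc: "continuous_on UNIV (\<lambda>p::'a \<times> (nat \<Rightarrow> real). snd p n)" for n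
    by (rule continuous_on_compose2[OF continuous_on_product_coordinates continuous_on_snd]) (auto intro: continuous_on_id)
  have clP: "closed {p::'a \<times> (nat \<Rightarrow> real). P k (snd p)}" for k
    unfolding P_def
    by (cases k) (auto intro!: closed_Collect_all closed_Collect_conj closed_Collect_le
        closed_Collect_eq closed_Collect_imp open_Collect_const cc continuous_on_const)
  let ?C = "(\<Inter>i. (\<lambda>p::'a \<times> (nat \<Rightarrow> real). (fst p, \<lambda>m. snd p (e i m))) -` {(x, y). y = f i x})
      \<inter> {p. snd p 0 \<in> \<nat>} \<inter> {p. \<forall>k. 1 \<le> \<bar>snd p 0 - real k\<bar> \<or> P k (snd p)}"
  have "{p::'a \<times> (nat \<Rightarrow> real). snd p 0 \<in> \<nat>} = (\<lambda>p. snd p 0) -` \<nat>" by auto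
  then have "closed {p::'a \<times> (nat \<Rightarrow> real). snd p 0 \<in> \<nat>}"
    using closed_vimage[OF closed_Nats cc[of 0]] by simp
  then have "closed ?C"
    by (intro closed_Int closed_INT closed_vimage cl closed_Collect_disj closed_Collect_all ballI
        closed_Collect_le continuous_on_Pair continuous_on_coordinatewise_then_product cc clP
        continuous_intros)
  also have "?C = {(x, y). y = g x}"
  proof -
    have "y = g x" if fx: "\<forall>i. (\<lambda>m. y (e i m)) = f i x" and yN: "y 0 \<in> \<nat>"
      and Pk: "\<forall>k. 1 \<le> \<bar>y 0 - real k\<bar> \<or> P k y" for x and y :: "nat \<Rightarrow> real"
    proof -
      from yN obtain k where k: "y 0 = real k" by (auto elim: Nats_cases)
      with Pk have "P k y" by (metis abs_zero diff_self not_one_le_zero)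
      moreover have yf: "y (e i m) = f i x m" for i m using fx by (metis (no_types))
      ultimately have "w x = k"
      proof (cases k)
        case 0
        then show ?thesis using \<open>P k y\<close> by (simp add: w_def P_def yf)
      next
        case (Suc l)
        then have l: "f l x 0 \<noteq> 0" "\<And>i. i < l \<Longrightarrow> f i x 0 = 0"
          using \<open>P k y\<close> by (auto simp: P_def yf)
        then have "(LEAST i. f i x 0 \<noteq> 0) = l"
          by (intro Least_equality) (auto simp: not_less[symmetric])
        then show ?thesis using l(1) by (auto simp: w_def Suc)
      qed
      then have "y n = g x n" for n
        using k yf[of "fst (prod_decode (n-1))" "snd (prod_decode (n-1))"]
        by (cases n) (auto simp: g_def e_def)
      then show "y = g x" by auto
    qed
    moreover have "(\<forall>i. (\<lambda>m. g x (e i m)) = f i x) \<and> g x 0 \<in> \<nat> \<and>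
        (\<forall>k. 1 \<le> \<bar>g x 0 - real k\<bar> \<or> P k (g x))" for x
    proof -
      have "P (w x) (g x)"
      proof (cases "\<exists>i. f i x 0 \<noteq> 0")
        case True
        then have "f (LEAST i. f i x 0 \<noteq> 0) x 0 \<noteq> 0" by (rule LeastI_ex)
        then show ?thesis using True iff not_less_Least by (fastforce simp: P_def ge w_def)
      qed (auto simp: P_def ge w_def)
      moreover have "1 \<le> \<bar>real (w x) - real k\<bar>" if "w x \<noteq> k" for k using that by linarith
      moreover have "g x 0 = real (w x)" by (simp add: g_def)
      ultimately have "g x 0 \<in> \<nat>" "1 \<le> \<bar>g x 0 - real k\<bar> \<or> P k (g x)" for k
        by (auto, cases "w x = k") auto
      then show ?thesis by (auto simp: ge)
    qed
    ultimately have "(\<forall>i. (\<lambda>m. y (e i m)) = f i x) \<and> y 0 \<in> \<nat> \<and>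
        (\<forall>k. 1 \<le> \<bar>y 0 - real k\<bar> \<or> P k y) \<longleftrightarrow> y = g x" for x y by blast
    then show ?thesis by (simp add: set_eq_iff conj_assoc)
  qed
  finally have cl': "closed {(x, y). y = g x}" .
  have "if x \<in> (\<Union>i. B i) then 1 \<le> g x 0 else g x 0 = 0" for x
    using iff(1)[of x] by (auto simp: g_def w_def)
  then show ?thesis
    unfolding has_closed_graph_flag_def using meas cl' by (intro exI[of _ g]) auto
qed

lemma borel_has_closed_graph_flag:
  fixes B :: "'a::polish_space set"
  assumes "B \<in> sets borel"
  shows "has_closed_graph_flag B"
proof -
  have "B \<in> sigma_sets UNIV {S. open S}"
    using assms by (simp add: borel_def)
  then show ?thesis
  proof induction
    case Empty
    show ?case by (rule has_closed_graph_flag_open) simp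
  next
    case (Compl a)
    then show ?case using has_closed_graph_flag_Compl by (simp add: Compl_eq_Diff_UNIV)
  qed (auto intro: has_closed_graph_flag_open has_closed_graph_flag_UN)
qed

lemma borel_of_top_sets: "sets (borel_of_top X) = sigma_sets (topspace X) {U. openin X U}"
  unfolding borel_of_top_def by (intro sets_measure_of) (auto dest: openin_subset)

lemma space_borel_of_top [simp]: "space (borel_of_top X) = topspace X"
  unfolding borel_of_top_def by (intro space_measure_of) (auto dest: openin_subset)

lemma borel_of_top_openin: "openin X U \<Longrightarrow> U \<in> sets (borel_of_top X)"
  by (simp add: borel_of_top_sets sigma_sets.Basic)

lemma second_countable_euclidean:
  "second_countable (euclidean :: 'a::second_countable_topology topology)"
proof -
  obtain \<B> :: "'a set set"
    where \<B>: "countable \<B>" "\<And>C. C \<in> \<B> \<Longrightarrow> open C" "\<And>S. open S \<Longrightarrow> \<exists>U. U \<subseteq> \<B> \<and> S = \<Union>U"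
    using univ_second_countable[where ?'a='a] by blast
  show ?thesis unfolding second_countable_def
  proof (intro exI[of _ \<B>] conjI ballI allI impI)
    fix U and x :: 'a assume "openin euclidean U \<and> x \<in> U"
    then obtain \<U> where "\<U> \<subseteq> \<B>" "U = \<Union>\<U>" "x \<in> U"
      using \<B>(3)[of U] unfolding open_openin[symmetric] by blast
    then show "\<exists>V\<in>\<B>. x \<in> V \<and> V \<subseteq> U" by blast
  qed (use \<B>(1,2) in \<open>simp_all only: open_openin[symmetric]\<close>)
qed

text \<open>
  The topology on \<open>B\<close> is pulled back from the part of the closed graph that lies over \<open>B\<close>. It refines
  the given topology, and it creates no new Borel sets because the map whose graph is used is Borel.
\<close>

theorem borel_subset_standard:
  fixes B :: "'a::polish_space set" and N :: "'a measure"
  assumes B: "B \<in> sets borel" and N: "space N = B" "sets N = sets (restrict_space borel B)"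
  shows "standard_borel_space N"
proof -
  obtain f :: "'a \<Rightarrow> nat \<Rightarrow> real" where f [measurable]: "f \<in> borel_measurable borel"
    and cl: "closed {(x, y). y = f x}" and fB: "\<And>x. if x \<in> B then 1 \<le> f x 0 else f x 0 = 0"
    using borel_has_closed_graph_flag[OF B] unfolding has_closed_graph_flag_def by auto
  define h where "h x = (x, f x)" for x
  have inj: "inj_on h B" by (auto simp: h_def inj_on_def)
  have cc: "continuous_on UNIV (\<lambda>p::'a \<times> (nat \<Rightarrow> real). snd p 0)"
    by (rule continuous_on_compose2[OF continuous_on_product_coordinates continuous_on_snd]) (auto intro: continuous_on_id)
  have "closed ({(x, y). y = f x} \<inter> {p. 1 \<le> snd p 0})"
    by (intro closed_Int cl closed_Collect_le cc continuous_on_const)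
  also have "{(x, y). y = f x} \<inter> {p. 1 \<le> snd p 0} = h ` B"
    using fB by (force simp: h_def split: if_splits)
  finally have clh: "closed (h ` B)" .
  define \<tau> where "\<tau> = pullback_topology B h euclidean"
  have ts: "topspace \<tau> = B" by (simp add: \<tau>_def topspace_pullback_topology)
  have hom: "homeomorphic_map \<tau> (top_of_set (h ` B)) h"
    unfolding homeomorphic_map_def quotient_map_def ts
  proof (intro conjI allI impI)
    fix U assume U: "U \<subseteq> topspace (top_of_set (h ` B))"
    have U': "U \<subseteq> h ` B" using U by simp
    have iff: "{x \<in> B. h x \<in> U} = h -` O' \<inter> B \<longleftrightarrow> U = O' \<inter> h ` B" for O'
    proof
      assume e: "{x \<in> B. h x \<in> U} = h -` O' \<inter> B"
      have "U = h ` {x \<in> B. h x \<in> U}" using U' by blast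
      then show "U = O' \<inter> h ` B" unfolding e by blast
    next
      assume e: "U = O' \<inter> h ` B"
      show "{x \<in> B. h x \<in> U} = h -` O' \<inter> B" unfolding e by blast
    qed
    show "openin \<tau> {x \<in> B. h x \<in> U} = openin (top_of_set (h ` B)) U"
      unfolding openin_subtopology \<tau>_def openin_pullback_topology iff ..
  next
    show "h ` B = topspace (top_of_set (h ` B))" by simp
    show "inj_on h B" by (rule inj)
  qed
  then have hs: "\<tau> homeomorphic_space top_of_set (h ` B)"
    using homeomorphic_map_imp_homeomorphic_space by blast
  have "completely_metrizable_space (top_of_set (h ` B))"
    using clh by (intro completely_metrizable_space_closedin completely_metrizable_space_euclidean) auto
  moreover have "second_countable (top_of_set (h ` B))"
    by (rule second_countable_subtopology[OF second_countable_euclidean])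
  ultimately have pol: "polish_topology \<tau>"
    using homeomorphic_completely_metrizable_space[OF hs] homeomorphic_space_second_countability[OF hs]
    unfolding polish_topology_def by simp
  have hm: "h \<in> borel_measurable borel"
    unfolding h_def by (intro borel_measurable_Pair) measurable
  have "sets (borel_of_top \<tau>) = sets (restrict_space borel B)"
  proof (rule antisym)
    show "sets (borel_of_top \<tau>) \<subseteq> sets (restrict_space borel B)"
    proof -
      have "U \<in> sets (restrict_space borel B)" if "openin \<tau> U" for U
      proof -
        obtain O' where "open O'" and U: "U = h -` O' \<inter> B"
          using \<open>openin \<tau> U\<close> unfolding \<tau>_def openin_pullback_topology by auto
        then have "h -` O' \<in> sets borel"
          using measurable_sets[OF hm, of O'] by (simp add: \<open>open O'\<close>)
        then show ?thesis using B unfolding U by (auto simp: sets_restrict_space)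
      qed
      then have "{U. openin \<tau> U} \<subseteq> sets (restrict_space borel B)" by auto
      from sets.sigma_sets_subset[OF this] show ?thesis
        by (simp add: borel_of_top_sets ts space_restrict_space)
    qed
  next
    have idm: "id \<in> borel_of_top \<tau> \<rightarrow>\<^sub>M borel"
    proof (rule borel_measurableI)
      fix S :: "'a set" assume "open S"
      have "S \<inter> B = h -` (S \<times> UNIV) \<inter> B" by (auto simp: h_def)
      moreover have "open (S \<times> (UNIV :: (nat \<Rightarrow> real) set))" using \<open>open S\<close> by (intro open_Times) auto
      ultimately have "openin \<tau> (S \<inter> B)"
        unfolding \<tau>_def openin_pullback_topology open_openin[symmetric] by blast
      then show "id -` S \<inter> space (borel_of_top \<tau>) \<in> sets (borel_of_top \<tau>)"
        by (simp add: ts borel_of_top_openin)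
    qed
    have "S \<inter> B \<in> sets (borel_of_top \<tau>)" if "S \<in> sets borel" for S
      using measurable_sets[OF idm that] by (simp add: ts)
    then show "sets (restrict_space borel B) \<subseteq> sets (borel_of_top \<tau>)"
      by (auto simp: sets_restrict_space Int_commute)
  qed
  then show ?thesis
    unfolding standard_borel_space_def generates_borel_def using pol N ts by (intro exI[of _ \<tau>]) auto
qed


section \<open>Poisson random sets\<close>

text \<open>
  The probability that a Poisson random set with intensity \<open>\<nu>\<close> has no point in \<open>A\<close>.
\<close>

definition void_prob :: "'z measure \<Rightarrow> 'z set \<Rightarrow> real" where
  "void_prob \<nu> A = (if emeasure \<nu> A = \<infinity> then 0 else exp (- measure \<nu> A))"

text \<open>
  Draw a Poisson distributed number of independent points uniformly from \<open>D\<close>. Given that the number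
  is \<open>n\<close>, the set \<open>A\<close> is missed with probability \<open>q ^ n\<close>, where \<open>q\<close> is the relative measure of the
  complement of \<open>A\<close> in \<open>D\<close>; averaging over \<open>n\<close> gives an exponential series.
\<close>

lemma finite_poisson_set:
  fixes \<nu> :: "'z measure"
  assumes D: "D \<in> sets \<nu>" and fin: "emeasure \<nu> D < \<infinity>"
  shows "\<exists>(\<Omega> :: (nat \<times> (nat \<Rightarrow> 'z)) measure) \<xi>. prob_space \<Omega> \<and>
    (\<forall>\<omega>. finite (\<xi> \<omega>) \<and> \<xi> \<omega> \<subseteq> D) \<and>
    (\<forall>A\<in>sets \<nu>. {\<omega>\<in>space \<Omega>. \<xi> \<omega> \<inter> A = {}} \<in> sets \<Omega> \<and>
       measure \<Omega> {\<omega>\<in>space \<Omega>. \<xi> \<omega> \<inter> A = {}} = exp (- measure \<nu> (A \<inter> D)))"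
proof (cases "measure \<nu> D = 0")
  case True
  have z: "measure \<nu> (A \<inter> D) = 0" if "A \<in> sets \<nu>" for A
  proof -
    have "measure \<nu> (A \<inter> D) \<le> measure \<nu> D"
      using D that fin by (intro measure_mono_fmeasurable) (auto simp: fmeasurable_def)
    then show ?thesis using True by (simp add: measure_le_0_iff)
  qed
  let ?\<Omega> = "return (count_space UNIV) undefined :: (nat \<times> (nat \<Rightarrow> 'z)) measure"
  interpret prob_space ?\<Omega> by (rule prob_space_return) simp
  show ?thesis
    using prob_space by (intro exI[of _ ?\<Omega>] exI[of _ "\<lambda>_. {}"])
      (simp add: prob_space_axioms z)
next
  case False
  define m where "m = measure \<nu> D"
  have m: "m > 0" using False by (simp add: m_def zero_less_measure_iff)
  have em: "emeasure \<nu> D = ennreal m"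
    unfolding m_def using fin by (intro emeasure_eq_ennreal_measure) auto
  define \<rho> where "\<rho> = uniform_measure \<nu> D"
  have sr [simp, measurable_cong]: "sets \<rho> = sets \<nu>" by (simp add: \<rho>_def)
  have spr [simp]: "space \<rho> = space \<nu>" by (simp add: \<rho>_def)
  interpret \<rho>: prob_space \<rho>
    unfolding \<rho>_def using em m fin by (intro prob_space_uniform_measure) auto
  interpret S: sequence_space \<rho> by unfold_locales
  define \<Omega> where "\<Omega> = measure_pmf (poisson_pmf m) \<Otimes>\<^sub>M (\<Pi>\<^sub>M i\<in>UNIV::nat set. \<rho>)"
  interpret P: pair_prob_space "measure_pmf (poisson_pmf m)" "\<Pi>\<^sub>M i\<in>UNIV::nat set. \<rho>"
    by unfold_locales
  \<comment> \<open>Points outside \<open>D\<close> occur with probability 0; they are removed to have the inclusion for every sample.\<close>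
  define \<xi> :: "nat \<times> (nat \<Rightarrow> 'z) \<Rightarrow> 'z set" where "\<xi> = (\<lambda>(n, x). x ` {..<n} \<inter> D)"
  have main: "{\<omega>\<in>space \<Omega>. \<xi> \<omega> \<inter> A = {}} \<in> sets \<Omega> \<and>
       measure \<Omega> {\<omega>\<in>space \<Omega>. \<xi> \<omega> \<inter> A = {}} = exp (- measure \<nu> (A \<inter> D))"
    if A [measurable]: "A \<in> sets \<nu>" for A
  proof -
    define C where "C = space \<nu> - A \<inter> D"
    define a where "a = measure \<nu> (A \<inter> D)"
    have C [measurable]: "C \<in> sets \<nu>" using D A by (auto simp: C_def)
    let ?E = "{\<omega>\<in>space \<Omega>. \<xi> \<omega> \<inter> A = {}}"
    have E: "?E = {\<omega>\<in>space \<Omega>. \<forall>i<fst \<omega>. snd \<omega> i \<in> C}"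
      by (auto simp: \<Omega>_def space_pair_measure space_PiM \<xi>_def C_def image_subset_iff
          disjoint_iff PiE_iff)
    have [measurable]: "fst \<in> \<Omega> \<rightarrow>\<^sub>M count_space UNIV"
    proof -
      have "fst \<in> \<Omega> \<rightarrow>\<^sub>M measure_pmf (poisson_pmf m)" unfolding \<Omega>_def by (rule measurable_fst)
      then show ?thesis by simp
    qed
    have [measurable]: "(\<lambda>\<omega>. snd \<omega> i) \<in> \<Omega> \<rightarrow>\<^sub>M \<nu>" for i
    proof -
      have "(\<lambda>\<omega>. snd \<omega> i) \<in> \<Omega> \<rightarrow>\<^sub>M \<rho>"
        unfolding \<Omega>_def by (rule measurable_compose[OF measurable_snd measurable_component_singleton]) simp
      then show ?thesis using measurable_cong_sets[OF refl sr, of \<Omega>] by simp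
    qed
    have Em: "?E \<in> sets \<Omega>"
      unfolding E by measurable
    have q: "measure \<rho> C = 1 - a / m"
    proof -
      have "measure \<rho> C = measure \<rho> (space \<rho> - A \<inter> D)" by (simp add: C_def)
      also have "\<dots> = 1 - measure \<rho> (A \<inter> D)" using D A by (subst \<rho>.prob_compl) auto
      also have "measure \<rho> (A \<inter> D) = a / m"
        unfolding \<rho>_def using D A fin em m
        by (subst measure_uniform_measure) (auto simp: a_def m_def Int_ac)
      finally show ?thesis .
    qed
    have "emeasure \<Omega> ?E = (\<integral>\<^sup>+n. emeasure S.S (Pair n -` ?E) \<partial>measure_pmf (poisson_pmf m))"
      using Em unfolding \<Omega>_def by (rule S.emeasure_pair_measure_alt)
    also have "\<dots> = (\<integral>\<^sup>+n. ennreal (measure \<rho> C ^ n) \<partial>measure_pmf (poisson_pmf m))"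
    proof (rule nn_integral_cong)
      fix n
      have "Pair n -` ?E = {x\<in>space S.S. \<forall>i\<in>{..<n}. x i \<in> C}"
        unfolding E by (auto simp: \<Omega>_def space_pair_measure)
      also have "emeasure S.S \<dots> = (\<Prod>i\<in>{..<n}. emeasure \<rho> C)"
        by (rule S.emeasure_PiM_Collect) (use C in auto)
      also have "\<dots> = ennreal (measure \<rho> C ^ n)"
        by (simp add: \<rho>.emeasure_eq_measure ennreal_power)
      finally show "emeasure S.S (Pair n -` ?E) = ennreal (measure \<rho> C ^ n)" .
    qed
    also have "\<dots> = (\<Sum>n. ennreal (m ^ n / fact n * exp (- m) * measure \<rho> C ^ n))"
      using m by (simp add: nn_integral_measure_pmf nn_integral_count_space_nat ennreal_mult[symmetric])
    also have "\<dots> = ennreal (exp (- a))"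
    proof (rule suminf_ennreal_eq)
      have "(\<lambda>n. exp (- m) * ((m * measure \<rho> C) ^ n /\<^sub>R fact n)) sums (exp (- m) * exp (m * measure \<rho> C))"
        by (intro sums_mult exp_converges)
      moreover have "exp (- m) * exp (m * measure \<rho> C) = exp (- a)"
        unfolding q exp_add[symmetric] using m by (simp add: field_simps)
      ultimately show "(\<lambda>n. m ^ n / fact n * exp (- m) * measure \<rho> C ^ n) sums exp (- a)"
        by (simp add: power_mult_distrib field_simps)
    qed (use m in auto)
    finally show ?thesis using Em by (simp add: measure_def a_def)
  qed
  show ?thesis
    by (intro exI[of _ \<Omega>] exI[of _ \<xi>] conjI ballI allI)
      (use main in \<open>auto simp: \<xi>_def \<Omega>_def P.prob_space_axioms\<close>)
qed

text \<open>
  The superposition of independent finite Poisson sets in the disjoint pieces \<open>disjointed C k\<close>. Only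
  the pieces up to index \<open>k\<close> meet \<open>C k\<close>, so the random set is finite in each \<open>C k\<close> for every sample
  and not merely almost surely. The probability of missing \<open>A\<close> is an infinite product, which tends
  to 0 exactly if \<open>A\<close> has infinite measure.
\<close>

theorem poisson_set_exists:
  fixes \<nu> :: "'z measure" and C :: "nat \<Rightarrow> 'z set"
  assumes C: "\<And>k. C k \<in> sets \<nu>" and fin: "\<And>k. emeasure \<nu> (C k) < \<infinity>"
  shows "\<exists>(\<Omega> :: (nat \<Rightarrow> nat \<times> (nat \<Rightarrow> 'z)) measure) \<xi>. prob_space \<Omega> \<and>
    (\<forall>\<omega>. \<xi> \<omega> \<subseteq> (\<Union>k. C k) \<and> (\<forall>k. finite (\<xi> \<omega> \<inter> C k))) \<and>
    (\<forall>A\<in>sets \<nu>. A \<subseteq> (\<Union>k. C k) \<longrightarrow> {\<omega>\<in>space \<Omega>. \<xi> \<omega> \<inter> A = {}} \<in> sets \<Omega> \<and>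
       measure \<Omega> {\<omega>\<in>space \<Omega>. \<xi> \<omega> \<inter> A = {}} = void_prob \<nu> A)"
proof -
  define D where "D = disjointed C"
  have DC: "D k \<subseteq> C k" for k by (simp add: D_def disjointed_subset)
  have D: "D k \<in> sets \<nu>" for k
    using sets.range_disjointed_sets[of C \<nu>] C by (auto simp: D_def)
  have finD: "emeasure \<nu> (D k) < \<infinity>" for k
    by (rule le_less_trans[OF emeasure_mono[OF DC C] fin])
  have "\<forall>k. \<exists>(\<Omega> :: (nat \<times> (nat \<Rightarrow> 'z)) measure) \<xi>. prob_space \<Omega> \<and>
    (\<forall>\<omega>. finite (\<xi> \<omega>) \<and> \<xi> \<omega> \<subseteq> D k) \<and>
    (\<forall>A\<in>sets \<nu>. {\<omega>\<in>space \<Omega>. \<xi> \<omega> \<inter> A = {}} \<in> sets \<Omega> \<and>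
       measure \<Omega> {\<omega>\<in>space \<Omega>. \<xi> \<omega> \<inter> A = {}} = exp (- measure \<nu> (A \<inter> D k)))"
    by (intro allI finite_poisson_set D finD)
  from choice[OF this] obtain W :: "nat \<Rightarrow> (nat \<times> (nat \<Rightarrow> 'z)) measure" where
    "\<forall>k. \<exists>\<xi>. prob_space (W k) \<and>
    (\<forall>\<omega>. finite (\<xi> \<omega>) \<and> \<xi> \<omega> \<subseteq> D k) \<and>
    (\<forall>A\<in>sets \<nu>. {\<omega>\<in>space (W k). \<xi> \<omega> \<inter> A = {}} \<in> sets (W k) \<and>
       measure (W k) {\<omega>\<in>space (W k). \<xi> \<omega> \<inter> A = {}} = exp (- measure \<nu> (A \<inter> D k)))" ..
  from choice[OF this] obtain X where WX: "\<forall>k. prob_space (W k) \<and>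
    (\<forall>\<omega>. finite (X k \<omega>) \<and> X k \<omega> \<subseteq> D k) \<and>
    (\<forall>A\<in>sets \<nu>. {\<omega>\<in>space (W k). X k \<omega> \<inter> A = {}} \<in> sets (W k) \<and>
       measure (W k) {\<omega>\<in>space (W k). X k \<omega> \<inter> A = {}} = exp (- measure \<nu> (A \<inter> D k)))" ..
  then have W: "\<And>k. prob_space (W k)"
    and X: "\<And>k \<omega>. finite (X k \<omega>)" "\<And>k \<omega>. X k \<omega> \<subseteq> D k"
    and XA: "\<And>k A. A \<in> sets \<nu> \<Longrightarrow> {\<omega>\<in>space (W k). X k \<omega> \<inter> A = {}} \<in> sets (W k)"
        "\<And>k A. A \<in> sets \<nu> \<Longrightarrow>
          measure (W k) {\<omega>\<in>space (W k). X k \<omega> \<inter> A = {}} = exp (- measure \<nu> (A \<inter> D k))"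
    by blast+
  interpret W: prob_space "W k" for k by (rule W)
  interpret P: product_prob_space W UNIV ..
  define \<xi> where "\<xi> \<omega> = (\<Union>k. X k (\<omega> k))" for \<omega>
  have sub: "\<xi> \<omega> \<subseteq> (\<Union>k. C k)" for \<omega>
    unfolding \<xi>_def using X(2) DC by blast
  have fin\<xi>: "finite (\<xi> \<omega> \<inter> C k)" for \<omega> k
  proof (rule finite_subset)
    show "\<xi> \<omega> \<inter> C k \<subseteq> (\<Union>i\<in>{..k}. X i (\<omega> i))"
    proof
      fix z assume z: "z \<in> \<xi> \<omega> \<inter> C k"
      then obtain i where i: "z \<in> X i (\<omega> i)" by (auto simp: \<xi>_def)
      then have "z \<in> D i" using X(2) by blast
      then have "i \<le> k" using z by (force simp: D_def disjointed_def not_le)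
      then show "z \<in> (\<Union>i\<in>{..k}. X i (\<omega> i))" using i by auto
    qed
  qed (use X(1) in auto)
  have void: "{\<omega>\<in>space (Pi\<^sub>M UNIV W). \<xi> \<omega> \<inter> A = {}} \<in> sets (Pi\<^sub>M UNIV W) \<and>
      measure (Pi\<^sub>M UNIV W) {\<omega>\<in>space (Pi\<^sub>M UNIV W). \<xi> \<omega> \<inter> A = {}} = void_prob \<nu> A"
    if A: "A \<in> sets \<nu>" "A \<subseteq> (\<Union>k. C k)" for A
  proof -
    define E where "E k = {\<omega>\<in>space (W k). X k \<omega> \<inter> A = {}}" for k
    have E: "E k \<in> sets (W k)" for k unfolding E_def by (rule XA(1)[OF A(1)])
    define F where "F n = {\<omega>\<in>space (Pi\<^sub>M UNIV W). \<forall>i\<in>{..<n}. \<omega> i \<in> E i}" for n :: nat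
    have F: "F n \<in> sets (Pi\<^sub>M UNIV W)" for n
      unfolding F_def using E by measurable
    have eq: "{\<omega>\<in>space (Pi\<^sub>M UNIV W). \<xi> \<omega> \<inter> A = {}} = (\<Inter>n. F n)"
      by (auto simp: F_def E_def \<xi>_def space_PiM)
    define a where "a i = measure \<nu> (A \<inter> D i)" for i
    have mF: "measure (Pi\<^sub>M UNIV W) (F n) = exp (- (\<Sum>i<n. a i))" for n
    proof -
      have "emeasure (Pi\<^sub>M UNIV W) (F n) = (\<Prod>i\<in>{..<n}. emeasure (W i) (E i))"
        unfolding F_def by (rule P.emeasure_PiM_Collect) (use E in auto)
      also have "\<dots> = ennreal (\<Prod>i\<in>{..<n}. exp (- a i))"
        by (simp add: W.emeasure_eq_measure E_def XA(2)[OF A(1)] a_def prod_ennreal)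
      also have "(\<Prod>i\<in>{..<n}. exp (- a i)) = exp (- (\<Sum>i<n. a i))"
        by (simp add: exp_sum[symmetric] sum_negf)
      finally show ?thesis by (simp add: measure_def)
    qed
    have "decseq F" by (auto simp: decseq_def F_def)
    then have lim: "(\<lambda>n. exp (- (\<Sum>i<n. a i))) \<longlonglongrightarrow> measure (Pi\<^sub>M UNIV W) (\<Inter>n. F n)"
      using P.finite_Lim_measure_decseq[of F] F by (auto simp: mF)
    have "(\<lambda>n. \<Sum>i<n. emeasure \<nu> (A \<inter> D i)) \<longlonglongrightarrow> (\<Sum>i. emeasure \<nu> (A \<inter> D i))"
      by (rule summable_LIMSEQ) simp
    also have "(\<Sum>i. emeasure \<nu> (A \<inter> D i)) = emeasure \<nu> (\<Union>i. A \<inter> D i)"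
    proof (rule suminf_emeasure)
      show "disjoint_family (\<lambda>i. A \<inter> D i)"
        using disjoint_family_disjointed[of C] by (fastforce simp: disjoint_family_on_def D_def)
    qed (use A D in auto)
    also have "(\<Union>i. A \<inter> D i) = A"
      using A(2) UN_disjointed_eq[of C] by (auto simp: D_def)
    also have "(\<lambda>n. \<Sum>i<n. emeasure \<nu> (A \<inter> D i)) = (\<lambda>n. ennreal (\<Sum>i<n. a i))"
    proof
      fix n
      have "emeasure \<nu> (A \<inter> D i) = ennreal (a i)" for i
        unfolding a_def using finD[of i] emeasure_mono[of "A \<inter> D i" "D i" \<nu>] D[of i]
        by (intro emeasure_eq_ennreal_measure) (auto simp: top_unique)
      then show "(\<Sum>i<n. emeasure \<nu> (A \<inter> D i)) = ennreal (\<Sum>i<n. a i)"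
        by (simp add: a_def sum_ennreal)
    qed
    finally have lim2: "(\<lambda>n. ennreal (\<Sum>i<n. a i)) \<longlonglongrightarrow> emeasure \<nu> A" .
    have "(\<lambda>n. exp (- (\<Sum>i<n. a i))) \<longlonglongrightarrow> void_prob \<nu> A"
    proof (cases "emeasure \<nu> A = \<infinity>")
      case True
      then have "filterlim (\<lambda>n. \<Sum>i<n. a i) at_top sequentially"
        using lim2 by (simp add: ennreal_tendsto_top_eq_at_top)
      then have "(\<lambda>n. exp (- (\<Sum>i<n. a i))) \<longlonglongrightarrow> 0"
        by (intro filterlim_compose[OF exp_at_bot] filterlim_uminus_at_bot_at_top[THEN filterlim_compose])
      then show ?thesis by (simp add: void_prob_def True)
    next
      case False
      then have "emeasure \<nu> A = ennreal (measure \<nu> A)"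
        by (simp add: emeasure_eq_ennreal_measure)
      then have "(\<lambda>n. \<Sum>i<n. a i) \<longlonglongrightarrow> measure \<nu> A"
        using lim2 by (intro tendsto_ennrealD) (auto simp: a_def intro!: sum_nonneg always_eventually)
      then show ?thesis using False by (auto simp: void_prob_def intro!: tendsto_intros)
    qed
    from LIMSEQ_unique[OF this lim] show ?thesis
      unfolding eq using F by auto
  qed
  show ?thesis
    using sub fin\<xi> void P.prob_space_axioms by (intro exI[of _ "Pi\<^sub>M UNIV W"] exI[of _ \<xi>]) blast
qed


section \<open>Families of sets with trivial stabilizer\<close>

text \<open>
  A sequence of closed sets \<open>F\<close> is coded by the indicator of the pairs \<open>(j, n)\<close> for which \<open>F j\<close> meets
  the \<open>n\<close>-th set of a fixed base; \<open>hits c j n\<close> reads this information off a code \<open>c\<close>.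
\<close>

definition hits :: "(nat \<Rightarrow> real) \<Rightarrow> nat \<Rightarrow> nat \<Rightarrow> bool" where
  "hits c j n \<longleftrightarrow> c (prod_encode (j, n)) = 1"

lemma pred_hits [measurable]: "Measurable.pred borel (\<lambda>c. hits c j n)"
  unfolding hits_def by measurable

definition isolated :: "'y topology \<Rightarrow> 'y set \<Rightarrow> 'y \<Rightarrow> bool" where
  "isolated Y F y \<longleftrightarrow> (\<exists>V. openin Y V \<and> F \<inter> V = {y})"

text \<open>
  The quantifier over \<open>V\<close> stands after the choice of \<open>W\<close>, for in the application \<open>V\<close> is the preimage of
  \<open>W\<close>. Only isolated points are compared because isolated points of a closed set can be described
  through the sets of a countable base, so that the property defines a Borel set of families.
\<close>

definition rigid_family :: "'y topology \<Rightarrow> (nat \<Rightarrow> 'y set) \<Rightarrow> bool" where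
  "rigid_family Y F \<longleftrightarrow>
     (\<forall>U. openin Y U \<and> U \<noteq> {} \<longrightarrow> (\<exists>j y. y \<in> U \<and> isolated Y (F j) y)) \<and>
     (\<forall>i x z. isolated Y (F i) x \<and> isolated Y (F i) z \<and> x \<noteq> z \<longrightarrow>
        (\<exists>W. openin Y W \<and> z \<in> W \<and>
          (\<forall>V. openin Y V \<and> x \<in> V \<longrightarrow> (\<exists>j. F j \<inter> V \<noteq> {} \<and> F j \<inter> W = {}))))"

lemma rigid_family_dense:
  "rigid_family Y F \<Longrightarrow> openin Y U \<Longrightarrow> u \<in> U \<Longrightarrow> \<exists>j y. y \<in> U \<and> isolated Y (F j) y"
  unfolding rigid_family_def by blast

lemma rigid_family_separated:
  "rigid_family Y F \<Longrightarrow> isolated Y (F i) x \<Longrightarrow> isolated Y (F i) z \<Longrightarrow> x \<noteq> z \<Longrightarrow>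
     \<exists>W. openin Y W \<and> z \<in> W \<and>
          (\<forall>V. openin Y V \<and> x \<in> V \<longrightarrow> (\<exists>j. F j \<inter> V \<noteq> {} \<and> F j \<inter> W = {}))"
  unfolding rigid_family_def by blast

lemma openin_homeomorphic_image:
  "homeomorphic_map X Y T \<Longrightarrow> openin X V \<Longrightarrow> openin Y (T ` V)"
  using homeomorphic_imp_open_map unfolding open_map_def by blast

lemma isolated_image:
  assumes T: "homeomorphic_map Y Y T" and F: "F \<subseteq> topspace Y" and y: "isolated Y F y"
  shows "isolated Y (T ` F) (T y)"
proof -
  obtain V where V: "openin Y V" "F \<inter> V = {y}" using y by (auto simp: isolated_def)
  have inj: "inj_on T (topspace Y)" using T by (simp add: homeomorphic_imp_injective_map)
  have "T ` F \<inter> T ` V = {T y}"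
    using inj_on_image_Int[OF inj F openin_subset[OF V(1)]] V(2) by simp
  then show ?thesis using openin_homeomorphic_image[OF T V(1)] by (auto simp: isolated_def)
qed

lemma rigid_family_image:
  assumes T: "homeomorphic_map Y Y T" and F: "\<And>j. F j \<subseteq> topspace Y" and r: "rigid_family Y F"
  shows "rigid_family Y (\<lambda>j. T ` F j)"
proof -
  obtain S where S: "homeomorphic_maps Y Y T S" using T homeomorphic_map_maps by blast
  have ST: "S (T y) = y" "T (S y) = y" "S y \<in> topspace Y" "T y \<in> topspace Y" if "y \<in> topspace Y" for y
    using S that by (auto simp: homeomorphic_maps_def continuous_map_def)
  have hS: "homeomorphic_map Y Y S"
    using S homeomorphic_maps_map homeomorphic_maps_sym by blast
  have STF: "S ` T ` F j = F j" for j using F ST(1) by force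
  have TF: "T ` F j \<subseteq> topspace Y" for j using F ST(4) by blast
  have isoS: "isolated Y (F j) (S y)" if "isolated Y (T ` F j) y" for j y
    using isolated_image[OF hS TF that] STF by simp
  have isoY: "y \<in> topspace Y" if "isolated Y (T ` F j) y" for j y
    using that TF[of j] by (auto simp: isolated_def)
  have dense: "\<exists>j y. y \<in> U \<and> isolated Y (T ` F j) y" if U: "openin Y U" "U \<noteq> {}" for U
  proof -
    obtain u0 where "S u0 \<in> S ` U" using U by blast
    then obtain j y where "y \<in> S ` U" "isolated Y (F j) y"
      using rigid_family_dense[OF r openin_homeomorphic_image[OF hS U(1)]] by blast
    then obtain u where u: "u \<in> U" "isolated Y (F j) (S u)" by blast
    have "T (S u) = u" using ST(2) u(1) openin_subset[OF U(1)] by blast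
    then show ?thesis using isolated_image[OF T F u(2)] u(1) by metis
  qed
  have sep: "\<exists>W. openin Y W \<and> z \<in> W \<and>
      (\<forall>V. openin Y V \<and> x \<in> V \<longrightarrow> (\<exists>j. T ` F j \<inter> V \<noteq> {} \<and> T ` F j \<inter> W = {}))"
    if x: "isolated Y (T ` F i) x" and z: "isolated Y (T ` F i) z" and "x \<noteq> z" for i x z
  proof -
    have xz: "x \<in> topspace Y" "z \<in> topspace Y" using isoY x z by auto
    have "S x \<noteq> S z" using ST(2)[OF xz(1)] ST(2)[OF xz(2)] \<open>x \<noteq> z\<close> by metis
    then obtain W where W: "openin Y W" "S z \<in> W"
      "\<And>V. openin Y V \<Longrightarrow> S x \<in> V \<Longrightarrow> \<exists>j. F j \<inter> V \<noteq> {} \<and> F j \<inter> W = {}"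
      using rigid_family_separated[OF r isoS[OF x] isoS[OF z]] by blast
    show ?thesis
    proof (intro exI[of _ "T ` W"] conjI allI impI)
      show "openin Y (T ` W)" by (rule openin_homeomorphic_image[OF T W(1)])
      show "z \<in> T ` W" using W(2) ST(2)[OF xz(2)] by (metis imageI)
      fix V assume V: "openin Y V \<and> x \<in> V"
      then have "openin Y (S ` V)" "S x \<in> S ` V"
        using openin_homeomorphic_image[OF hS] by auto
      then obtain j where j: "F j \<inter> S ` V \<noteq> {}" "F j \<inter> W = {}" using W(3) by blast
      from j(1) obtain v where "v \<in> V" "S v \<in> F j" by blast
      moreover have "v \<in> topspace Y" using V \<open>v \<in> V\<close> openin_subset by blast
      ultimately have "v \<in> T ` F j \<inter> V" using ST(2)[of v] by (metis IntI imageI)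
      moreover have "T ` F j \<inter> T ` W = {}"
        using inj_on_image_Int[OF homeomorphic_imp_injective_map[OF T] F openin_subset[OF W(1)]] j(2)
        by (metis image_empty)
      ultimately show "\<exists>j. T ` F j \<inter> V \<noteq> {} \<and> T ` F j \<inter> T ` W = {}" by blast
    qed
  qed
  show ?thesis
    unfolding rigid_family_def
    by (intro conjI allI impI; elim conjE; (rule dense; assumption | rule sep; assumption))
qed

text \<open>
  If \<open>T\<close> moves some point, then by density it moves an isolated point \<open>x\<close> of some \<open>F i\<close>, and \<open>T x\<close> is
  another isolated point of \<open>F i\<close>. For the set \<open>W\<close> around \<open>T x\<close> and \<open>V\<close> the preimage of \<open>W\<close>, a set \<open>F j\<close>
  that meets \<open>V\<close> must also meet \<open>W\<close>.
\<close>

theorem rigid_family_imp_trivial: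
  assumes T: "homeomorphic_map Y Y T" and H: "Hausdorff_space Y"
    and F: "\<And>j. F j \<subseteq> topspace Y" and r: "rigid_family Y F"
    and inv: "\<And>j. T ` F j = F j" and y: "y \<in> topspace Y"
  shows "T y = y"
proof (rule ccontr)
  assume "T y \<noteq> y"
  have cT: "continuous_map Y Y T" using T by (rule homeomorphic_imp_continuous_map)
  have "T y \<in> topspace Y" using cT y by (auto simp: continuous_map_def)
  then obtain P Q where PQ: "openin Y P" "openin Y Q" "y \<in> P" "T y \<in> Q" "disjnt P Q"
    using H y \<open>T y \<noteq> y\<close> unfolding Hausdorff_space_def by metis
  have "openin Y {u \<in> topspace Y. T u \<in> Q}"
    using cT PQ(2) by (rule openin_continuous_map_preimage)
  then have "openin Y (P \<inter> {u \<in> topspace Y. T u \<in> Q})" using PQ(1) by blast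
  moreover have "y \<in> P \<inter> {u \<in> topspace Y. T u \<in> Q}" using PQ y by blast
  ultimately obtain j x where x: "x \<in> P" "T x \<in> Q" "isolated Y (F j) x"
    using rigid_family_dense[OF r] by blast
  have iTx: "isolated Y (F j) (T x)" using isolated_image[OF T F x(3)] inv by simp
  have xTx: "x \<noteq> T x" using x PQ(5) by (auto simp: disjnt_def)
  obtain W where W: "openin Y W" "T x \<in> W"
      "\<And>V. openin Y V \<Longrightarrow> x \<in> V \<Longrightarrow> \<exists>j. F j \<inter> V \<noteq> {} \<and> F j \<inter> W = {}"
    using rigid_family_separated[OF r x(3) iTx xTx] by blast
  have "openin Y {u \<in> topspace Y. T u \<in> W}"
    using cT W(1) by (rule openin_continuous_map_preimage)
  moreover have "x \<in> {u \<in> topspace Y. T u \<in> W}"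
    using W(2) x(1) openin_subset[OF PQ(1)] by auto
  ultimately obtain i where i: "F i \<inter> {u \<in> topspace Y. T u \<in> W} \<noteq> {}" "F i \<inter> W = {}"
    using W(3) by blast
  then obtain u where "u \<in> F i" "T u \<in> W" by blast
  then show False using inv[of i] i(2) by blast
qed


section \<open>Codes of sequences of closed sets\<close>

locale polish_base =
  fixes Y :: "'y topology" and B :: "nat \<Rightarrow> 'y set"
  assumes cm: "completely_metrizable_space Y"
    and B_open: "openin Y (B n)"
    and B_base: "openin Y U \<Longrightarrow> y \<in> U \<Longrightarrow> \<exists>n. y \<in> B n \<and> B n \<subseteq> U"
begin

definition code :: "(nat \<Rightarrow> 'y set) \<Rightarrow> nat \<Rightarrow> real" where
  "code F k = of_bool (F (fst (prod_decode k)) \<inter> B (snd (prod_decode k)) \<noteq> {})"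

text \<open>
  A point belongs to a closed set if and only if all its basic neighbourhoods meet the set.
\<close>

definition decode :: "(nat \<Rightarrow> real) \<Rightarrow> nat \<Rightarrow> 'y set" where
  "decode c j = {y \<in> topspace Y. \<forall>n. y \<in> B n \<longrightarrow> hits c j n}"

definition codes :: "(nat \<Rightarrow> real) set" where
  "codes = code ` {F. \<forall>j. closedin Y (F j)}"

lemma B_subset: "B n \<subseteq> topspace Y"
  using B_open openin_subset by blast

lemma Hausdorff: "Hausdorff_space Y"
  using cm completely_metrizable_imp_metrizable_space metrizable_imp_Hausdorff_space by blast

lemma B_base_closure:
  assumes "openin Y U" "y \<in> U"
  shows "\<exists>n. y \<in> B n \<and> Y closure_of B n \<subseteq> U"
proof -
  have "regular_space Y"
    using cm completely_metrizable_imp_metrizable_space metrizable_imp_regular_space by blast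
  then have "neighbourhood_base_of (closedin Y) Y"
    by (simp add: neighbourhood_base_of_closedin)
  then obtain P C where P: "openin Y P" "closedin Y C" "y \<in> P" "P \<subseteq> C" "C \<subseteq> U"
    using assms unfolding neighbourhood_base_of by meson
  then obtain n where "y \<in> B n" "B n \<subseteq> P" using B_base by blast
  then show ?thesis using P closure_of_minimal[of "B n" C Y] by blast
qed

lemma hits_code: "hits (code F) j n \<longleftrightarrow> F j \<inter> B n \<noteq> {}"
  by (simp add: hits_def code_def)

lemma closedin_decode: "closedin Y (decode c j)"
proof -
  have "topspace Y - decode c j = \<Union>{B n |n. \<not> hits c j n}"
    using B_subset by (fastforce simp: decode_def)
  moreover have "openin Y (\<Union>{B n |n. \<not> hits c j n})" using B_open by blast
  ultimately show ?thesis by (simp add: closedin_def decode_def)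
qed

lemma decode_subset: "decode c j \<subseteq> topspace Y"
  by (auto simp: decode_def)

lemma decode_code:
  assumes "\<And>j. closedin Y (F j)"
  shows "decode (code F) = F"
proof
  fix j
  show "decode (code F) j = F j"
  proof (intro Set.set_eqI iffI)
    fix y assume y: "y \<in> decode (code F) j"
    show "y \<in> F j"
    proof (rule ccontr)
      assume "y \<notin> F j"
      then obtain n where "y \<in> B n" "B n \<subseteq> topspace Y - F j"
        using B_base[of "topspace Y - F j" y] assms[of j] y by (auto simp: decode_def closedin_def)
      then show False using y by (auto simp: decode_def hits_code)
    qed
  next
    fix y assume "y \<in> F j"
    then show "y \<in> decode (code F) j"
      using closedin_subset[OF assms[of j]] by (auto simp: decode_def hits_code)
  qed
qed

lemma code_in_codes: "(\<And>j. closedin Y (F j)) \<Longrightarrow> code F \<in> codes"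
  by (auto simp: codes_def)

lemma code_decode: "c \<in> codes \<Longrightarrow> code (decode c) = c"
  by (auto simp: codes_def decode_code)

lemma hits_iff: "c \<in> codes \<Longrightarrow> hits c j n \<longleftrightarrow> decode c j \<inter> B n \<noteq> {}"
  using hits_code[of "decode c"] by (simp add: code_decode)

lemma decode_misses_iff:
  assumes "c \<in> codes" "openin Y U"
  shows "decode c j \<inter> U = {} \<longleftrightarrow> (\<forall>n. B n \<subseteq> U \<longrightarrow> \<not> hits c j n)"
proof
  assume *: "\<forall>n. B n \<subseteq> U \<longrightarrow> \<not> hits c j n"
  show "decode c j \<inter> U = {}"
  proof (rule ccontr)
    assume "decode c j \<inter> U \<noteq> {}"
    then obtain y where y: "y \<in> decode c j" "y \<in> U" by blast
    then obtain n where "y \<in> B n" "B n \<subseteq> U" using B_base assms(2) by blast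
    then show False using * y by (auto simp: decode_def)
  qed
qed (use hits_iff[OF assms(1)] in blast)

text \<open>
  The set of indices of the basic sets that meet a given set is upward closed, and each of its
  members contains the closure of an arbitrarily small member. Conversely, if a code has these
  countably many properties, then below each basic set that it marks there is a sequence of marked
  sets with nested closures and diameters tending to 0; by completeness they have a common point,
  which lies in the decoded set. So every code with these properties is the code of closed sets.
\<close>

theorem codes_borel [measurable]: "codes \<in> sets borel"
proof -
  obtain M d where Md: "Metric_space M d" and mc: "Metric_space.mcomplete M d"
    and Yd: "Y = Metric_space.mtopology M d"
    using cm unfolding completely_metrizable_space_def by (elim exE conjE) (rule that)
  interpret Metric_space M d by (rule Md)
  define small where "small r m \<longleftrightarrow> (\<exists>a. B m \<subseteq> mcball a (1 / Suc r))" for r m :: nat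
  define Q where "Q c j n \<longleftrightarrow> B n \<noteq> {} \<and> (\<forall>m. B n \<subseteq> B m \<longrightarrow> hits c j m) \<and>
      (\<forall>r. \<exists>m. hits c j m \<and> Y closure_of B m \<subseteq> B n \<and> small r m)" for c j n
  have "c \<in> codes \<longleftrightarrow> (\<forall>k. c k = 0 \<or> c k = 1) \<and> (\<forall>j n. hits c j n \<longrightarrow> Q c j n)" for c
  proof (intro iffI conjI allI impI)
    fix k assume "c \<in> codes"
    then show "c k = 0 \<or> c k = 1" by (auto simp: codes_def code_def)
  next
    fix j n assume c: "c \<in> codes" and h: "hits c j n"
    then obtain x where x: "x \<in> decode c j" "x \<in> B n" using hits_iff by blast
    show "Q c j n" unfolding Q_def
    proof (intro conjI allI impI)
      show "B n \<noteq> {}" using x by blast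
      show "hits c j m" if "B n \<subseteq> B m" for m using hits_iff[OF c] x that by blast
      fix r :: nat
      have "x \<in> M" using B_subset x(2) Yd by auto
      then have "openin Y (B n \<inter> mball x (1 / Suc r))" "x \<in> B n \<inter> mball x (1 / Suc r)"
        using B_open[of n] x(2) openin_mball[of x] unfolding Yd by auto
      then obtain m where m: "x \<in> B m" "Y closure_of B m \<subseteq> B n \<inter> mball x (1 / Suc r)"
        using B_base_closure by blast
      have "B m \<subseteq> Y closure_of B m" by (rule closure_of_subset[OF B_subset])
      then have "small r m" using m(2) mball_subset_mcball unfolding small_def by blast
      then show "\<exists>m. hits c j m \<and> Y closure_of B m \<subseteq> B n \<and> small r m"
        using m x(1) hits_iff[OF c] by blast
    qed
  next
    assume c: "(\<forall>k. c k = 0 \<or> c k = 1) \<and> (\<forall>j n. hits c j n \<longrightarrow> Q c j n)"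
    have ex: "decode c j \<inter> B n \<noteq> {}" if h: "hits c j n" for j n
    proof -
      have "\<exists>f. f 0 = n \<and> (\<forall>i. hits c j (f i)) \<and>
          (\<forall>i. Y closure_of B (f (Suc i)) \<subseteq> B (f i) \<and> small i (f (Suc i)))"
      proof -
        have "\<exists>f. \<forall>i. (hits c j (f i) \<and> (i = 0 \<longrightarrow> f i = n)) \<and>
          (Y closure_of B (f (Suc i)) \<subseteq> B (f i) \<and> small i (f (Suc i)))"
        proof (rule dependent_nat_choice)
          show "\<exists>m. hits c j m \<and> (0 = (0::nat) \<longrightarrow> m = n)" using h by blast
          fix m i :: nat assume "hits c j m \<and> (i = 0 \<longrightarrow> m = n)"
          then have "Q c j m" using c by blast
          then show "\<exists>y. (hits c j y \<and> (Suc i = 0 \<longrightarrow> y = n)) \<and>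
              Y closure_of B y \<subseteq> B m \<and> small i y"
            unfolding Q_def by (metis nat.distinct(1))
        qed
        then show ?thesis by metis
      qed
      then obtain f where f: "f 0 = n" "\<And>i. hits c j (f i)"
        "\<And>i. Y closure_of B (f (Suc i)) \<subseteq> B (f i)" "\<And>i. small i (f (Suc i))" by blast
      define C where "C i = Y closure_of B (f (Suc i))" for i
      have sC: "B (f (Suc i)) \<subseteq> C i" for i
        unfolding C_def by (rule closure_of_subset[OF B_subset])
      have "\<Inter> (range C) \<noteq> {}"
      proof (rule mc[unfolded mcomplete_nest, rule_format], intro conjI allI impI)
        show "closedin mtopology (C i)" for i by (simp add: C_def Yd)
        show "C i \<noteq> {}" for i
          using sC[of i] f(2)[of "Suc i"] c unfolding Q_def by blast
        show "decseq C"
        proof (rule decseq_SucI)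
          fix i
          have "C (Suc i) \<subseteq> B (f (Suc i))" unfolding C_def using f(3) by blast
          then show "C (Suc i) \<subseteq> C i" using sC by blast
        qed
        fix e :: real assume "e > 0"
        then obtain r :: nat where r: "1 / Suc r < e" using nat_approx_posE by blast
        obtain a where "B (f (Suc r)) \<subseteq> mcball a (1 / Suc r)" using f(4) unfolding small_def by blast
        then have "C r \<subseteq> mcball a (1 / Suc r)"
          unfolding C_def Yd by (intro closure_of_minimal) auto
        also have "\<dots> \<subseteq> mcball a e" using r by (intro mcball_subset_concentric) auto
        finally show "\<exists>i a. C i \<subseteq> mcball a e" by blast
      qed
      then obtain y where y: "\<And>i. y \<in> C i" by blast
      have yB: "y \<in> B (f i)" for i using y f(3) unfolding C_def by blast
      have "hits c j l" if yl: "y \<in> B l" for l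
      proof -
        have "openin mtopology (B l)" using B_open Yd by simp
        then obtain e where e: "e > 0" "mball y e \<subseteq> B l"
          using yl unfolding openin_mtopology by blast
        obtain r :: nat where r: "1 / Suc r < e / 2" using nat_approx_posE[of "e/2"] e(1) by auto
        obtain a where a: "B (f (Suc r)) \<subseteq> mcball a (1 / Suc r)" using f(4) unfolding small_def by blast
        have "B (f (Suc r)) \<subseteq> B l"
        proof
          fix u assume u: "u \<in> B (f (Suc r))"
          have "d a u \<le> 1 / Suc r" "d a y \<le> 1 / Suc r" "a \<in> M" "u \<in> M" "y \<in> M"
            using a u yB[of "Suc r"] by auto
          then have "d y u < e" using triangle[of y a u] commute[of y a] r by auto
          then show "u \<in> B l" using e \<open>u \<in> M\<close> \<open>y \<in> M\<close> by auto
        qed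
        then show ?thesis using f(2)[of "Suc r"] c unfolding Q_def by blast
      qed
      then have "y \<in> decode c j" using yB[of 0] B_subset by (auto simp: decode_def)
      then show ?thesis using yB[of 0] f(1) by blast
    qed
    have "code (decode c) k = c k" for k
    proof -
      obtain j n where k: "k = prod_encode (j, n)" by (metis prod_decode_inverse surj_pair)
      have "decode c j \<inter> B n \<noteq> {} \<longleftrightarrow> hits c j n" using ex[of j n] by (auto simp: decode_def)
      moreover have "c k = 0 \<or> c k = 1" using c by blast
      ultimately show ?thesis by (auto simp: code_def k hits_def)
    qed
    then have "code (decode c) = c" by auto
    then show "c \<in> codes" using code_in_codes[of "decode c"] closedin_decode by metis
  qed
  then have "codes = {c \<in> space borel. (\<forall>k. c k = 0 \<or> c k = 1) \<and> (\<forall>j n. hits c j n \<longrightarrow> Q c j n)}"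
    by auto
  also have "\<dots> \<in> sets borel" unfolding Q_def by measurable
  finally show ?thesis .
qed

end


context polish_base
begin


section \<open>The Borel set of rigid codes\<close>

text \<open>
  By the Hausdorff property, \<open>B m\<close> contains exactly one point of a closed set if the set meets \<open>B m\<close>
  but does not meet two disjoint basic subsets of \<open>B m\<close>.
\<close>

definition isolates :: "(nat \<Rightarrow> real) \<Rightarrow> nat \<Rightarrow> nat \<Rightarrow> bool" where
  "isolates c j m \<longleftrightarrow> hits c j m \<and>
     (\<forall>k l. B k \<subseteq> B m \<and> B l \<subseteq> B m \<and> B k \<inter> B l = {} \<longrightarrow> \<not> (hits c j k \<and> hits c j l))"

lemma pred_isolates [measurable]: "Measurable.pred borel (\<lambda>c. isolates c j m)"
  unfolding isolates_def by measurable

lemma isolates_iff: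
  assumes c: "c \<in> codes"
  shows "isolates c j m \<longleftrightarrow> (\<exists>y. decode c j \<inter> B m = {y})"
proof
  assume i: "isolates c j m"
  then obtain y where y: "y \<in> decode c j" "y \<in> B m"
    using hits_iff[OF c] unfolding isolates_def by blast
  have "z = y" if z: "z \<in> decode c j" "z \<in> B m" for z
  proof (rule ccontr)
    assume "z \<noteq> y"
    moreover have "y \<in> topspace Y" "z \<in> topspace Y" using y(2) z(2) B_subset by blast+
    ultimately obtain P Q where PQ: "openin Y P" "openin Y Q" "y \<in> P" "z \<in> Q" "disjnt P Q"
      using Hausdorff unfolding Hausdorff_space_def by metis
    have "openin Y (P \<inter> B m)" "openin Y (Q \<inter> B m)" using PQ(1,2) B_open by blast+
    then obtain k l where "y \<in> B k" "B k \<subseteq> P \<inter> B m" "z \<in> B l" "B l \<subseteq> Q \<inter> B m"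
      using B_base[of "P \<inter> B m" y] B_base[of "Q \<inter> B m" z] PQ y z by blast
    moreover have "hits c j k" "hits c j l"
      using hits_iff[OF c] \<open>y \<in> B k\<close> \<open>z \<in> B l\<close> y z by blast+
    moreover have "B k \<inter> B l = {}"
      using PQ(5) \<open>B k \<subseteq> P \<inter> B m\<close> \<open>B l \<subseteq> Q \<inter> B m\<close> unfolding disjnt_def by blast
    ultimately show False using i unfolding isolates_def by blast
  qed
  then show "\<exists>y. decode c j \<inter> B m = {y}" using y by blast
next
  assume "\<exists>y. decode c j \<inter> B m = {y}"
  then obtain y where y: "decode c j \<inter> B m = {y}" ..
  have "y \<in> B k" if "B k \<subseteq> B m" "hits c j k" for k
  proof -
    have "decode c j \<inter> B k \<noteq> {}" using hits_iff[OF c] that(2) by blast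
    then show ?thesis using y that(1) by auto
  qed
  then show "isolates c j m"
    unfolding isolates_def using hits_iff[OF c, of j m] y by blast
qed

lemma isolated_decode_iff:
  assumes c: "c \<in> codes"
  shows "isolated Y (decode c j) y \<longleftrightarrow> (\<exists>m. isolates c j m \<and> y \<in> decode c j \<and> y \<in> B m)"
proof
  assume "isolated Y (decode c j) y"
  then obtain V where V: "openin Y V" "decode c j \<inter> V = {y}" unfolding isolated_def by blast
  then obtain m where m: "y \<in> B m" "B m \<subseteq> V" using B_base[of V y] by blast
  then have "decode c j \<inter> B m = {y}" "y \<in> decode c j" using V(2) by blast+
  then show "\<exists>m. isolates c j m \<and> y \<in> decode c j \<and> y \<in> B m"
    using isolates_iff[OF c] m(1) by blast
next
  assume "\<exists>m. isolates c j m \<and> y \<in> decode c j \<and> y \<in> B m"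
  then obtain m z where "decode c j \<inter> B m = {z}" "y \<in> decode c j" "y \<in> B m"
    using isolates_iff[OF c] by blast
  then have "decode c j \<inter> B m = {y}" by auto
  then show "isolated Y (decode c j) y" unfolding isolated_def using B_open by blast
qed

lemma rigid_dense_iff:
  assumes c: "c \<in> codes"
  shows "(\<forall>U. openin Y U \<and> U \<noteq> {} \<longrightarrow> (\<exists>j y. y \<in> U \<and> isolated Y (decode c j) y)) \<longleftrightarrow>
    (\<forall>n. B n \<noteq> {} \<longrightarrow> (\<exists>j m. B m \<subseteq> B n \<and> isolates c j m))" (is "?L \<longleftrightarrow> ?R")
proof
  assume L: ?L
  show ?R
  proof (intro allI impI)
    fix n assume "B n \<noteq> {}"
    then obtain j y where y: "y \<in> B n" "isolated Y (decode c j) y" using L B_open by blast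
    then obtain V where V: "openin Y V" "decode c j \<inter> V = {y}" unfolding isolated_def by blast
    then have "openin Y (V \<inter> B n)" "y \<in> V \<inter> B n" using B_open y(1) by blast+
    then obtain m where m: "y \<in> B m" "B m \<subseteq> V \<inter> B n" using B_base by blast
    then have "decode c j \<inter> B m = {y}" using V(2) by blast
    then have "isolates c j m" using isolates_iff[OF c] by blast
    then show "\<exists>j m. B m \<subseteq> B n \<and> isolates c j m" using m(2) by blast
  qed
next
  assume R: ?R
  show ?L
  proof (intro allI impI)
    fix U assume U: "openin Y U \<and> U \<noteq> {}"
    then obtain n where n: "B n \<noteq> {}" "B n \<subseteq> U" using B_base by blast
    then obtain j m where m: "B m \<subseteq> B n" "isolates c j m" using R by blast
    then obtain y where "decode c j \<inter> B m = {y}" using isolates_iff[OF c] by blast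
    then have "y \<in> U" "y \<in> decode c j" "y \<in> B m" using m(1) n(2) by blast+
    then show "\<exists>j y. y \<in> U \<and> isolated Y (decode c j) y"
      using isolated_decode_iff[OF c] m(2) by blast
  qed
qed

text \<open>
  Isolated points are represented by basic sets that isolate them. A basic neighbourhood of the
  isolated point in \<open>B n\<close> is then the same as a basic set inside \<open>B n\<close> that meets the set.
\<close>

lemma rigid_separated_iff:
  assumes c: "c \<in> codes"
  shows "(\<forall>i x z. isolated Y (decode c i) x \<and> isolated Y (decode c i) z \<and> x \<noteq> z \<longrightarrow>
        (\<exists>W. openin Y W \<and> z \<in> W \<and>
          (\<forall>V. openin Y V \<and> x \<in> V \<longrightarrow> (\<exists>j. decode c j \<inter> V \<noteq> {} \<and> decode c j \<inter> W = {})))) \<longleftrightarrow>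
    (\<forall>i n m. isolates c i n \<and> isolates c i m \<and> B n \<inter> B m = {} \<longrightarrow>
        (\<exists>k. hits c i k \<and> B k \<subseteq> B m \<and>
          (\<forall>l. B l \<subseteq> B n \<and> hits c i l \<longrightarrow> (\<exists>j. hits c j l \<and> \<not> hits c j k))))" (is "?L \<longleftrightarrow> ?R")
proof
  assume L: ?L
  show ?R
  proof (intro allI impI; elim conjE)
    fix i n m assume n: "isolates c i n" and m: "isolates c i m" and d: "B n \<inter> B m = {}"
    obtain x where x: "decode c i \<inter> B n = {x}"
      using isolates_iff[OF c, THEN iffD1, OF n] ..
    obtain z where z: "decode c i \<inter> B m = {z}"
      using isolates_iff[OF c, THEN iffD1, OF m] ..
    have ix: "isolated Y (decode c i) x" unfolding isolated_def using x B_open by blast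
    have iz: "isolated Y (decode c i) z" unfolding isolated_def using z B_open by blast
    have "x \<in> B n" "z \<in> B m" "z \<in> decode c i" using x z by auto
    then have "x \<noteq> z" using d by blast
    then obtain W where W: "openin Y W" "z \<in> W"
      and WV: "\<And>V. openin Y V \<Longrightarrow> x \<in> V \<Longrightarrow> \<exists>j. decode c j \<inter> V \<noteq> {} \<and> decode c j \<inter> W = {}"
      using L[rule_format, of i x z] ix iz by blast
    have "openin Y (W \<inter> B m)" using W(1) B_open by blast
    moreover have "z \<in> W \<inter> B m" using W(2) \<open>z \<in> B m\<close> by blast
    ultimately obtain k where k: "z \<in> B k" "B k \<subseteq> W \<inter> B m" using B_base by meson
    show "\<exists>k. hits c i k \<and> B k \<subseteq> B m \<and>
          (\<forall>l. B l \<subseteq> B n \<and> hits c i l \<longrightarrow> (\<exists>j. hits c j l \<and> \<not> hits c j k))"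
    proof (rule exI[of _ k], intro conjI allI impI; (elim conjE)?)
      show "hits c i k" using hits_iff[OF c] k(1) \<open>z \<in> decode c i\<close> by blast
      show "B k \<subseteq> B m" using k(2) by blast
      fix l assume l: "B l \<subseteq> B n" "hits c i l"
      have "decode c i \<inter> B l \<noteq> {}" using hits_iff[OF c] l(2) by blast
      then have "x \<in> B l" using x l(1) by auto
      from WV[OF B_open this] obtain j where "decode c j \<inter> B l \<noteq> {}" "decode c j \<inter> W = {}" by blast
      then have "hits c j l" "\<not> hits c j k" using hits_iff[OF c] k(2) by blast+
      then show "\<exists>j. hits c j l \<and> \<not> hits c j k" by blast
    qed
  qed
next
  assume R: ?R
  show ?L
  proof (intro allI impI; elim conjE)
    fix i x z assume x: "isolated Y (decode c i) x" and z: "isolated Y (decode c i) z" and "x \<noteq> z"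
    obtain V1 V2 where V: "openin Y V1" "decode c i \<inter> V1 = {x}" "openin Y V2" "decode c i \<inter> V2 = {z}"
      using x z unfolding isolated_def by blast
    have xz: "x \<in> decode c i" "x \<in> V1" "z \<in> decode c i" "z \<in> V2" using V(2,4) by auto
    have "x \<in> topspace Y" "z \<in> topspace Y" using xz decode_subset[of c i] by blast+
    then obtain P Q where PQ: "openin Y P" "openin Y Q" "x \<in> P" "z \<in> Q" "disjnt P Q"
      using Hausdorff \<open>x \<noteq> z\<close> unfolding Hausdorff_space_def by metis
    have "openin Y (P \<inter> V1)" "openin Y (Q \<inter> V2)" using PQ(1,2) V(1,3) by blast+
    moreover have "x \<in> P \<inter> V1" "z \<in> Q \<inter> V2" using PQ(3,4) xz by blast+
    ultimately obtain n m where n: "x \<in> B n" "B n \<subseteq> P \<inter> V1" and m: "z \<in> B m" "B m \<subseteq> Q \<inter> V2"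
      using B_base by meson
    have dn: "decode c i \<inter> B n = {x}" using V(2) n xz by auto
    have dm: "decode c i \<inter> B m = {z}" using V(4) m xz by auto
    have "isolates c i n" "isolates c i m"
      by (rule isolates_iff[OF c, THEN iffD2, OF exI, OF dn])
        (rule isolates_iff[OF c, THEN iffD2, OF exI, OF dm])
    moreover have "B n \<inter> B m = {}" using n(2) m(2) PQ(5) unfolding disjnt_def by blast
    ultimately obtain k where k: "hits c i k" "B k \<subseteq> B m"
      and kl: "\<And>l. B l \<subseteq> B n \<Longrightarrow> hits c i l \<Longrightarrow> \<exists>j. hits c j l \<and> \<not> hits c j k"
      using R[rule_format, of i n m] by blast
    have "decode c i \<inter> B k \<noteq> {}" using hits_iff[OF c] k(1) by blast
    then have zk: "z \<in> B k" using dm k(2) by auto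
    show "\<exists>W. openin Y W \<and> z \<in> W \<and>
          (\<forall>V. openin Y V \<and> x \<in> V \<longrightarrow> (\<exists>j. decode c j \<inter> V \<noteq> {} \<and> decode c j \<inter> W = {}))"
    proof (intro exI[of _ "B k"] conjI allI impI; (elim conjE)?)
      fix V assume "openin Y V" "x \<in> V"
      then have "openin Y (V \<inter> B n)" "x \<in> V \<inter> B n" using B_open n(1) by blast+
      then obtain l where l: "x \<in> B l" "B l \<subseteq> V \<inter> B n" using B_base by meson
      have "hits c i l" using hits_iff[OF c] l(1) xz by blast
      then obtain j where "hits c j l" "\<not> hits c j k" using kl[of l] l(2) by blast
      then have "decode c j \<inter> B l \<noteq> {}" "decode c j \<inter> B k = {}" using hits_iff[OF c] by blast+
      then show "\<exists>j. decode c j \<inter> V \<noteq> {} \<and> decode c j \<inter> B k = {}" using l(2) by blast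
    qed (use B_open zk in auto)
  qed
qed

definition rigid_codes :: "(nat \<Rightarrow> real) set" where
  "rigid_codes = {c \<in> codes. rigid_family Y (decode c)}"

theorem rigid_codes_borel [measurable]: "rigid_codes \<in> sets borel"
proof -
  have "rigid_codes = {c \<in> space borel. c \<in> codes \<and>
      (\<forall>n. B n \<noteq> {} \<longrightarrow> (\<exists>j m. B m \<subseteq> B n \<and> isolates c j m)) \<and>
      (\<forall>i n m. isolates c i n \<and> isolates c i m \<and> B n \<inter> B m = {} \<longrightarrow>
        (\<exists>k. hits c i k \<and> B k \<subseteq> B m \<and>
          (\<forall>l. B l \<subseteq> B n \<and> hits c i l \<longrightarrow> (\<exists>j. hits c j l \<and> \<not> hits c j k))))}"
  proof (rule Set.set_eqI)
    fix c
    show "c \<in> rigid_codes \<longleftrightarrow> c \<in> {c \<in> space borel. c \<in> codes \<and>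
      (\<forall>n. B n \<noteq> {} \<longrightarrow> (\<exists>j m. B m \<subseteq> B n \<and> isolates c j m)) \<and>
      (\<forall>i n m. isolates c i n \<and> isolates c i m \<and> B n \<inter> B m = {} \<longrightarrow>
        (\<exists>k. hits c i k \<and> B k \<subseteq> B m \<and>
          (\<forall>l. B l \<subseteq> B n \<and> hits c i l \<longrightarrow> (\<exists>j. hits c j l \<and> \<not> hits c j k))))}"
    proof (cases "c \<in> codes")
      case True
      show ?thesis
        unfolding rigid_codes_def rigid_family_def mem_Collect_eq
          rigid_dense_iff[OF True] rigid_separated_iff[OF True] by simp
    qed (simp add: rigid_codes_def)
  qed
  also have "\<dots> \<in> sets borel" by measurable
  finally show ?thesis .
qed


section \<open>Homeomorphisms acting on codes\<close>

definition push :: "('y \<Rightarrow> 'y) \<Rightarrow> (nat \<Rightarrow> real) \<Rightarrow> nat \<Rightarrow> real" where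
  "push T c = code (\<lambda>j. T ` decode c j)"

lemma decode_push:
  assumes "homeomorphic_map Y Y T"
  shows "decode (push T c) = (\<lambda>j. T ` decode c j)"
  unfolding push_def
proof (rule decode_code)
  show "closedin Y (T ` decode c j)" for j
    using homeomorphic_imp_closed_map[OF assms] closedin_decode unfolding closed_map_def by blast
qed

lemma push_in_codes: "homeomorphic_map Y Y T \<Longrightarrow> push T c \<in> codes"
  unfolding push_def using homeomorphic_imp_closed_map[of Y Y T] closedin_decode
  by (intro code_in_codes) (auto simp: closed_map_def)

lemma push_in_rigid_codes:
  "homeomorphic_map Y Y T \<Longrightarrow> c \<in> rigid_codes \<Longrightarrow> push T c \<in> rigid_codes"
  by (simp add: rigid_codes_def push_in_codes decode_push rigid_family_image decode_subset)

lemma push_push: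
  "homeomorphic_map Y Y T \<Longrightarrow> push S (push T c) = push (S \<circ> T) c"
  by (subst (1 3) push_def) (simp only: decode_push image_comp)

lemma push_cong: "(\<And>y. y \<in> topspace Y \<Longrightarrow> S y = T y) \<Longrightarrow> push S c = push T c"
  unfolding push_def using decode_subset by (intro arg_cong[where f=code] ext image_cong) auto

lemma push_ident:
  assumes "c \<in> codes" "\<And>y. y \<in> topspace Y \<Longrightarrow> T y = y"
  shows "push T c = c"
proof -
  have "push T c = push (\<lambda>y. y) c" by (rule push_cong) (rule assms(2))
  then show ?thesis by (simp add: push_def code_decode[OF assms(1)])
qed

text \<open>
  This splits the dependence of the coded image on \<open>T\<close> and on \<open>F\<close>: the right-hand side is a countable
  combination of conditions on \<open>F\<close> alone and on \<open>T\<close> alone. The closures make the condition on \<open>T\<close> a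
  closed one.
\<close>

lemma image_misses_open:
  assumes T: "continuous_map Y Y T" and F: "F \<subseteq> topspace Y"
  shows "T ` F \<inter> B n \<noteq> {} \<longleftrightarrow>
     (\<exists>m k. Y closure_of B k \<subseteq> B n \<and> F \<inter> B m \<noteq> {} \<and> T ` B m \<subseteq> Y closure_of B k)"
proof
  assume "T ` F \<inter> B n \<noteq> {}"
  then obtain y where y: "y \<in> F" "T y \<in> B n" by blast
  then obtain k where k: "T y \<in> B k" "Y closure_of B k \<subseteq> B n" using B_base_closure B_open by meson
  have "openin Y {u \<in> topspace Y. T u \<in> B k}" using T B_open by (rule openin_continuous_map_preimage)
  then obtain m where m: "y \<in> B m" "B m \<subseteq> {u \<in> topspace Y. T u \<in> B k}"
    using B_base k(1) y(1) F by blast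
  have "B k \<subseteq> Y closure_of B k" by (rule closure_of_subset[OF B_subset])
  then have "T ` B m \<subseteq> Y closure_of B k" using m(2) by blast
  then show "\<exists>m k. Y closure_of B k \<subseteq> B n \<and> F \<inter> B m \<noteq> {} \<and> T ` B m \<subseteq> Y closure_of B k"
    using k(2) m(1) y(1) by blast
qed blast

text \<open>
  The points \<open>d l\<close> form a countable dense set, so inclusion in a closed set is decided by the values
  of \<open>T\<close> at countably many points.
\<close>

lemma image_subset_closed_iff:
  assumes T: "continuous_map Y Y T" and C: "closedin Y C"
    and d: "\<And>l. B l \<noteq> {} \<Longrightarrow> d l \<in> B l"
  shows "T ` B m \<subseteq> C \<longleftrightarrow> (\<forall>l. B l \<noteq> {} \<and> d l \<in> B m \<longrightarrow> T (d l) \<in> C)"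
proof
  assume *: "\<forall>l. B l \<noteq> {} \<and> d l \<in> B m \<longrightarrow> T (d l) \<in> C"
  show "T ` B m \<subseteq> C"
  proof (rule ccontr)
    assume "\<not> T ` B m \<subseteq> C"
    then obtain y where y: "y \<in> B m" "T y \<notin> C" by blast
    have yY: "y \<in> topspace Y" using y(1) B_subset by blast
    have "openin Y {u \<in> topspace Y. T u \<in> topspace Y - C}"
      using T C by (intro openin_continuous_map_preimage) auto
    then have "openin Y (B m \<inter> {u \<in> topspace Y. T u \<in> topspace Y - C})" using B_open by blast
    moreover have "y \<in> B m \<inter> {u \<in> topspace Y. T u \<in> topspace Y - C}"
      using y yY T by (auto simp: continuous_map_def)
    ultimately obtain l where l: "y \<in> B l" "B l \<subseteq> B m \<inter> {u \<in> topspace Y. T u \<in> topspace Y - C}"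
      using B_base by meson
    then have "d l \<in> B l" using d by blast
    then show False using * l by blast
  qed
qed blast

text \<open>
  Measurability of \<open>A g y\<close> in \<open>g\<close> for fixed \<open>y\<close> is sufficient here, since by the two preceding lemmas
  only countably many points \<open>y\<close> matter.
\<close>

theorem push_measurable:
  fixes \<Gamma> :: "'g measure" and A :: "'g \<Rightarrow> 'y \<Rightarrow> 'y"
  assumes cont: "\<And>g. g \<in> space \<Gamma> \<Longrightarrow> continuous_map Y Y (A g)"
    and meas: "\<And>y U. y \<in> topspace Y \<Longrightarrow> openin Y U \<Longrightarrow> {g \<in> space \<Gamma>. A g y \<in> U} \<in> sets \<Gamma>"
    and E: "E \<subseteq> codes"
  shows "(\<lambda>(g, c). push (A g) c) \<in> borel_measurable (\<Gamma> \<Otimes>\<^sub>M restrict_space borel E)"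
proof -
  define d where "d l = (SOME y. y \<in> B l)" for l
  have d: "d l \<in> B l" if "B l \<noteq> {}" for l
    unfolding d_def using that by (auto intro: someI)
  define R where "R g m k \<longleftrightarrow> (\<forall>l. B l \<noteq> {} \<and> d l \<in> B m \<longrightarrow> A g (d l) \<in> Y closure_of B k)" for g m k
  have pR [measurable]: "Measurable.pred \<Gamma> (\<lambda>g. R g m k)" for m k
    unfolding R_def
  proof (intro pred_intros_countable(1))
    fix l
    show "Measurable.pred \<Gamma> (\<lambda>g. B l \<noteq> {} \<and> d l \<in> B m \<longrightarrow> A g (d l) \<in> Y closure_of B k)"
    proof (cases "B l \<noteq> {} \<and> d l \<in> B m")
      case True
      then have dl: "d l \<in> topspace Y" using B_subset by blast
      have "{g \<in> space \<Gamma>. A g (d l) \<in> Y closure_of B k} =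
          space \<Gamma> - {g \<in> space \<Gamma>. A g (d l) \<in> topspace Y - Y closure_of B k}"
        using cont dl by (auto simp: continuous_map_def)
      also have "\<dots> \<in> sets \<Gamma>"
        by (intro sets.compl_sets meas[OF dl]) (simp add: openin_diff)
      finally show ?thesis using True by (simp add: pred_def)
    qed auto
  qed
  let ?M = "\<Gamma> \<Otimes>\<^sub>M restrict_space borel E"
  have sp: "fst p \<in> space \<Gamma>" "snd p \<in> codes" if "p \<in> space ?M" for p
    using that E by (auto simp: space_pair_measure space_restrict_space)
  have [measurable]: "snd \<in> borel_measurable ?M"
    by (rule measurable_compose[OF measurable_snd measurable_restrict_space1[of "\<lambda>c. c" borel]]) simp
  show ?thesis
  proof (rule measurable_coordinatewise_then_product)
    fix i
    obtain j n where i: "i = prod_encode (j, n)" by (metis prod_decode_inverse surj_pair)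
    have "(\<lambda>p. (case p of (g, c) \<Rightarrow> push (A g) c) i) \<in> borel_measurable ?M \<longleftrightarrow>
      (\<lambda>p. of_bool (\<exists>m k. Y closure_of B k \<subseteq> B n \<and> hits (snd p) j m \<and> R (fst p) m k) :: real)
        \<in> borel_measurable ?M"
    proof (rule measurable_cong)
      fix p assume p: "p \<in> space ?M"
      have "(case p of (g, c) \<Rightarrow> push (A g) c) i = of_bool (A (fst p) ` decode (snd p) j \<inter> B n \<noteq> {})"
        by (simp add: case_prod_beta push_def code_def i)
      also have "A (fst p) ` decode (snd p) j \<inter> B n \<noteq> {} \<longleftrightarrow>
          (\<exists>m k. Y closure_of B k \<subseteq> B n \<and> hits (snd p) j m \<and> R (fst p) m k)"
      proof -
        have "A (fst p) ` B m \<subseteq> Y closure_of B k \<longleftrightarrow> R (fst p) m k" for m k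
          unfolding R_def
          by (rule image_subset_closed_iff[OF cont[OF sp(1)[OF p]] closedin_closure_of d])
        then show ?thesis
          unfolding image_misses_open[OF cont[OF sp(1)[OF p]] decode_subset] hits_iff[OF sp(2)[OF p]]
          by simp
      qed
      finally show "(case p of (g, c) \<Rightarrow> push (A g) c) i =
        of_bool (\<exists>m k. Y closure_of B k \<subseteq> B n \<and> hits (snd p) j m \<and> R (fst p) m k)" .
    qed
    also have "\<dots>" by measurable
    finally show "(\<lambda>p. (case p of (g, c) \<Rightarrow> push (A g) c) i) \<in> borel_measurable ?M" .
  qed
qed

end


section \<open>The law of a sequence of independent Poisson sets\<close>

lemma void_prob_cong: "emeasure M A = emeasure N B \<Longrightarrow> void_prob M A = void_prob N B"
  by (simp add: void_prob_def measure_def)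

lemma void_prob_nonneg: "0 \<le> void_prob M A"
  by (simp add: void_prob_def)

lemma void_prob_Un:
  assumes "A \<in> sets M" "B \<in> sets M" "A \<inter> B = {}"
  shows "void_prob M (A \<union> B) = void_prob M A * void_prob M B"
proof -
  have e: "emeasure M (A \<union> B) = emeasure M A + emeasure M B"
    using plus_emeasure[OF assms] by simp
  have "measure M (A \<union> B) = measure M A + measure M B"
    if "emeasure M A \<noteq> \<infinity>" "emeasure M B \<noteq> \<infinity>"
    using measure_Union[OF that assms] .
  then show ?thesis unfolding void_prob_def e by (auto simp: exp_add[symmetric])
qed

lemma void_prob_null: "emeasure M A = 0 \<Longrightarrow> void_prob M A = 1"
  by (simp add: void_prob_def measure_def)

lemma void_prob_less_1: "emeasure M A \<noteq> 0 \<Longrightarrow> void_prob M A < 1"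
  by (auto simp: void_prob_def measure_def enn2real_positive_iff top.not_eq_extremum zero_less_iff_neq_zero)

lemma void_prob_pos: "emeasure M A < \<infinity> \<Longrightarrow> 0 < void_prob M A"
  by (simp add: void_prob_def)

lemma locally_finite_closedin_isolated:
  assumes t1: "t1_space Y" and F: "F \<subseteq> topspace Y"
    and lf: "\<And>y. y \<in> topspace Y \<Longrightarrow> \<exists>U. openin Y U \<and> y \<in> U \<and> finite (F \<inter> U)"
  shows "closedin Y F" and "y \<in> F \<Longrightarrow> isolated Y F y"
proof -
  have *: "\<exists>V. openin Y V \<and> y \<in> V \<and> F \<inter> V \<subseteq> {y}" if "y \<in> topspace Y" for y
  proof -
    obtain U where U: "openin Y U" "y \<in> U" "finite (F \<inter> U)" using lf \<open>y \<in> topspace Y\<close> by blast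
    have "closedin Y (F \<inter> U - {y})"
      using t1 U(3) F by (auto simp: t1_space_closedin_finite)
    then have "openin Y (U - (F \<inter> U - {y}))" using U(1) by (rule openin_diff[rotated])
    then show ?thesis using U(2) by (intro exI[of _ "U - (F \<inter> U - {y})"]) auto
  qed
  show "isolated Y F y" if "y \<in> F"
  proof -
    have "y \<in> topspace Y" using that F by auto
    from *[OF this] obtain V where V: "openin Y V" "y \<in> V" "F \<inter> V \<subseteq> {y}"
      by (elim exE conjE)
    then have "F \<inter> V = {y}" using that by auto
    then show ?thesis using V(1) unfolding isolated_def by (intro exI[of _ V]) simp
  qed
  have "openin Y (topspace Y - F)"
  proof (subst openin_subopen, intro ballI)
    fix y assume y: "y \<in> topspace Y - F"
    then obtain V where V: "openin Y V" "y \<in> V" "F \<inter> V \<subseteq> {y}" using * by blast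
    then have "V \<subseteq> topspace Y - F" using y openin_subset[OF V(1)] by blast
    then show "\<exists>V. openin Y V \<and> y \<in> V \<and> V \<subseteq> topspace Y - F" using V by blast
  qed
  then show "closedin Y F" using F by (simp add: closedin_def)
qed

text \<open>
  A sequence of independent Poisson sets in \<open>Y\<close> is a single Poisson set in \<open>Y \<times> UNIV\<close> whose slices are
  the members of the sequence; the sequence misses \<open>U\<close> if and only if the Poisson set misses \<open>layers U\<close>.
\<close>

definition layers :: "(nat \<Rightarrow> 'y set) \<Rightarrow> ('y \<times> nat) set" where
  "layers U = (\<Union>j. U j \<times> {j})"

locale poisson_setup = polish_base Y B + sigma_finite_measure \<mu>
  for Y :: "'y topology" and B :: "nat \<Rightarrow> 'y set" and \<mu> :: "'y measure" +
  assumes open_meas: "openin Y U \<Longrightarrow> U \<in> sets \<mu>"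
    and loc_fin: "y \<in> topspace Y \<Longrightarrow> \<exists>U. openin Y U \<and> y \<in> U \<and> emeasure \<mu> U < \<infinity>"
    and full_supp: "openin Y U \<Longrightarrow> U \<noteq> {} \<Longrightarrow> emeasure \<mu> U \<noteq> 0"
    and point_null: "y \<in> topspace Y \<Longrightarrow> emeasure \<mu> {y} = 0"
    and nonempty: "topspace Y \<noteq> {}"
begin

definition \<nu> :: "('y \<times> nat) measure" where
  "\<nu> = \<mu> \<Otimes>\<^sub>M count_space UNIV"

lemma emeasure_layer: "S \<in> sets \<mu> \<Longrightarrow> emeasure \<nu> (S \<times> {j}) = emeasure \<mu> S"
proof -
  interpret C: sigma_finite_measure "count_space (UNIV :: nat set)"
    by (rule sigma_finite_measure_count_space)
  assume "S \<in> sets \<mu>"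
  then show ?thesis unfolding \<nu>_def by (subst C.emeasure_pair_measure_Times) auto
qed

lemma layer_sets: "S \<in> sets \<mu> \<Longrightarrow> S \<times> {j} \<in> sets \<nu>"
  unfolding \<nu>_def by (intro pair_measureI) auto

lemma layers_sets: "(\<And>j. U j \<in> sets \<mu>) \<Longrightarrow> layers U \<in> sets \<nu>"
  unfolding layers_def by (intro sets.countable_UN image_subsetI layer_sets)

lemma emeasure_layers:
  assumes "\<And>j. U j \<in> sets \<mu>"
  shows "emeasure \<nu> (layers U) = (\<Sum>j. emeasure \<mu> (U j))"
proof -
  have "(\<Sum>j. emeasure \<nu> (U j \<times> {j})) = emeasure \<nu> (layers U)"
    unfolding layers_def using assms
    by (intro suminf_emeasure) (auto simp: layer_sets disjoint_family_on_def)
  then show ?thesis by (simp add: emeasure_layer assms)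
qed

lemma sets_singleton: "y \<in> topspace Y \<Longrightarrow> {y} \<in> sets \<mu>"
proof -
  assume y: "y \<in> topspace Y"
  have "closedin Y {y}" using y Hausdorff by (simp add: closedin_Hausdorff_singleton)
  then have "topspace Y - (topspace Y - {y}) \<in> sets \<mu>"
    by (intro sets.Diff open_meas) auto
  then show ?thesis using y by (simp add: Diff_Diff_Int)
qed

definition misses :: "(nat \<Rightarrow> 'y set) \<Rightarrow> (nat \<Rightarrow> real) set" where
  "misses U = {c \<in> codes. \<forall>j. decode c j \<inter> U j = {}}"

lemma misses_borel: "(\<And>j. openin Y (U j)) \<Longrightarrow> misses U \<in> sets borel"
proof -
  assume U: "\<And>j. openin Y (U j)"
  have "misses U = {c \<in> space borel. c \<in> codes \<and> (\<forall>j n. B n \<subseteq> U j \<longrightarrow> \<not> hits c j n)}"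
  proof -
    have "(\<forall>j. decode c j \<inter> U j = {}) \<longleftrightarrow> (\<forall>j n. B n \<subseteq> U j \<longrightarrow> \<not> hits c j n)" if "c \<in> codes" for c
      using decode_misses_iff[OF that U] by simp
    then show ?thesis unfolding misses_def by auto
  qed
  also have "\<dots> \<in> sets borel" by measurable
  finally show ?thesis .
qed

text \<open>
  The Poisson set is constructed along the cover of \<open>Y \<times> UNIV\<close> by the products of the basic sets of
  finite measure with singletons. Its slices are then locally finite, hence closed and discrete, so
  that they coincide with the sets decoded from their codes.
\<close>

theorem poisson_law_exists:
  "\<exists>P :: (nat \<Rightarrow> real) measure. prob_space P \<and> sets P = sets borel \<and>
     (AE c in P. c \<in> codes) \<and>
     (AE c in P. \<forall>j n. hits c j n \<longrightarrow> (\<exists>m. B m \<subseteq> B n \<and> isolates c j m)) \<and>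
     (\<forall>U. (\<forall>j. openin Y (U j)) \<longrightarrow> measure P (misses U) = void_prob \<nu> (layers U)) \<and>
     (\<forall>y\<in>topspace Y. \<forall>j. AE c in P. y \<notin> decode c j)"
proof -
  define C where "C k = (case prod_decode k of (j, n) \<Rightarrow>
     if emeasure \<mu> (B n) < \<infinity> then B n \<times> {j} else {})" for k
  have B_sets: "B n \<in> sets \<mu>" for n by (rule open_meas[OF B_open])
  have C1: "C k \<in> sets \<nu>" for k
    by (auto simp: C_def B_sets layer_sets split: prod.split)
  have C2: "emeasure \<nu> (C k) < \<infinity>" for k
    by (auto simp: C_def B_sets emeasure_layer split: prod.split)
  have fin_base: "\<exists>n. y \<in> B n \<and> emeasure \<mu> (B n) < \<infinity>" if "y \<in> topspace Y" for y
  proof -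
    obtain U where U: "openin Y U" "y \<in> U" "emeasure \<mu> U < \<infinity>" using loc_fin \<open>y \<in> topspace Y\<close> by blast
    then obtain n where n: "y \<in> B n" "B n \<subseteq> U" using B_base by meson
    have "emeasure \<mu> (B n) \<le> emeasure \<mu> U" by (rule emeasure_mono[OF n(2) open_meas[OF U(1)]])
    then show ?thesis using n(1) U(3) by (meson le_less_trans)
  qed
  have CU: "(\<Union>k. C k) = topspace Y \<times> UNIV"
  proof (intro equalityI subsetI)
    fix z assume "z \<in> (\<Union>k. C k)"
    then obtain k where "z \<in> C k" by blast
    then show "z \<in> topspace Y \<times> UNIV"
      using B_subset by (cases "prod_decode k") (auto simp: C_def split: if_splits)
  next
    fix z :: "'y \<times> nat" assume "z \<in> topspace Y \<times> UNIV"
    then obtain y j where z: "z = (y, j)" "y \<in> topspace Y" by auto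
    then obtain n where "y \<in> B n" "emeasure \<mu> (B n) < \<infinity>" using fin_base by blast
    then have "z \<in> C (prod_encode (j, n))" by (simp add: C_def z)
    then show "z \<in> (\<Union>k. C k)" by blast
  qed
  obtain \<Omega> :: "(nat \<Rightarrow> nat \<times> (nat \<Rightarrow> 'y \<times> nat)) measure" and \<xi> where *: "prob_space \<Omega> \<and>
    (\<forall>\<omega>. \<xi> \<omega> \<subseteq> (\<Union>k. C k) \<and> (\<forall>k. finite (\<xi> \<omega> \<inter> C k))) \<and>
    (\<forall>A\<in>sets \<nu>. A \<subseteq> (\<Union>k. C k) \<longrightarrow> {\<omega>\<in>space \<Omega>. \<xi> \<omega> \<inter> A = {}} \<in> sets \<Omega> \<and>
       measure \<Omega> {\<omega>\<in>space \<Omega>. \<xi> \<omega> \<inter> A = {}} = void_prob \<nu> A)"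
    using poisson_set_exists[of C \<nu>, OF C1 C2] by (elim exE) (rule that)
  have O: "prob_space \<Omega>" using * by (rule conjunct1)
  have \<xi>1: "\<And>\<omega>. \<xi> \<omega> \<subseteq> (\<Union>k. C k)" "\<And>\<omega> k. finite (\<xi> \<omega> \<inter> C k)"
    and \<xi>2: "\<And>A. A \<in> sets \<nu> \<Longrightarrow> A \<subseteq> (\<Union>k. C k) \<Longrightarrow> {\<omega>\<in>space \<Omega>. \<xi> \<omega> \<inter> A = {}} \<in> sets \<Omega>"
    "\<And>A. A \<in> sets \<nu> \<Longrightarrow> A \<subseteq> (\<Union>k. C k) \<Longrightarrow>
       measure \<Omega> {\<omega>\<in>space \<Omega>. \<xi> \<omega> \<inter> A = {}} = void_prob \<nu> A"
    using * by blast+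
  interpret \<Omega>: prob_space \<Omega> by (rule O)
  define F where "F \<omega> j = {y. (y, j) \<in> \<xi> \<omega>}" for \<omega> j
  have FY: "F \<omega> j \<subseteq> topspace Y" for \<omega> j
    using \<xi>1(1)[of \<omega>] unfolding CU F_def by blast
  have t1: "t1_space Y" using Hausdorff by (rule Hausdorff_imp_t1_space)
  have lf: "\<exists>U. openin Y U \<and> y \<in> U \<and> finite (F \<omega> j \<inter> U)" if y: "y \<in> topspace Y" for \<omega> j y
  proof -
    obtain n where n: "y \<in> B n" "emeasure \<mu> (B n) < \<infinity>" using fin_base y by blast
    have "F \<omega> j \<inter> B n \<subseteq> fst ` (\<xi> \<omega> \<inter> C (prod_encode (j, n)))"
    proof
      fix u assume "u \<in> F \<omega> j \<inter> B n"
      then have "(u, j) \<in> \<xi> \<omega> \<inter> C (prod_encode (j, n))" using n(2) by (simp add: F_def C_def)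
      then show "u \<in> fst ` (\<xi> \<omega> \<inter> C (prod_encode (j, n)))" by force
    qed
    then have "finite (F \<omega> j \<inter> B n)" using \<xi>1(2) finite_surj by blast
    then show ?thesis using n(1) B_open by blast
  qed
  have clF: "closedin Y (F \<omega> j)" for \<omega> j
    by (rule locally_finite_closedin_isolated(1)[OF t1 FY lf])
  have isoF: "isolated Y (F \<omega> j) y" if "y \<in> F \<omega> j" for \<omega> j y
    by (rule locally_finite_closedin_isolated(2)[OF t1 FY lf that])
  define X where "X \<omega> = code (F \<omega>)" for \<omega>
  have dX: "decode (X \<omega>) = F \<omega>" for \<omega>
    unfolding X_def by (rule decode_code[OF clF])
  have Xc: "X \<omega> \<in> codes" for \<omega>
    unfolding X_def by (rule code_in_codes[OF clF])
  have missF: "(\<forall>j. F \<omega> j \<inter> U j = {}) \<longleftrightarrow> \<xi> \<omega> \<inter> layers U = {}" for \<omega> U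
    unfolding F_def layers_def by blast
  have missF1: "F \<omega> j \<inter> S = {} \<longleftrightarrow> \<xi> \<omega> \<inter> (S \<times> {j}) = {}" for \<omega> j S
    unfolding F_def by blast
  have Xm [measurable]: "X \<in> borel_measurable \<Omega>"
  proof (rule measurable_coordinatewise_then_product)
    fix k
    obtain j n where k: "k = prod_encode (j, n)" by (metis prod_decode_inverse surj_pair)
    have [measurable]: "Measurable.pred \<Omega> (\<lambda>\<omega>. \<xi> \<omega> \<inter> (B n \<times> {j}) = {})"
      unfolding pred_def using \<xi>2(1)[OF layer_sets[OF B_sets], of n j] B_subset[of n]
      unfolding CU by blast
    have "(\<lambda>\<omega>. X \<omega> k) = (\<lambda>\<omega>. of_bool (\<not> (\<xi> \<omega> \<inter> (B n \<times> {j}) = {})))"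
      by (simp add: X_def code_def k missF1)
    also have "\<dots> \<in> borel_measurable \<Omega>" by measurable
    finally show "(\<lambda>\<omega>. X \<omega> k) \<in> borel_measurable \<Omega>" .
  qed
  define P where "P = distr \<Omega> borel X"
  have "prob_space P" unfolding P_def by (rule \<Omega>.prob_space_distr[OF Xm])
  moreover have "sets P = sets borel" by (simp add: P_def)
  moreover have "AE c in P. c \<in> codes"
    unfolding P_def by (subst AE_distr_iff[OF Xm]) (use Xc in auto)
  moreover have "AE c in P. \<forall>j n. hits c j n \<longrightarrow> (\<exists>m. B m \<subseteq> B n \<and> isolates c j m)"
  proof -
    have "\<exists>m. B m \<subseteq> B n \<and> isolates (X \<omega>) j m" if h: "hits (X \<omega>) j n" for \<omega> j n
    proof -
      obtain y where y: "y \<in> decode (X \<omega>) j" "y \<in> B n" using h hits_iff[OF Xc] by blast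
      then obtain V where V: "openin Y V" "F \<omega> j \<inter> V = {y}"
        using isoF unfolding dX isolated_def by blast
      have "openin Y (V \<inter> B n)" using V(1) B_open by blast
      moreover have "y \<in> V \<inter> B n" using V(2) y(2) by auto
      ultimately obtain m where m: "y \<in> B m" "B m \<subseteq> V \<inter> B n" using B_base by meson
      have "decode (X \<omega>) j \<inter> B m = {y}" using V(2) m y(1) unfolding dX by auto
      then show ?thesis using m(2) isolates_iff[OF Xc] by blast
    qed
    then show ?thesis unfolding P_def by (subst AE_distr_iff[OF Xm]) auto
  qed
  moreover have "measure P (misses U) = void_prob \<nu> (layers U)" if U: "\<And>j. openin Y (U j)" for U
  proof -
    have "measure P (misses U) = measure \<Omega> (X -` misses U \<inter> space \<Omega>)"
      unfolding P_def by (rule measure_distr[OF Xm misses_borel[OF U]])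
    also have "X -` misses U \<inter> space \<Omega> = {\<omega>\<in>space \<Omega>. \<xi> \<omega> \<inter> layers U = {}}"
      using missF by (auto simp: misses_def Xc dX)
    also have "measure \<Omega> \<dots> = void_prob \<nu> (layers U)"
    proof (rule \<xi>2(2))
      show "layers U \<in> sets \<nu>" by (rule layers_sets[OF open_meas[OF U]])
      show "layers U \<subseteq> (\<Union>k. C k)" unfolding CU layers_def using openin_subset[OF U] by blast
    qed
    finally show ?thesis .
  qed
  moreover have "AE c in P. y \<notin> decode c j" if y: "y \<in> topspace Y" for y j
  proof -
    have A: "{y} \<times> {j} \<in> sets \<nu>" "{y} \<times> {j} \<subseteq> (\<Union>k. C k)"
      using layer_sets[OF sets_singleton[OF y]] y unfolding CU by auto
    have "\<Omega>.prob {\<omega>\<in>space \<Omega>. \<xi> \<omega> \<inter> ({y} \<times> {j}) = {}} = 1"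
      unfolding \<xi>2(2)[OF A]
      using void_prob_null[of \<nu> "{y} \<times> {j}"] emeasure_layer[OF sets_singleton[OF y], of j]
        point_null[OF y] by simp
    from \<Omega>.AE_prob_1[OF this] have "AE \<omega> in \<Omega>. y \<notin> decode (X \<omega>) j"
      unfolding dX by eventually_elim (auto simp: F_def)
    then show ?thesis unfolding P_def using y by (subst AE_distr_iff[OF Xm]) (simp_all add: decode_def)
  qed
  ultimately show ?thesis
    by (intro exI[of _ P] conjI allI ballI impI; (assumption | blast))
qed

end


lemma sum_const_ennreal_infinite:
  fixes c :: ennreal
  assumes "c \<noteq> 0"
  shows "(\<Sum>i::nat. c) = \<infinity>"
proof -
  have "(\<Sum>i::nat. c) = (\<integral>\<^sup>+i. c \<partial>count_space (UNIV :: nat set))"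
    by (rule nn_integral_count_space_nat[symmetric])
  also have "\<dots> = c * \<infinity>" by (subst nn_integral_const) (simp add: emeasure_count_space)
  finally show ?thesis using assms by (simp add: ennreal_mult_top)
qed

locale poisson_law = poisson_setup Y B \<mu>
  for Y :: "'y topology" and B :: "nat \<Rightarrow> 'y set" and \<mu> :: "'y measure" +
  fixes P :: "(nat \<Rightarrow> real) measure"
  assumes P_prob: "prob_space P" and P_sets [measurable_cong]: "sets P = sets borel"
    and P_codes: "AE c in P. c \<in> codes"
    and P_isolates: "AE c in P. \<forall>j n. hits c j n \<longrightarrow> (\<exists>m. B m \<subseteq> B n \<and> isolates c j m)"
    and P_void: "(\<And>j. openin Y (U j)) \<Longrightarrow> measure P (misses U) = void_prob \<nu> (layers U)"
    and P_point: "y \<in> topspace Y \<Longrightarrow> AE c in P. y \<notin> decode c j"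
begin

sublocale P: prob_space P by (rule P_prob)

lemma P_space: "space P = UNIV"
  using sets_eq_imp_space_eq[OF P_sets] by simp

text \<open>
  The events that \<open>F j\<close> meets \<open>V\<close> and misses \<open>W\<close> are independent for different \<open>j\<close> and have the same
  positive probability, so almost surely one of them occurs. Independence is extracted from the
  probabilities of missing open sets, by inclusion and exclusion one index at a time.
\<close>

lemma AE_hits_and_misses:
  assumes V: "openin Y V" and W: "openin Y W" and d: "V \<inter> W = {}" and "V \<noteq> {}"
    and fin: "emeasure \<mu> W < \<infinity>"
  shows "AE c in P. \<exists>j. decode c j \<inter> V \<noteq> {} \<and> decode c j \<inter> W = {}"
proof -
  define a where "a = void_prob \<mu> W"
  define b where "b = void_prob \<mu> (V \<union> W)"
  define q where "q = 1 - a + b"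
  have bv: "b = void_prob \<mu> V * a"
    unfolding a_def b_def by (rule void_prob_Un[OF open_meas[OF V] open_meas[OF W] d])
  have "void_prob \<mu> V < 1" by (rule void_prob_less_1[OF full_supp[OF V \<open>V \<noteq> {}\<close>]])
  moreover have "0 < a" unfolding a_def by (rule void_prob_pos[OF fin])
  ultimately have "b < a" unfolding bv by simp
  have "a \<le> 1" by (simp add: a_def void_prob_def)
  have "0 \<le> b" unfolding b_def by (rule void_prob_nonneg)
  have q: "0 \<le> q" "q < 1" unfolding q_def using \<open>b < a\<close> \<open>a \<le> 1\<close> \<open>0 \<le> b\<close> by auto
  define E where "E J = {c \<in> codes. \<forall>j<J. \<not> (decode c j \<inter> V \<noteq> {} \<and> decode c j \<inter> W = {})}" for J :: nat
  have VW: "openin Y (V \<union> W)" using V W by (rule openin_Un)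
  \<comment> \<open>The free parameter \<open>U\<close> is used by the induction to impose conditions on the set with index \<open>J\<close>.\<close>
  have key: "E J \<inter> misses U \<in> sets P \<and> measure P (E J \<inter> misses U) = void_prob \<nu> (layers U) * q ^ J"
    if "\<And>j. openin Y (U j)" "\<And>j. j < J \<Longrightarrow> U j = {}" for J U
    using that
  proof (induction J arbitrary: U)
    case 0
    have "E 0 \<inter> misses U = misses U" by (auto simp: E_def misses_def)
    then show ?case using misses_borel[OF 0(1)] P_void[OF 0(1)] by (simp add: P_sets)
  next
    case (Suc J)
    have UJ: "U J = {}" using Suc.prems(2) by simp
    have ext: "misses (U(J := S)) = {c \<in> misses U. decode c J \<inter> S = {}} \<and>
        void_prob \<nu> (layers (U(J := S))) = void_prob \<nu> (layers U) * void_prob \<mu> S"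
      if S: "openin Y S" for S
    proof (intro conjI)
      show "misses (U(J := S)) = {c \<in> misses U. decode c J \<inter> S = {}}"
        using UJ by (auto simp: misses_def split: if_splits)
      have "layers (U(J := S)) = layers U \<union> S \<times> {J}"
        using UJ by (auto simp: layers_def split: if_splits)
      moreover have "void_prob \<nu> (layers U \<union> S \<times> {J}) = void_prob \<nu> (layers U) * void_prob \<nu> (S \<times> {J})"
        by (intro void_prob_Un layers_sets layer_sets open_meas Suc.prems(1) S)
          (use UJ in \<open>auto simp: layers_def\<close>)
      moreover have "void_prob \<nu> (S \<times> {J}) = void_prob \<mu> S"
        by (intro void_prob_cong emeasure_layer open_meas S)
      ultimately show "void_prob \<nu> (layers (U(J := S))) = void_prob \<nu> (layers U) * void_prob \<mu> S"
        by simp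
    qed
    let ?S = "E J \<inter> misses U"
    let ?S1 = "E J \<inter> misses (U(J := W))"
    let ?S2 = "E J \<inter> misses (U(J := V \<union> W))"
    have 0: "?S \<in> sets P \<and> measure P ?S = void_prob \<nu> (layers U) * q ^ J"
      by (rule Suc.IH) (use Suc.prems in auto)
    have 1: "?S1 \<in> sets P \<and> measure P ?S1 = void_prob \<nu> (layers (U(J := W))) * q ^ J"
      by (rule Suc.IH) (use Suc.prems W in auto)
    have 2: "?S2 \<in> sets P \<and> measure P ?S2 = void_prob \<nu> (layers (U(J := V \<union> W))) * q ^ J"
      by (rule Suc.IH) (use Suc.prems VW in auto)
    have m1: "misses (U(J := W)) = {c \<in> misses U. decode c J \<inter> W = {}}"
      and m2: "misses (U(J := V \<union> W)) = {c \<in> misses U. decode c J \<inter> (V \<union> W) = {}}"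
      using ext[OF W] ext[OF VW] by blast+
    have eq: "E (Suc J) \<inter> misses U = (?S - ?S1) \<union> ?S2"
      unfolding m1 m2 E_def by (auto simp: less_Suc_eq)
    have sub: "?S1 \<subseteq> ?S" "?S2 \<subseteq> ?S1" unfolding m1 m2 by auto
    have "measure P ((?S - ?S1) \<union> ?S2) = measure P (?S - ?S1) + measure P ?S2"
      using 0 1 2 sub by (intro P.finite_measure_Union) auto
    also have "measure P (?S - ?S1) = measure P ?S - measure P ?S1"
      using 0 1 sub by (intro P.finite_measure_Diff) auto
    also have "measure P ?S - measure P ?S1 + measure P ?S2 = void_prob \<nu> (layers U) * q ^ Suc J"
      using 0 1 2 ext[OF W] ext[OF VW] by (simp add: q_def a_def b_def algebra_simps)
    finally have m: "measure P ((?S - ?S1) \<union> ?S2) = void_prob \<nu> (layers U) * q ^ Suc J" .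
    have "(?S - ?S1) \<union> ?S2 \<in> sets P" using 0 1 2 by blast
    then show ?case unfolding eq using m by (rule conjI)
  qed
  have E: "E J \<in> sets P \<and> measure P (E J) = q ^ J" for J
  proof -
    have "E J \<inter> misses (\<lambda>_. {}) = E J" by (auto simp: E_def misses_def)
    moreover have "void_prob \<nu> (layers (\<lambda>_. {})) = 1" by (simp add: layers_def void_prob_null)
    ultimately show ?thesis using key[of "\<lambda>_. {}" J] by simp
  qed
  have "measure P (\<Inter>J. E J) \<le> q ^ J" for J
    using P.finite_measure_mono[of "\<Inter>J. E J" "E J"] E[of J] by auto
  then have "measure P (\<Inter>J. E J) \<le> 0"
    using q by (intro LIMSEQ_le_const[OF LIMSEQ_realpow_zero]) auto
  then have "measure P (\<Inter>J. E J) = 0" using measure_nonneg by (intro antisym)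
  then have "AE c in P. c \<notin> (\<Inter>J. E J)"
    using E by (intro P.prob_eq_0[THEN iffD1]) auto
  with P_codes show ?thesis by eventually_elim (auto simp: E_def)
qed

text \<open>
  Missing \<open>B n\<close> with every index means missing infinitely many disjoint copies of \<open>B n\<close>, which
  together have infinite measure.
\<close>

lemma AE_hits:
  assumes "B n \<noteq> {}"
  shows "AE c in P. \<exists>j. hits c j n"
proof -
  have "measure P (misses (\<lambda>_. B n)) = void_prob \<nu> (layers (\<lambda>_. B n))"
    by (rule P_void[OF B_open])
  also have "emeasure \<nu> (layers (\<lambda>_. B n)) = \<infinity>"
    by (subst emeasure_layers[OF open_meas[OF B_open]])
      (rule sum_const_ennreal_infinite[OF full_supp[OF B_open assms]])
  then have "void_prob \<nu> (layers (\<lambda>_. B n)) = 0" by (simp add: void_prob_def)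
  finally have "AE c in P. c \<notin> misses (\<lambda>_. B n)"
    using misses_borel[of "\<lambda>_. B n"] B_open by (intro P.prob_eq_0[THEN iffD1]) (auto simp: P_sets)
  with P_codes show ?thesis
  proof eventually_elim
    case (elim c)
    then obtain j where "decode c j \<inter> B n \<noteq> {}" by (auto simp: misses_def)
    then show ?case using hits_iff[OF elim(1)] by blast
  qed
qed

theorem AE_rigid: "AE c in P. c \<in> rigid_codes"
proof -
  have h: "AE c in P. \<forall>n. B n \<noteq> {} \<longrightarrow> (\<exists>j. hits c j n)"
    unfolding AE_all_countable
  proof
    fix n show "AE c in P. B n \<noteq> {} \<longrightarrow> (\<exists>j. hits c j n)"
      using AE_hits[of n] by (cases "B n = {}") auto
  qed
  have s: "AE c in P. \<forall>l m. B l \<noteq> {} \<and> B l \<inter> B m = {} \<and> emeasure \<mu> (B m) < \<infinity> \<longrightarrow>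
      (\<exists>j. decode c j \<inter> B l \<noteq> {} \<and> decode c j \<inter> B m = {})"
    unfolding AE_all_countable
  proof (intro allI)
    fix l m show "AE c in P. B l \<noteq> {} \<and> B l \<inter> B m = {} \<and> emeasure \<mu> (B m) < \<infinity> \<longrightarrow>
      (\<exists>j. decode c j \<inter> B l \<noteq> {} \<and> decode c j \<inter> B m = {})"
      using AE_hits_and_misses[OF B_open B_open, of l m]
      by (cases "B l \<noteq> {} \<and> B l \<inter> B m = {} \<and> emeasure \<mu> (B m) < \<infinity>") (auto elim: eventually_mono)
  qed
  from P_codes P_isolates h s show ?thesis
  proof eventually_elim
    case (elim c)
    have "\<exists>j m. B m \<subseteq> B n \<and> isolates c j m" if "B n \<noteq> {}" for n
      using elim(2,3) that by meson
    then have dense: "\<forall>U. openin Y U \<and> U \<noteq> {} \<longrightarrow> (\<exists>j y. y \<in> U \<and> isolated Y (decode c j) y)"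
      unfolding rigid_dense_iff[OF elim(1)] by blast
    have sep: "\<exists>W. openin Y W \<and> z \<in> W \<and>
          (\<forall>V. openin Y V \<and> x \<in> V \<longrightarrow> (\<exists>j. decode c j \<inter> V \<noteq> {} \<and> decode c j \<inter> W = {}))"
      if x: "isolated Y (decode c i) x" and z: "isolated Y (decode c i) z" and "x \<noteq> z" for i x z
    proof -
      have "x \<in> decode c i" "z \<in> decode c i" using x z by (auto simp: isolated_def)
      then have xz: "x \<in> topspace Y" "z \<in> topspace Y" using decode_subset[of c i] by auto
      then obtain S Q where SQ: "openin Y S" "openin Y Q" "x \<in> S" "z \<in> Q" "disjnt S Q"
        using Hausdorff \<open>x \<noteq> z\<close> unfolding Hausdorff_space_def by metis
      obtain U where U: "openin Y U" "z \<in> U" "emeasure \<mu> U < \<infinity>" using loc_fin xz(2) by blast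
      have "openin Y (Q \<inter> U)" "z \<in> Q \<inter> U" using SQ U by auto
      then obtain m where m: "z \<in> B m" "B m \<subseteq> Q \<inter> U" using B_base by meson
      have "emeasure \<mu> (B m) \<le> emeasure \<mu> U" using m(2) by (intro emeasure_mono open_meas[OF U(1)]) auto
      then have fin: "emeasure \<mu> (B m) < \<infinity>" using U(3) by (rule le_less_trans)
      show ?thesis
      proof (rule exI[of _ "B m"], intro conjI allI impI; (elim conjE)?)
        fix V assume V: "openin Y V" "x \<in> V"
        then have "openin Y (V \<inter> S)" "x \<in> V \<inter> S" using SQ by auto
        then obtain l where l: "x \<in> B l" "B l \<subseteq> V \<inter> S" using B_base by meson
        have "B l \<inter> B m = {}" using l(2) m(2) SQ(5) by (auto simp: disjnt_def)
        then obtain j where "decode c j \<inter> B l \<noteq> {}" "decode c j \<inter> B m = {}"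
          using elim(4) l(1) fin by blast
        then show "\<exists>j. decode c j \<inter> V \<noteq> {} \<and> decode c j \<inter> B m = {}" using l(2) by blast
      qed (use B_open m in auto)
    qed
    have "rigid_family Y (decode c)"
      unfolding rigid_family_def
      by (rule conjI[OF dense], intro allI impI, elim conjE) (rule sep)
    then show ?case using elim(1) by (simp add: rigid_codes_def)
  qed
qed


section \<open>The action on rigid codes\<close>

definition rigid_law :: "(nat \<Rightarrow> real) measure" where
  "rigid_law = restrict_space P rigid_codes"

lemma space_rigid_law: "space rigid_law = rigid_codes"
  by (simp add: rigid_law_def space_restrict_space P_space)

lemma sets_rigid_law: "sets rigid_law = sets (restrict_space borel rigid_codes)"
  unfolding rigid_law_def by (rule sets_restrict_space_cong[OF P_sets])

lemma rigid_codes_P: "rigid_codes \<in> sets P"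
  by (simp add: P_sets)

lemma emeasure_rigid_law: "A \<subseteq> rigid_codes \<Longrightarrow> emeasure rigid_law A = emeasure P A"
  unfolding rigid_law_def using rigid_codes_P by (intro emeasure_restrict_space) (auto simp: P_space)

lemma prob_space_rigid_law: "prob_space rigid_law"
proof
  have "emeasure rigid_law (space rigid_law) = emeasure P rigid_codes" by (simp add: space_rigid_law emeasure_rigid_law)
  also have "\<dots> = 1" using P.AE_in_set_eq_1[OF rigid_codes_P] AE_rigid by (simp add: P.emeasure_eq_measure)
  finally show "emeasure rigid_law (space rigid_law) = 1" .
qed

lemma standard_borel_space_rigid_law: "standard_borel_space rigid_law"
  by (rule borel_subset_standard[OF rigid_codes_borel space_rigid_law sets_rigid_law])

lemma emeasure_rigid_law_misses:
  assumes "\<And>j. openin Y (U j)"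
  shows "emeasure rigid_law (misses U \<inter> rigid_codes) = ennreal (void_prob \<nu> (layers U))"
proof -
  have "emeasure rigid_law (misses U \<inter> rigid_codes) = emeasure P (misses U \<inter> rigid_codes)"
    by (rule emeasure_rigid_law) simp
  also have "\<dots> = emeasure P (misses U)"
    using AE_rigid misses_borel[OF assms] rigid_codes_P
    by (intro emeasure_eq_AE) (auto simp: P_sets)
  finally show ?thesis by (simp add: P.emeasure_eq_measure P_void[OF assms])
qed

text \<open>
  Since \<open>misses U \<inter> misses V\<close> is \<open>misses\<close> of the pointwise union, the generator is closed under
  intersection, so a law is determined by the probabilities of missing open sets.
\<close>

lemma sets_rigid_law_generated:
  "sets rigid_law = sigma_sets rigid_codes {misses U \<inter> rigid_codes |U. \<forall>j. openin Y (U j)}" (is "_ = sigma_sets _ ?G")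
proof (rule antisym)
  have "?G \<subseteq> sets rigid_law"
    unfolding sets_rigid_law using misses_borel by (auto simp: sets_restrict_space Int_commute)
  from sets.sigma_sets_subset[OF this] show "sigma_sets rigid_codes ?G \<subseteq> sets rigid_law"
    by (simp add: space_rigid_law)
next
  define \<Sigma> where "\<Sigma> = sigma rigid_codes ?G"
  have s\<Sigma>: "sets \<Sigma> = sigma_sets rigid_codes ?G" "space \<Sigma> = rigid_codes"
    unfolding \<Sigma>_def by (auto intro!: sets_measure_of space_measure_of)
  have "(\<lambda>c. c) \<in> borel_measurable \<Sigma>"
  proof (rule measurable_coordinatewise_then_product)
    fix k
    obtain j n where k: "k = prod_encode (j, n)" by (metis prod_decode_inverse surj_pair)
    define U where "U = (\<lambda>i. if i = j then B n else {})"
    have U: "openin Y (U i)" for i using B_open by (simp add: U_def)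
    have "c k = (if c \<in> misses U \<inter> rigid_codes then 0 else 1)" if c: "c \<in> space \<Sigma>" for c
    proof -
      have c': "c \<in> codes" using c by (simp add: s\<Sigma> rigid_codes_def)
      then have "c k = 0 \<or> c k = 1" by (auto simp: codes_def code_def)
      moreover have "c k = 1 \<longleftrightarrow> decode c j \<inter> B n \<noteq> {}" using hits_iff[OF c', of j n] by (simp add: hits_def k)
      moreover have "c \<in> misses U \<inter> rigid_codes \<longleftrightarrow> decode c j \<inter> B n = {}"
        using c c' by (auto simp: misses_def U_def s\<Sigma> split: if_splits)
      ultimately show ?thesis by auto
    qed
    moreover have "misses U \<inter> rigid_codes \<in> sets \<Sigma>"
      unfolding s\<Sigma> using U by (intro sigma_sets.Basic) auto
    then have "(\<lambda>c. if c \<in> misses U \<inter> rigid_codes then 0 else 1 :: real) \<in> borel_measurable \<Sigma>"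
      by measurable
    ultimately show "(\<lambda>c. c k) \<in> borel_measurable \<Sigma>"
      by (subst measurable_cong) auto
  qed
  then have "S \<inter> rigid_codes \<in> sets \<Sigma>" if "S \<in> sets borel" for S
    using measurable_sets[of "\<lambda>c. c" \<Sigma> borel S] that by (simp add: s\<Sigma>)
  then show "sets rigid_law \<subseteq> sigma_sets rigid_codes ?G"
    unfolding sets_rigid_law s\<Sigma>(1)[symmetric] by (auto simp: sets_restrict_space Int_commute)
qed

theorem distr_rigid_law_push:
  assumes T: "homeomorphic_map Y Y T" and m: "push T \<in> rigid_law \<rightarrow>\<^sub>M rigid_law"
    and inv: "\<And>U. openin Y U \<Longrightarrow> emeasure \<mu> {y \<in> topspace Y. T y \<in> U} = emeasure \<mu> U"
  shows "distr rigid_law rigid_law (push T) = rigid_law"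
proof (rule measure_eqI_generator_eq)
  let ?G = "{misses U \<inter> rigid_codes |U. \<forall>j. openin Y (U j)}"
  show "Int_stable ?G"
  proof (rule Int_stableI)
    fix a b assume "a \<in> ?G" "b \<in> ?G"
    then obtain U V where "a = misses U \<inter> rigid_codes" "b = misses V \<inter> rigid_codes"
      "\<forall>j. openin Y (U j)" "\<forall>j. openin Y (V j)" by blast
    then have "a \<inter> b = misses (\<lambda>j. U j \<union> V j) \<inter> rigid_codes" "\<forall>j. openin Y (U j \<union> V j)"
      by (auto simp: misses_def)
    then show "a \<inter> b \<in> ?G" by blast
  qed
  show "?G \<subseteq> Pow rigid_codes" by blast
  show "sets (distr rigid_law rigid_law (push T)) = sigma_sets rigid_codes ?G" by (simp add: sets_rigid_law_generated)
  show "sets rigid_law = sigma_sets rigid_codes ?G" by (rule sets_rigid_law_generated)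
  show "range (\<lambda>_::nat. misses (\<lambda>_. {}) \<inter> rigid_codes) \<subseteq> ?G" by auto
  show "(\<Union>_::nat. misses (\<lambda>_. {}) \<inter> rigid_codes) = rigid_codes"
    by (auto simp: misses_def rigid_codes_def)
  interpret rigid_law: prob_space rigid_law by (rule prob_space_rigid_law)
  interpret D: prob_space "distr rigid_law rigid_law (push T)" by (rule rigid_law.prob_space_distr[OF m])
  show "emeasure (distr rigid_law rigid_law (push T)) (misses (\<lambda>_. {}) \<inter> rigid_codes) \<noteq> \<infinity>" for i :: nat
    by (simp add: D.emeasure_eq_measure)
  fix a assume "a \<in> ?G"
  then obtain U where a: "a = misses U \<inter> rigid_codes" and U: "\<And>j. openin Y (U j)" by blast
  define V where "V j = {y \<in> topspace Y. T y \<in> U j}" for j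
  have V: "openin Y (V j)" for j
    unfolding V_def by (rule openin_continuous_map_preimage[OF homeomorphic_imp_continuous_map[OF T] U])
  have aN: "a \<in> sets rigid_law" unfolding sets_rigid_law_generated using U a by (intro sigma_sets.Basic) auto
  have "emeasure (distr rigid_law rigid_law (push T)) a = emeasure rigid_law (push T -` a \<inter> space rigid_law)"
    by (rule emeasure_distr[OF m aN])
  also have "push T -` a \<inter> space rigid_law = misses V \<inter> rigid_codes"
  proof -
    have "push T c \<in> a \<longleftrightarrow> c \<in> misses V" if c: "c \<in> rigid_codes" for c
    proof -
      have "T ` decode c j \<inter> U j = {} \<longleftrightarrow> decode c j \<inter> V j = {}" for j
        using decode_subset[of c j] unfolding V_def by blast
      then show ?thesis
        using push_in_rigid_codes[OF T c] push_in_codes[OF T] c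
        by (simp add: a misses_def decode_push[OF T] rigid_codes_def)
    qed
    then show ?thesis by (auto simp: space_rigid_law)
  qed
  also have "emeasure rigid_law (misses V \<inter> rigid_codes) = ennreal (void_prob \<nu> (layers V))"
    by (rule emeasure_rigid_law_misses[OF V])
  also have "void_prob \<nu> (layers V) = void_prob \<nu> (layers U)"
    using emeasure_layers[of V, OF open_meas[OF V]] emeasure_layers[of U, OF open_meas[OF U]] inv[OF U]
    by (intro void_prob_cong) (simp add: V_def)
  also have "ennreal (void_prob \<nu> (layers U)) = emeasure rigid_law a"
    unfolding a by (rule emeasure_rigid_law_misses[OF U, symmetric])
  finally show "emeasure (distr rigid_law rigid_law (push T)) a = emeasure rigid_law a" .
qed

text \<open>
  Some member of a rigid family contains a point, and a fixed point almost surely belongs to none of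
  the random sets.
\<close>

lemma point_null_rigid_law:
  assumes a: "a \<in> rigid_codes"
  shows "emeasure rigid_law {a} = 0"
proof -
  obtain u where "u \<in> topspace Y" using nonempty by blast
  then obtain j y where "isolated Y (decode a j) y"
    using rigid_family_dense[of Y "decode a" "topspace Y" u] a by (auto simp: rigid_codes_def)
  then have y: "y \<in> decode a j" by (auto simp: isolated_def)
  then have "AE c in P. y \<notin> decode c j" using decode_subset by (intro P_point) auto
  then have "AE c in P. c \<notin> {a}" by eventually_elim (use y in auto)
  then have "emeasure P {a} = 0"
    by (subst (asm) AE_iff_measurable[of "{a}"]) (auto simp: P_sets P_space)
  then show ?thesis using a by (simp add: emeasure_rigid_law)
qed

text \<open>
  On an atom each of the countably many coordinates would be almost surely constant, so the atom
  would carry a point of positive measure.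
\<close>

lemma non_atomic_rigid_law: "non_atomic rigid_law"
  unfolding non_atomic_def
proof (intro ballI impI, rule ccontr)
  fix A assume A: "A \<in> sets rigid_law" and pos: "emeasure rigid_law A > 0"
    and na: "\<not> (\<exists>S\<in>sets rigid_law. S \<subseteq> A \<and> 0 < emeasure rigid_law S \<and> emeasure rigid_law S < emeasure rigid_law A)"
  interpret rigid_law: prob_space rigid_law by (rule prob_space_rigid_law)
  have AR: "A \<subseteq> rigid_codes" using sets.sets_into_space[OF A] by (simp add: space_rigid_law)
  have dich: "emeasure rigid_law S = 0 \<or> emeasure rigid_law (A - S) = 0" if S: "S \<in> sets rigid_law" "S \<subseteq> A" for S
  proof -
    have "emeasure rigid_law S = 0 \<or> \<not> emeasure rigid_law S < emeasure rigid_law A"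
      using na S by (auto simp: zero_less_iff_neq_zero)
    moreover have "emeasure rigid_law (A - S) = emeasure rigid_law A - emeasure rigid_law S"
      by (rule emeasure_Diff) (use S A in auto)
    moreover have "emeasure rigid_law A < \<top>" using rigid_law.emeasure_finite[of A] by (simp add: less_top[symmetric])
    then have "emeasure rigid_law A - emeasure rigid_law S = 0" if "\<not> emeasure rigid_law S < emeasure rigid_law A"
      using that by (intro diff_eq_0_ennreal) (auto simp: not_less)
    ultimately show ?thesis by auto
  qed
  have [measurable]: "(\<lambda>c. c k) \<in> borel_measurable rigid_law" for k
  proof -
    have "(\<lambda>c. c k) \<in> borel_measurable (restrict_space borel rigid_codes)"
      by (rule measurable_restrict_space1) simp
    then show ?thesis using measurable_cong_sets[OF sets_rigid_law refl] by blast
  qed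
  define S where "S k = {c \<in> A. c k = 1}" for k
  have S: "S k \<in> sets rigid_law" for k
  proof -
    have "S k = A \<inter> {c \<in> space rigid_law. c k = 1}" using sets.sets_into_space[OF A] by (auto simp: S_def)
    also have "\<dots> \<in> sets rigid_law" using A by measurable
    finally show ?thesis .
  qed
  define a :: "nat \<Rightarrow> real" where "a k = (if emeasure rigid_law (S k) = 0 then 0 else 1)" for k
  have null: "AE c in rigid_law. c \<in> A \<longrightarrow> c k = a k" for k
  proof -
    have "{c \<in> A. c k \<noteq> a k} \<subseteq> (if emeasure rigid_law (S k) = 0 then S k else A - S k)"
      using AR by (auto simp: S_def a_def rigid_codes_def codes_def code_def)
    moreover have "(if emeasure rigid_law (S k) = 0 then S k else A - S k) \<in> null_sets rigid_law"
      using dich[OF S[of k]] S[of k] A by (auto simp: S_def)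
    ultimately show ?thesis
      using sets.sets_into_space[OF A]
      by (intro AE_I'[of "if emeasure rigid_law (S k) = 0 then S k else A - S k"]) auto
  qed
  have "AE c in rigid_law. \<forall>k. c \<in> A \<longrightarrow> c k = a k" unfolding AE_all_countable using null by blast
  then have ae: "AE c in rigid_law. c \<in> A \<longrightarrow> c \<in> {a} \<inter> A" by eventually_elim auto
  have "emeasure rigid_law ({a} \<inter> A) = 0"
  proof (cases "a \<in> A")
    case True
    then show ?thesis using point_null_rigid_law[of a] AR by auto
  qed auto
  moreover have "{a} \<inter> A \<in> sets rigid_law"
  proof -
    have "{a} \<in> sets (borel :: (nat \<Rightarrow> real) measure)" by simp
    then have "rigid_codes \<inter> {a} \<in> sets rigid_law" unfolding sets_rigid_law sets_restrict_space by blast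
    then have "rigid_codes \<inter> {a} \<inter> A \<in> sets rigid_law" using A by blast
    moreover have "rigid_codes \<inter> {a} \<inter> A = {a} \<inter> A" using AR by blast
    ultimately show ?thesis by simp
  qed
  moreover have "emeasure rigid_law A \<le> emeasure rigid_law ({a} \<inter> A)"
    using ae by (intro emeasure_mono_AE) (use calculation A in auto)
  ultimately show False using pos by simp
qed

end

lemma polish_base_exists:
  assumes "polish_topology Y"
  shows "\<exists>B. polish_base Y B"
proof -
  obtain \<B> where \<B>: "countable \<B>" "\<And>V. V \<in> \<B> \<Longrightarrow> openin Y V"
    "\<And>U y. openin Y U \<Longrightarrow> y \<in> U \<Longrightarrow> \<exists>V\<in>\<B>. y \<in> V \<and> V \<subseteq> U"
    using assms unfolding polish_topology_def second_countable_def by metis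
  define B where "B = from_nat_into (insert {} \<B>)"
  have r: "range B = insert {} \<B>"
    unfolding B_def using \<B>(1) by (intro range_from_nat_into) auto
  have "polish_base Y B"
  proof
    show "completely_metrizable_space Y" using assms by (simp add: polish_topology_def)
    show "openin Y (B n)" for n
      using r \<B>(2) by (metis insertE openin_empty rangeI)
    show "\<exists>n. y \<in> B n \<and> B n \<subseteq> U" if U: "openin Y U" "y \<in> U" for U y
    proof -
      obtain V where V: "V \<in> \<B>" "y \<in> V" "V \<subseteq> U" using \<B>(3)[OF U] by blast
      then have "V \<in> range B" using r by blast
      then show ?thesis using V by blast
    qed
  qed
  then show ?thesis by blast
qed

text \<open>
  This is the passage from a locally finite invariant measure to an invariant probability measure.
  The action is continuous in the point and Borel in the group element separately, since this is
  what the Maharam extension provides.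
\<close>

theorem free_action_of_homeomorphic_action:
  fixes G :: "('g, 'm) monoid_scheme" and Y :: "'y topology" and A :: "'g \<Rightarrow> 'y \<Rightarrow> 'y"
  assumes grp: "group G" and ts: "topspace \<tau>G = carrier G"
    and pol: "polish_topology Y" and ne: "topspace Y \<noteq> {}"
    and sf: "sigma_finite_measure \<mu>" and om: "\<And>U. openin Y U \<Longrightarrow> U \<in> sets \<mu>"
    and lf: "\<And>y. y \<in> topspace Y \<Longrightarrow> \<exists>U. openin Y U \<and> y \<in> U \<and> emeasure \<mu> U < \<infinity>"
    and fs: "\<And>U. openin Y U \<Longrightarrow> U \<noteq> {} \<Longrightarrow> emeasure \<mu> U \<noteq> 0"
    and pn: "\<And>y. y \<in> topspace Y \<Longrightarrow> emeasure \<mu> {y} = 0"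
    and cont: "\<And>g. g \<in> carrier G \<Longrightarrow> continuous_map Y Y (A g)"
    and one: "\<And>y. y \<in> topspace Y \<Longrightarrow> A \<one>\<^bsub>G\<^esub> y = y"
    and mult: "\<And>g h y. g \<in> carrier G \<Longrightarrow> h \<in> carrier G \<Longrightarrow> y \<in> topspace Y \<Longrightarrow>
        A g (A h y) = A (g \<otimes>\<^bsub>G\<^esub> h) y"
    and meas: "\<And>y U. y \<in> topspace Y \<Longrightarrow> openin Y U \<Longrightarrow>
        {g \<in> carrier G. A g y \<in> U} \<in> sets (borel_of_top \<tau>G)"
    and inv: "\<And>g U. g \<in> carrier G \<Longrightarrow> openin Y U \<Longrightarrow>
        emeasure \<mu> {y \<in> topspace Y. A g y \<in> U} = emeasure \<mu> U"
    and faithful: "\<And>g. g \<in> carrier G \<Longrightarrow> g \<noteq> \<one>\<^bsub>G\<^esub> \<Longrightarrow> \<exists>y\<in>topspace Y. A g y \<noteq> y"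
  shows "admits_free_prob_preserving_action G \<tau>G"
proof -
  interpret G: group G by (rule grp)
  obtain B where "polish_base Y B" using polish_base_exists[OF pol] ..
  then interpret polish_base Y B .
  interpret poisson_setup Y B \<mu>
    by (intro poisson_setup.intro poisson_setup_axioms.intro \<open>polish_base Y B\<close> sf om lf fs pn ne)
  obtain P :: "(nat \<Rightarrow> real) measure" where P: "prob_space P" "sets P = sets borel"
     "AE c in P. c \<in> codes"
     "AE c in P. \<forall>j n. hits c j n \<longrightarrow> (\<exists>m. B m \<subseteq> B n \<and> isolates c j m)"
     "\<forall>U. (\<forall>j. openin Y (U j)) \<longrightarrow> measure P (misses U) = void_prob \<nu> (layers U)"
     "\<forall>y\<in>topspace Y. \<forall>j. AE c in P. y \<notin> decode c j"
    using poisson_law_exists by (elim exE conjE) (rule that)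
  interpret poisson_law Y B \<mu> P
    by (intro poisson_law.intro poisson_law_axioms.intro poisson_setup_axioms P(1-4))
      (use P(5,6) in auto)
  have hom: "homeomorphic_map Y Y (A g)" if g: "g \<in> carrier G" for g
  proof -
    have "homeomorphic_maps Y Y (A g) (A (inv\<^bsub>G\<^esub> g))"
      unfolding homeomorphic_maps_def
      using g cont mult[of g "inv\<^bsub>G\<^esub> g"] mult[of "inv\<^bsub>G\<^esub> g" g] one by simp
    then show ?thesis using homeomorphic_maps_map by blast
  qed
  let ?S = "\<lambda>g. push (A g)"
  have Gsp: "space (borel_of_top \<tau>G) = carrier G" by (simp add: ts)
  have "(\<lambda>(g, c). ?S g c) \<in> borel_measurable (borel_of_top \<tau>G \<Otimes>\<^sub>M restrict_space borel rigid_codes)"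
    by (rule push_measurable) (use cont meas in \<open>auto simp: Gsp ts rigid_codes_def\<close>)
  then have "(\<lambda>(g, c). ?S g c) \<in> (borel_of_top \<tau>G \<Otimes>\<^sub>M restrict_space borel rigid_codes) \<rightarrow>\<^sub>M
      restrict_space borel rigid_codes"
    by (intro measurable_restrict_space2)
      (auto simp: space_pair_measure space_restrict_space ts intro!: push_in_rigid_codes hom)
  also have "(borel_of_top \<tau>G \<Otimes>\<^sub>M restrict_space borel rigid_codes) \<rightarrow>\<^sub>M restrict_space borel rigid_codes
      = (borel_of_top \<tau>G \<Otimes>\<^sub>M rigid_law) \<rightarrow>\<^sub>M rigid_law"
    by (intro measurable_cong_sets sets_pair_measure_cong sets_rigid_law[symmetric] refl)
  finally have joint: "(\<lambda>(g, c). ?S g c) \<in> (borel_of_top \<tau>G \<Otimes>\<^sub>M rigid_law) \<rightarrow>\<^sub>M rigid_law" .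
  have act: "borel_action G \<tau>G rigid_law ?S"
    unfolding borel_action_def
  proof (intro conjI ballI joint)
    fix c assume c: "c \<in> space rigid_law"
    then show "?S \<one>\<^bsub>G\<^esub> c = c" using one by (intro push_ident) (auto simp: space_rigid_law rigid_codes_def)
    fix g h assume gh: "g \<in> carrier G" "h \<in> carrier G"
    have "?S g (?S h c) = push (A g \<circ> A h) c" by (rule push_push[OF hom[OF gh(2)]])
    also have "\<dots> = ?S (g \<otimes>\<^bsub>G\<^esub> h) c" by (rule push_cong) (simp add: mult gh)
    finally show "?S g (?S h c) = ?S (g \<otimes>\<^bsub>G\<^esub> h) c" .
  qed
  have pres: "distr rigid_law rigid_law (?S g) = rigid_law" if g: "g \<in> carrier G" for g
  proof (rule distr_rigid_law_push[OF hom[OF g]])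
    have "g \<in> space (borel_of_top \<tau>G)" using g by (simp add: Gsp ts)
    from measurable_compose[OF measurable_Pair1'[OF this] joint]
    show "?S g \<in> rigid_law \<rightarrow>\<^sub>M rigid_law" by simp
  qed (rule inv[OF g])
  have free: "?S g c \<noteq> c" if g: "g \<in> carrier G" "g \<noteq> \<one>\<^bsub>G\<^esub>" and c: "c \<in> space rigid_law" for g c
  proof
    assume fixed: "?S g c = c"
    obtain y where y: "y \<in> topspace Y" "A g y \<noteq> y" using faithful[OF g] by blast
    have "A g ` decode c j = decode c j" for j
      using decode_push[OF hom[OF g(1)], of c] unfolding fixed by metis
    then have "A g y = y"
      using c by (intro rigid_family_imp_trivial[OF hom[OF g(1)] Hausdorff decode_subset _ _ y(1)])
        (auto simp: space_rigid_law rigid_codes_def)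
    then show False using y(2) by simp
  qed
  interpret rigid_law: prob_space rigid_law by (rule prob_space_rigid_law)
  show ?thesis
    unfolding admits_free_prob_preserving_action_def prob_preserving_spatial_action_def
      spatial_action_def standard_measure_space_def free_action_def
    using standard_borel_space_rigid_law non_atomic_rigid_law prob_space_rigid_law act pres free rigid_law.emeasure_space_1
    by (intro exI[of _ rigid_law] exI[of _ ?S]) auto
qed


section \<open>Preliminaries on products\<close>

lemma second_countable_prod_topology:
  assumes "second_countable X" "second_countable Y"
  shows "second_countable (prod_topology X Y)"
proof -
  obtain \<A> where A: "countable \<A>" "\<And>V. V \<in> \<A> \<Longrightarrow> openin X V"
    "\<And>U x. openin X U \<Longrightarrow> x \<in> U \<Longrightarrow> \<exists>V\<in>\<A>. x \<in> V \<and> V \<subseteq> U"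
    using assms(1) unfolding second_countable_def by metis
  obtain \<B> where B: "countable \<B>" "\<And>V. V \<in> \<B> \<Longrightarrow> openin Y V"
    "\<And>U x. openin Y U \<Longrightarrow> x \<in> U \<Longrightarrow> \<exists>V\<in>\<B>. x \<in> V \<and> V \<subseteq> U"
    using assms(2) unfolding second_countable_def by metis
  let ?C = "(\<lambda>(V, W). V \<times> W) ` (\<A> \<times> \<B>)"
  have "\<exists>Q\<in>?C. z \<in> Q \<and> Q \<subseteq> U" if U: "openin (prod_topology X Y) U" "z \<in> U" for U z
  proof -
    obtain V W where VW: "openin X V" "openin Y W" "fst z \<in> V" "snd z \<in> W" "V \<times> W \<subseteq> U"
      using U unfolding openin_prod_topology_alt by (metis prod.collapse)
    obtain V' where V': "V' \<in> \<A>" "fst z \<in> V'" "V' \<subseteq> V" using A(3) VW by meson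
    obtain W' where W': "W' \<in> \<B>" "snd z \<in> W'" "W' \<subseteq> W" using B(3) VW by meson
    show ?thesis
      by (rule bexI[of _ "V' \<times> W'"]) (use V' W' VW(5) in \<open>auto simp: mem_Times_iff\<close>)
  qed
  moreover have "countable ?C" using A(1) B(1) by blast
  moreover have "openin (prod_topology X Y) Q" if "Q \<in> ?C" for Q
    using that A(2) B(2) by (auto simp: openin_prod_Times_iff)
  ultimately show ?thesis unfolding second_countable_def by (intro exI[of _ ?C]) blast
qed

lemma openin_prod_sets:
  assumes X: "second_countable X" and Y: "second_countable Y"
    and M: "\<And>V. openin X V \<Longrightarrow> V \<in> sets M" and N: "\<And>W. openin Y W \<Longrightarrow> W \<in> sets N"
    and U: "openin (prod_topology X Y) U"
  shows "U \<in> sets (M \<Otimes>\<^sub>M N)"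
proof -
  obtain \<A> where A: "countable \<A>" "\<And>V. V \<in> \<A> \<Longrightarrow> openin X V"
    "\<And>U x. openin X U \<Longrightarrow> x \<in> U \<Longrightarrow> \<exists>V\<in>\<A>. x \<in> V \<and> V \<subseteq> U"
    using X unfolding second_countable_def by metis
  obtain \<B> where B: "countable \<B>" "\<And>V. V \<in> \<B> \<Longrightarrow> openin Y V"
    "\<And>U x. openin Y U \<Longrightarrow> x \<in> U \<Longrightarrow> \<exists>V\<in>\<B>. x \<in> V \<and> V \<subseteq> U"
    using Y unfolding second_countable_def by metis
  let ?I = "{p \<in> \<A> \<times> \<B>. fst p \<times> snd p \<subseteq> U}"
  have "U = (\<Union>p\<in>?I. fst p \<times> snd p)"
  proof (intro equalityI subsetI)
    fix z assume z: "z \<in> U"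
    obtain V W where VW: "openin X V" "openin Y W" "fst z \<in> V" "snd z \<in> W" "V \<times> W \<subseteq> U"
      using U z unfolding openin_prod_topology_alt by (metis prod.collapse)
    obtain V' where V': "V' \<in> \<A>" "fst z \<in> V'" "V' \<subseteq> V" using A(3) VW by meson
    obtain W' where W': "W' \<in> \<B>" "snd z \<in> W'" "W' \<subseteq> W" using B(3) VW by meson
    have "(V', W') \<in> ?I" using V' W' VW(5) by auto
    moreover have "z \<in> fst (V', W') \<times> snd (V', W')" using V' W' by (simp add: mem_Times_iff)
    ultimately show "z \<in> (\<Union>p\<in>?I. fst p \<times> snd p)" by blast
  qed blast
  also have "\<dots> \<in> sets (M \<Otimes>\<^sub>M N)"
  proof (rule sets.countable_UN')
    show "countable ?I" using A(1) B(1) by (intro countable_Collect countable_SIGMA) auto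
  qed (use A(2) B(2) M N in \<open>auto intro!: pair_measureI\<close>)
  finally show ?thesis .
qed

lemma borel_of_top_measurableI:
  assumes "f \<in> space M \<rightarrow> topspace X" "\<And>U. openin X U \<Longrightarrow> f -` U \<inter> space M \<in> sets M"
    and "sets N = sets (borel_of_top X)"
  shows "f \<in> M \<rightarrow>\<^sub>M N"
proof -
  have "f \<in> M \<rightarrow>\<^sub>M borel_of_top X"
    by (rule measurable_sigma_sets[OF borel_of_top_sets])
      (use assms in \<open>auto dest: openin_subset\<close>)
  then show ?thesis using measurable_cong_sets[OF refl assms(3)] by blast
qed

lemma emeasure_lborel_scaled:
  fixes c :: real
  assumes c: "c > 0" and D: "D \<in> sets borel"
  shows "emeasure lborel {s. s * c \<in> D} = emeasure lborel D * ennreal (1 / c)"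
proof -
  have [measurable]: "D \<in> sets borel" by (rule D)
  have m: "{s. s * c \<in> D} \<in> sets borel"
  proof -
    have "{s. s * c \<in> D} = {s \<in> space borel. s * c \<in> D}" by simp
    also have "\<dots> \<in> sets borel" by measurable
    finally show ?thesis .
  qed
  have "emeasure lborel D = (\<integral>\<^sup>+s. indicator D s \<partial>lborel)" using D by simp
  also have "\<dots> = ennreal \<bar>c\<bar> * (\<integral>\<^sup>+s. indicator D (0 + c * s) \<partial>lborel)"
    using c by (intro nn_integral_real_affine) auto
  also have "(\<lambda>s. indicator D (0 + c * s) :: ennreal) = indicator {s. s * c \<in> D}"
    by (auto simp: indicator_def fun_eq_iff mult.commute)
  also have "(\<integral>\<^sup>+s. indicator {s. s * c \<in> D} s \<partial>lborel) = emeasure lborel {s. s * c \<in> D}"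
    using m by simp
  finally have "emeasure lborel D * ennreal (1 / c) =
      (ennreal (1 / c) * ennreal c) * emeasure lborel {s. s * c \<in> D}"
    using c by (simp add: ac_simps)
  also have "ennreal (1 / c) * ennreal c = 1" using c by (simp add: ennreal_mult[symmetric])
  finally show ?thesis by simp
qed


section \<open>The continuous Radon--Nikodym cocycle on the support\<close>

locale cocycle_action =
  fixes G :: "('g, 'm) monoid_scheme" and \<tau>G :: "'g topology" and M :: "'x measure"
    and \<tau> :: "'x topology" and T :: "'g \<Rightarrow> 'x \<Rightarrow> 'x" and f :: "'g \<Rightarrow> 'x \<Rightarrow> real"
  assumes polG: "polish_group G \<tau>G"
    and act: "locally_finite_polish_nonsingular_action G \<tau>G M \<tau> T"
    and f_cont: "g \<in> carrier G \<Longrightarrow> continuous_map \<tau> euclideanreal (f g)"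
    and f_pos: "g \<in> carrier G \<Longrightarrow> x \<in> topspace \<tau> \<Longrightarrow> 0 < f g x"
    and f_RN: "g \<in> carrier G \<Longrightarrow> AE x in M. RN_deriv M (distr M M (T g)) x = ennreal (f g x)"
begin

sublocale group G
  using polG by (simp add: polish_group_def)

abbreviation \<Gamma> :: "'g measure" where "\<Gamma> \<equiv> borel_of_top \<tau>G"

lemma tsG: "topspace \<tau>G = carrier G"
  using polG by (simp add: polish_group_def)

lemma polish: "polish_topology \<tau>"
  using act by (simp add: locally_finite_polish_nonsingular_action_def polish_action_def)

lemma ts: "topspace \<tau> = space M"
  using act by (simp add: locally_finite_polish_nonsingular_action_def polish_action_def generates_borel_def)

lemma sets_M: "sets M = sets (borel_of_top \<tau>)"
  using act by (simp add: locally_finite_polish_nonsingular_action_def polish_action_def generates_borel_def)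

lemma open_M: "openin \<tau> U \<Longrightarrow> U \<in> sets M"
  unfolding sets_M by (rule borel_of_top_openin)

lemma closed_M: "closedin \<tau> C \<Longrightarrow> C \<in> sets M"
proof -
  assume C: "closedin \<tau> C"
  then have "space M - (topspace \<tau> - C) \<in> sets M" by (intro sets.compl_sets open_M) auto
  moreover have "space M - (topspace \<tau> - C) = C" using closedin_subset[OF C] ts by blast
  ultimately show ?thesis by simp
qed

lemma Hausdorff: "Hausdorff_space \<tau>"
  using polish completely_metrizable_imp_metrizable_space metrizable_imp_Hausdorff_space
  unfolding polish_topology_def by blast

sublocale sigma_finite_measure M
  using act unfolding locally_finite_polish_nonsingular_action_def nonsingular_spatial_action_def
    standard_measure_space_def
  by (auto intro: prob_space_imp_sigma_finite)

lemma M_nonzero: "emeasure M (space M) \<noteq> 0"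
  using act prob_space.emeasure_space_1[of M]
  unfolding locally_finite_polish_nonsingular_action_def nonsingular_spatial_action_def
    standard_measure_space_def by auto

lemma loc_fin: "x \<in> topspace \<tau> \<Longrightarrow> \<exists>U. openin \<tau> U \<and> x \<in> U \<and> emeasure M U < \<infinity>"
  using act by (simp add: locally_finite_polish_nonsingular_action_def locally_finite_measure_def)

lemma T_joint: "(\<lambda>(g, x). T g x) \<in> \<Gamma> \<Otimes>\<^sub>M M \<rightarrow>\<^sub>M M"
  using act by (simp add: locally_finite_polish_nonsingular_action_def polish_action_def borel_action_def)

lemma T_measurable: "g \<in> carrier G \<Longrightarrow> T g \<in> M \<rightarrow>\<^sub>M M"
  using measurable_compose[OF measurable_Pair1'[of g \<Gamma> M] T_joint] by (simp add: tsG)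

lemma T_orbit_measurable: "x \<in> space M \<Longrightarrow> (\<lambda>g. T g x) \<in> \<Gamma> \<rightarrow>\<^sub>M M"
  using measurable_compose[OF measurable_Pair2'[of x M \<Gamma>] T_joint] by simp

lemma T_in: "g \<in> carrier G \<Longrightarrow> x \<in> space M \<Longrightarrow> T g x \<in> space M"
  using T_measurable measurable_space by metis

lemma T_one: "x \<in> space M \<Longrightarrow> T \<one>\<^bsub>G\<^esub> x = x"
  using act by (simp add: locally_finite_polish_nonsingular_action_def polish_action_def borel_action_def)

lemma T_mult: "g \<in> carrier G \<Longrightarrow> h \<in> carrier G \<Longrightarrow> x \<in> space M \<Longrightarrow> T g (T h x) = T (g \<otimes>\<^bsub>G\<^esub> h) x"
  using act by (simp add: locally_finite_polish_nonsingular_action_def polish_action_def borel_action_def)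

lemma T_inv: "g \<in> carrier G \<Longrightarrow> x \<in> space M \<Longrightarrow> T (inv\<^bsub>G\<^esub> g) (T g x) = x"
  by (simp add: T_mult T_one)

lemma T_cont: "g \<in> carrier G \<Longrightarrow> continuous_map \<tau> \<tau> (T g)"
proof -
  assume g: "g \<in> carrier G"
  have j: "continuous_map (prod_topology \<tau>G \<tau>) \<tau> (\<lambda>(g, x). T g x)"
    using act by (simp add: locally_finite_polish_nonsingular_action_def polish_action_def)
  have "continuous_map \<tau> (prod_topology \<tau>G \<tau>) (\<lambda>x. (g, x))"
    using g by (simp add: continuous_map_pairwise o_def tsG)
  from continuous_map_compose[OF this j] show ?thesis by (simp add: o_def)
qed

lemma f_measurable: "g \<in> carrier G \<Longrightarrow> f g \<in> borel_measurable M"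
proof (rule borel_measurableI)
  fix S :: "real set" assume g: "g \<in> carrier G" and "open S"
  then have "openin \<tau> {x \<in> topspace \<tau>. f g x \<in> S}"
    by (intro openin_continuous_map_preimage[OF f_cont]) auto
  moreover have "{x \<in> topspace \<tau>. f g x \<in> S} = f g -` S \<inter> space M" using ts by auto
  ultimately show "f g -` S \<inter> space M \<in> sets M" using open_M by metis
qed

lemma distr_T:
  assumes g: "g \<in> carrier G"
  shows "distr M M (T g) = density M (\<lambda>x. ennreal (f g x))"
proof -
  have "absolutely_continuous M (distr M M (T g))"
    using act g by (simp add: locally_finite_polish_nonsingular_action_def nonsingular_spatial_action_def)
  then have "distr M M (T g) = density M (RN_deriv M (distr M M (T g)))"
    by (intro density_RN_deriv[symmetric]) auto
  also have "\<dots> = density M (\<lambda>x. ennreal (f g x))"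
    using f_RN[OF g] f_measurable[OF g] by (intro density_cong) auto
  finally show ?thesis .
qed

lemma nn_integral_T:
  assumes g: "g \<in> carrier G" and \<phi>: "\<phi> \<in> borel_measurable M"
  shows "(\<integral>\<^sup>+x. \<phi> (T g x) \<partial>M) = (\<integral>\<^sup>+x. ennreal (f g x) * \<phi> x \<partial>M)"
proof -
  have "(\<integral>\<^sup>+x. \<phi> (T g x) \<partial>M) = (\<integral>\<^sup>+x. \<phi> x \<partial>distr M M (T g))"
    using T_measurable[OF g] \<phi> by (intro nn_integral_distr[symmetric]) auto
  also have "\<dots> = (\<integral>\<^sup>+x. ennreal (f g x) * \<phi> x \<partial>M)"
    unfolding distr_T[OF g] using f_measurable[OF g] \<phi> by (intro nn_integral_density) auto
  finally show ?thesis .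
qed

definition supp :: "'x set" where
  "supp = {x \<in> topspace \<tau>. \<forall>U. openin \<tau> U \<and> x \<in> U \<longrightarrow> emeasure M U \<noteq> 0}"

lemma supp_subset: "supp \<subseteq> space M"
  using ts by (auto simp: supp_def)

lemma supp_complement: "openin \<tau> (topspace \<tau> - supp)" and supp_conull: "emeasure M (topspace \<tau> - supp) = 0"
proof -
  obtain \<A> where A: "countable \<A>" "\<And>V. V \<in> \<A> \<Longrightarrow> openin \<tau> V"
    "\<And>U x. openin \<tau> U \<Longrightarrow> x \<in> U \<Longrightarrow> \<exists>V\<in>\<A>. x \<in> V \<and> V \<subseteq> U"
    using polish unfolding polish_topology_def second_countable_def by metis
  let ?N = "{V \<in> \<A>. emeasure M V = 0}"
  have eq: "topspace \<tau> - supp = \<Union>?N"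
  proof (intro equalityI subsetI)
    fix x assume x: "x \<in> topspace \<tau> - supp"
    then obtain U where U: "openin \<tau> U" "x \<in> U" "emeasure M U = 0" unfolding supp_def by blast
    then obtain V where V: "V \<in> \<A>" "x \<in> V" "V \<subseteq> U" using A(3) by meson
    have "emeasure M V \<le> emeasure M U" by (rule emeasure_mono[OF V(3) open_M[OF U(1)]])
    then show "x \<in> \<Union>?N" using V U(3) by auto
  next
    fix x assume "x \<in> \<Union>?N"
    then obtain V where V: "V \<in> \<A>" "emeasure M V = 0" "x \<in> V" by blast
    then show "x \<in> topspace \<tau> - supp"
      using A(2) openin_subset[OF A(2)[OF V(1)]] unfolding supp_def by blast
  qed
  show "openin \<tau> (topspace \<tau> - supp)" unfolding eq using A(2) by blast
  have "\<Union>?N \<in> null_sets M"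
  proof -
    have "(\<Union>V\<in>?N. V) \<in> null_sets M"
      by (rule null_sets_UN') (use A(1,2) open_M in auto)
    then show ?thesis by simp
  qed
  then show "emeasure M (topspace \<tau> - supp) = 0" unfolding eq by auto
qed

lemma supp_closed: "closedin \<tau> supp"
  using supp_complement by (auto simp: closedin_def supp_def)

lemma AE_supp: "AE x in M. x \<in> supp"
proof (rule AE_I[of _ _ "topspace \<tau> - supp"])
  show "{x \<in> space M. x \<notin> supp} \<subseteq> topspace \<tau> - supp" using ts by blast
qed (use supp_conull open_M[OF supp_complement] in auto)

lemma T_supp:
  assumes g: "g \<in> carrier G" and x: "x \<in> supp"
  shows "T g x \<in> supp"
proof -
  have xM: "x \<in> space M" using x supp_subset by blast
  have "emeasure M U \<noteq> 0" if U: "openin \<tau> U" "T g x \<in> U" for U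
  proof
    assume 0: "emeasure M U = 0"
    have "absolutely_continuous M (distr M M (T g))"
      using act g by (simp add: locally_finite_polish_nonsingular_action_def nonsingular_spatial_action_def)
    then have "U \<in> null_sets (distr M M (T g))"
      using 0 open_M[OF U(1)] unfolding absolutely_continuous_def by (auto simp: null_sets_def)
    then have "emeasure M (T g -` U \<inter> space M) = 0"
      using emeasure_distr[OF T_measurable[OF g] open_M[OF U(1)]] by auto
    moreover have "T g -` U \<inter> space M = {u \<in> topspace \<tau>. T g u \<in> U}" using ts by auto
    moreover have "openin \<tau> {u \<in> topspace \<tau>. T g u \<in> U}"
      by (rule openin_continuous_map_preimage[OF T_cont[OF g] U(1)])
    ultimately show False using x xM U(2) ts unfolding supp_def by fastforce
  qed
  then show ?thesis using T_in[OF g xM] ts by (simp add: supp_def)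
qed

text \<open>
  A nonempty open set that meets the support is not null, so almost everywhere equality of continuous
  functions improves to equality at every point of the support.
\<close>

lemma eq_on_supp:
  assumes a: "continuous_map \<tau> euclideanreal a" and b: "continuous_map \<tau> euclideanreal b"
    and ae: "AE x in M. a x = b x" and x: "x \<in> supp"
  shows "a x = b x"
proof (rule ccontr)
  assume ne: "a x \<noteq> b x"
  let ?D = "{u \<in> topspace \<tau>. a u - b u \<in> - {0}}"
  have D: "openin \<tau> ?D"
    using a b by (intro openin_continuous_map_preimage[where Y=euclideanreal] continuous_map_diff)
      (auto simp: open_Compl)
  have "AE u in M. u \<notin> ?D" using ae by eventually_elim auto
  then have "emeasure M ?D = 0"
    using open_M[OF D] ts by (subst (asm) AE_iff_measurable[of ?D]) auto
  moreover have "x \<in> ?D" using ne x by (auto simp: supp_def)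
  ultimately show False using x D unfolding supp_def by blast
qed

text \<open>
  Both sides are densities of the image of \<open>M\<close> under \<open>T (g \<otimes>\<^bsub>G\<^esub> h)\<close>, and both are continuous.
\<close>

lemma cocycle:
  assumes g: "g \<in> carrier G" and h: "h \<in> carrier G" and x: "x \<in> supp"
  shows "f (g \<otimes>\<^bsub>G\<^esub> h) x = f h (T (inv\<^bsub>G\<^esub> g) x) * f g x"
proof (rule eq_on_supp[OF _ _ _ x])
  have gh: "g \<otimes>\<^bsub>G\<^esub> h \<in> carrier G" and ig: "inv\<^bsub>G\<^esub> g \<in> carrier G" using g h by auto
  show "continuous_map \<tau> euclideanreal (f (g \<otimes>\<^bsub>G\<^esub> h))" by (rule f_cont[OF gh])
  have "continuous_map \<tau> euclideanreal (f h \<circ> T (inv\<^bsub>G\<^esub> g))"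
    by (rule continuous_map_compose[OF T_cont[OF ig] f_cont[OF h]])
  then show "continuous_map \<tau> euclideanreal (\<lambda>x. f h (T (inv\<^bsub>G\<^esub> g) x) * f g x)"
    by (intro continuous_map_real_mult f_cont[OF g]) (simp add: o_def)
  note [measurable] = f_measurable[OF g] f_measurable[OF h] f_measurable[OF gh]
    T_measurable[OF g] T_measurable[OF h] T_measurable[OF ig] T_measurable[OF gh]
  have nn: "0 \<le> f h (T (inv\<^bsub>G\<^esub> g) u)" "0 \<le> f g u" "0 < f (g \<otimes>\<^bsub>G\<^esub> h) u" if "u \<in> space M" for u
    using f_pos[OF h, of "T (inv\<^bsub>G\<^esub> g) u"] f_pos[OF g, of u] f_pos[OF gh, of u] T_in[OF ig that] that ts
    by auto
  have "density M (\<lambda>u. ennreal (f (g \<otimes>\<^bsub>G\<^esub> h) u)) =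
      density M (\<lambda>u. ennreal (f h (T (inv\<^bsub>G\<^esub> g) u) * f g u))"
  proof (rule measure_eqI)
    fix A assume "A \<in> sets (density M (\<lambda>u. ennreal (f (g \<otimes>\<^bsub>G\<^esub> h) u)))"
    then have A [measurable]: "A \<in> sets M" by simp
    have "emeasure (density M (\<lambda>u. ennreal (f (g \<otimes>\<^bsub>G\<^esub> h) u))) A =
        (\<integral>\<^sup>+u. ennreal (f (g \<otimes>\<^bsub>G\<^esub> h) u) * indicator A u \<partial>M)"
      by (rule emeasure_density) auto
    also have "\<dots> = (\<integral>\<^sup>+u. indicator A (T (g \<otimes>\<^bsub>G\<^esub> h) u) \<partial>M)"
      by (rule nn_integral_T[OF gh, symmetric]) auto
    also have "\<dots> = (\<integral>\<^sup>+u. indicator A (T g (T h u)) \<partial>M)"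
      by (intro nn_integral_cong) (simp add: T_mult g h)
    also have "\<dots> = (\<integral>\<^sup>+u. ennreal (f h u) * indicator A (T g u) \<partial>M)"
      by (rule nn_integral_T[OF h, of "\<lambda>v. indicator A (T g v)"]) measurable
    also have "\<dots> = (\<integral>\<^sup>+u. ennreal (f h (T (inv\<^bsub>G\<^esub> g) (T g u))) * indicator A (T g u) \<partial>M)"
      by (intro nn_integral_cong) (simp add: T_inv g)
    also have "\<dots> = (\<integral>\<^sup>+u. ennreal (f g u) * (ennreal (f h (T (inv\<^bsub>G\<^esub> g) u)) * indicator A u) \<partial>M)"
      by (rule nn_integral_T[OF g, of "\<lambda>v. ennreal (f h (T (inv\<^bsub>G\<^esub> g) v)) * indicator A v"]) measurable
    also have "\<dots> = (\<integral>\<^sup>+u. ennreal (f h (T (inv\<^bsub>G\<^esub> g) u) * f g u) * indicator A u \<partial>M)"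
      by (intro nn_integral_cong) (simp add: nn ennreal_mult' ac_simps)
    also have "\<dots> = emeasure (density M (\<lambda>u. ennreal (f h (T (inv\<^bsub>G\<^esub> g) u) * f g u))) A"
      by (rule emeasure_density[symmetric]) auto
    finally show "emeasure (density M (\<lambda>u. ennreal (f (g \<otimes>\<^bsub>G\<^esub> h) u))) A =
      emeasure (density M (\<lambda>u. ennreal (f h (T (inv\<^bsub>G\<^esub> g) u) * f g u))) A" .
  qed simp
  then have "AE u in M. ennreal (f (g \<otimes>\<^bsub>G\<^esub> h) u) = ennreal (f h (T (inv\<^bsub>G\<^esub> g) u) * f g u)"
    by (intro density_unique) auto
  then show "AE u in M. f (g \<otimes>\<^bsub>G\<^esub> h) u = f h (T (inv\<^bsub>G\<^esub> g) u) * f g u"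
  proof (rule AE_mp, intro AE_I2 impI)
    fix u assume u: "u \<in> space M" and e: "ennreal (f (g \<otimes>\<^bsub>G\<^esub> h) u) = ennreal (f h (T (inv\<^bsub>G\<^esub> g) u) * f g u)"
    then show "f (g \<otimes>\<^bsub>G\<^esub> h) u = f h (T (inv\<^bsub>G\<^esub> g) u) * f g u"
      using nn[OF u] by (simp add: ennreal_inj)
  qed
qed

lemma f_one: "x \<in> supp \<Longrightarrow> f \<one>\<^bsub>G\<^esub> x = 1"
  using cocycle[of "\<one>\<^bsub>G\<^esub>" "\<one>\<^bsub>G\<^esub>" x] supp_subset f_pos[of "\<one>\<^bsub>G\<^esub>" x] ts T_one[of x] by fastforce

lemma f_inv:
  assumes g: "g \<in> carrier G" and x: "x \<in> supp"
  shows "f g (T g x) = 1 / f (inv\<^bsub>G\<^esub> g) x"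
proof -
  have ig: "inv\<^bsub>G\<^esub> g \<in> carrier G" using g by simp
  have "0 < f (inv\<^bsub>G\<^esub> g) x" using f_pos[OF ig] x supp_subset ts by blast
  moreover have "1 = f g (T g x) * f (inv\<^bsub>G\<^esub> g) x"
    using cocycle[OF ig g x] f_one[OF x] g by simp
  ultimately show ?thesis by (simp add: field_simps)
qed

lemma emeasure_T_le:
  assumes g: "g \<in> carrier G" and A: "A \<in> sets M" and r: "0 \<le> r" and le: "\<And>u. u \<in> A \<Longrightarrow> f g u \<le> r"
  shows "emeasure M {u \<in> space M. T g u \<in> A} \<le> ennreal r * emeasure M A"
proof -
  have "emeasure M {u \<in> space M. T g u \<in> A} = (\<integral>\<^sup>+u. indicator A (T g u) \<partial>M)"
  proof -
    have "{u \<in> space M. T g u \<in> A} \<in> sets M" using T_measurable[OF g] A by measurable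
    then have "emeasure M {u \<in> space M. T g u \<in> A} = (\<integral>\<^sup>+u. indicator {u \<in> space M. T g u \<in> A} u \<partial>M)"
      by simp
    also have "\<dots> = (\<integral>\<^sup>+u. indicator A (T g u) \<partial>M)"
      by (intro nn_integral_cong) (auto simp: indicator_def)
    finally show ?thesis .
  qed
  also have "\<dots> = (\<integral>\<^sup>+u. ennreal (f g u) * indicator A u \<partial>M)"
    by (rule nn_integral_T[OF g]) (use A in auto)
  also have "\<dots> \<le> (\<integral>\<^sup>+u. ennreal r * indicator A u \<partial>M)"
    by (intro nn_integral_mono) (auto simp: indicator_def intro!: ennreal_leI le)
  also have "\<dots> = ennreal r * emeasure M A" by (rule nn_integral_cmult_indicator[OF A])
  finally show ?thesis .
qed

lemma emeasure_T_ge: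
  assumes g: "g \<in> carrier G" and A: "A \<in> sets M" and le: "\<And>u. u \<in> A \<Longrightarrow> r \<le> f g u"
  shows "ennreal r * emeasure M A \<le> emeasure M {u \<in> space M. T g u \<in> A}"
proof -
  have "ennreal r * emeasure M A = (\<integral>\<^sup>+u. ennreal r * indicator A u \<partial>M)"
    by (rule nn_integral_cmult_indicator[OF A, symmetric])
  also have "\<dots> \<le> (\<integral>\<^sup>+u. ennreal (f g u) * indicator A u \<partial>M)"
    by (intro nn_integral_mono) (auto simp: indicator_def intro!: ennreal_leI le)
  also have "\<dots> = (\<integral>\<^sup>+u. indicator A (T g u) \<partial>M)"
    by (rule nn_integral_T[OF g, symmetric]) (use A in auto)
  also have "\<dots> = (\<integral>\<^sup>+u. indicator {u \<in> space M. T g u \<in> A} u \<partial>M)"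
    by (intro nn_integral_cong) (auto simp: indicator_def)
  also have "\<dots> = emeasure M {u \<in> space M. T g u \<in> A}"
  proof -
    have "{u \<in> space M. T g u \<in> A} \<in> sets M" using T_measurable[OF g] A by measurable
    then show ?thesis by simp
  qed
  finally show ?thesis .
qed

text \<open>
  By continuity of \<open>f g\<close>, the inequality \<open>a < f g x\<close> holds if and only if for some rational \<open>r > a\<close> the
  measure of \<open>B m\<close> under \<open>distr M M (T g)\<close> is at least \<open>r\<close> times its measure under \<open>M\<close>, for all
  basic sets \<open>B m\<close> inside some basic neighbourhood of \<open>x\<close>. The measure of a fixed set under
  \<open>distr M M (T g)\<close> is a measurable function of \<open>g\<close> by Fubini.
\<close>

lemma f_group_measurable:
  assumes x: "x \<in> supp"
  shows "(\<lambda>g. f g x) \<in> borel_measurable \<Gamma>"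
proof -
  have xts: "x \<in> topspace \<tau>" using x by (simp add: supp_def)
  obtain B where "polish_base \<tau> B" using polish_base_exists[OF polish] ..
  then interpret B: polish_base \<tau> B .
  have [measurable]: "B m \<in> sets M" for m by (rule open_M[OF B.B_open])
  define R where "R r n g \<longleftrightarrow> (\<forall>m. B m \<subseteq> B n \<longrightarrow>
      ennreal (real_of_rat r) * emeasure M (B m) \<le> emeasure M {u \<in> space M. T g u \<in> B m})" for r n g
  have em [measurable]: "(\<lambda>g. emeasure M {u \<in> space M. T g u \<in> B m}) \<in> borel_measurable \<Gamma>" for m
  proof -
    let ?Q = "(\<lambda>(g, x). T g x) -` B m \<inter> space (\<Gamma> \<Otimes>\<^sub>M M)"
    have "?Q \<in> sets (\<Gamma> \<Otimes>\<^sub>M M)" using measurable_sets[OF T_joint] by simp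
    from measurable_emeasure_Pair[OF this]
    have "(\<lambda>g. emeasure M (Pair g -` ?Q)) \<in> borel_measurable \<Gamma>" .
    also have "(\<lambda>g. emeasure M (Pair g -` ?Q)) \<in> borel_measurable \<Gamma> \<longleftrightarrow> ?thesis"
      by (intro measurable_cong arg_cong[where f="emeasure M"]) (auto simp: space_pair_measure)
    finally show ?thesis .
  qed
  have iff: "a < f g x \<longleftrightarrow> (\<exists>r n. a < real_of_rat r \<and> x \<in> B n \<and> R r n g)" if g: "g \<in> carrier G" for a g
  proof
    assume "a < f g x"
    then obtain r where r: "a < real_of_rat r" "real_of_rat r < f g x" using of_rat_dense by blast
    have "openin \<tau> {u \<in> topspace \<tau>. f g u \<in> {real_of_rat r<..}}"
      by (rule openin_continuous_map_preimage[OF f_cont[OF g]]) auto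
    moreover have "x \<in> {u \<in> topspace \<tau>. f g u \<in> {real_of_rat r<..}}" using r(2) xts by simp
    ultimately obtain n where n: "x \<in> B n" "B n \<subseteq> {u \<in> topspace \<tau>. f g u \<in> {real_of_rat r<..}}"
      using B.B_base by meson
    have "R r n g" unfolding R_def
      using n(2) by (intro allI impI emeasure_T_ge[OF g]) (auto intro!: less_imp_le)
    then show "\<exists>r n. a < real_of_rat r \<and> x \<in> B n \<and> R r n g" using r(1) n(1) by blast
  next
    assume "\<exists>r n. a < real_of_rat r \<and> x \<in> B n \<and> R r n g"
    then obtain r n where r: "a < real_of_rat r" and n: "x \<in> B n" and R: "R r n g" by blast
    show "a < f g x"
    proof (rule ccontr)
      assume "\<not> a < f g x"
      then have fa: "f g x \<le> a" by simp
      \<comment> \<open>A value strictly between \<open>f g x\<close> and \<open>r\<close> gives a neighbourhood of \<open>x\<close> on which the ratio is at most \<open>t < r\<close>.\<close>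
      define t where "t = (a + real_of_rat r) / 2"
      have t: "f g x < t" "t < real_of_rat r" using fa r by (auto simp: t_def field_simps)
      have "0 < t" using f_pos[OF g xts] t(1) by simp
      obtain U where U: "openin \<tau> U" "x \<in> U" "emeasure M U < \<infinity>" using loc_fin[OF xts] by blast
      have "openin \<tau> {u \<in> topspace \<tau>. f g u \<in> {..<t}}"
        by (rule openin_continuous_map_preimage[OF f_cont[OF g]]) auto
      then have "openin \<tau> ({u \<in> topspace \<tau>. f g u \<in> {..<t}} \<inter> U \<inter> B n)"
        using U(1) B.B_open by blast
      moreover have "x \<in> {u \<in> topspace \<tau>. f g u \<in> {..<t}} \<inter> U \<inter> B n" using t(1) xts U(2) n by simp
      ultimately obtain m where m: "x \<in> B m" "B m \<subseteq> {u \<in> topspace \<tau>. f g u \<in> {..<t}} \<inter> U \<inter> B n"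
        using B.B_base by meson
      have "ennreal (real_of_rat r) * emeasure M (B m) \<le> emeasure M {u \<in> space M. T g u \<in> B m}"
        using R m(2) unfolding R_def by blast
      also have "\<dots> \<le> ennreal t * emeasure M (B m)"
        by (rule emeasure_T_le[OF g]) (use m(2) \<open>0 < t\<close> in \<open>auto intro!: less_imp_le\<close>)
      finally have le: "ennreal (real_of_rat r) * emeasure M (B m) \<le> ennreal t * emeasure M (B m)" .
      have "emeasure M (B m) \<noteq> 0" using x m(1) B.B_open unfolding supp_def by blast
      moreover have "emeasure M (B m) \<le> emeasure M U"
        using m(2) by (intro emeasure_mono open_M[OF U(1)]) auto
      then have "emeasure M (B m) < \<top>" using U(3) by (simp add: le_less_trans)
      ultimately obtain w where w: "emeasure M (B m) = ennreal w" "w > 0"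
        by (cases "emeasure M (B m)") (auto simp: ennreal_eq_0_iff)
      have "real_of_rat r * w \<le> t * w"
        using le w t \<open>0 < t\<close> less_trans[OF \<open>0 < t\<close> t(2)] by (simp add: ennreal_mult[symmetric])
      then show False using t(2) w(2) by simp
    qed
  qed
  have "{g \<in> space \<Gamma>. a < f g x} \<in> sets \<Gamma>" for a
  proof -
    have "{g \<in> space \<Gamma>. a < f g x} =
        {g \<in> space \<Gamma>. \<exists>r n. a < real_of_rat r \<and> x \<in> B n \<and> R r n g}"
      using iff by (auto simp: tsG)
    also have "\<dots> \<in> sets \<Gamma>" unfolding R_def by measurable
    finally show ?thesis .
  qed
  then show ?thesis by (simp add: borel_measurable_iff_greater)
qed

end


section \<open>The Maharam extension\<close>

context cocycle_action
begin

definition ext_top :: "('x \<times> real) topology" where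
  "ext_top = prod_topology (subtopology \<tau> supp) (top_of_set {0<..})"

text \<open>
  The factor in the second coordinate compensates the density \<open>f g\<close> of the image of \<open>M\<close> under \<open>T g\<close>.
\<close>

definition ext_action :: "'g \<Rightarrow> 'x \<times> real \<Rightarrow> 'x \<times> real" where
  "ext_action g = (\<lambda>(x, s). (T g x, s * f g (T g x)))"

definition ext_measure :: "('x \<times> real) measure" where
  "ext_measure = M \<Otimes>\<^sub>M lborel"

lemma topspace_ext: "topspace ext_top = supp \<times> {0<..}"
  using supp_subset ts by (auto simp: ext_top_def)

lemma polish_ext: "polish_topology ext_top"
proof -
  have "completely_metrizable_space (subtopology \<tau> supp)"
    using polish supp_closed by (intro completely_metrizable_space_closedin) (auto simp: polish_topology_def)
  moreover have "completely_metrizable_space (top_of_set {0::real<..})"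
    by (intro completely_metrizable_space_openin completely_metrizable_space_euclidean) auto
  moreover have "second_countable (subtopology \<tau> supp)"
    using polish by (intro second_countable_subtopology) (auto simp: polish_topology_def)
  moreover have "second_countable (top_of_set {0::real<..})"
    by (intro second_countable_subtopology second_countable_euclidean)
  ultimately show ?thesis
    unfolding polish_topology_def ext_top_def
    by (simp add: completely_metrizable_space_prod_topology second_countable_prod_topology)
qed

lemma open_ext: "openin ext_top U \<Longrightarrow> U \<in> sets ext_measure"
  unfolding ext_top_def ext_measure_def
proof (rule openin_prod_sets)
  show "second_countable (subtopology \<tau> supp)"
    using polish by (intro second_countable_subtopology) (auto simp: polish_topology_def)
  show "second_countable (top_of_set {0::real<..})"
    by (intro second_countable_subtopology second_countable_euclidean)
  show "V \<in> sets M" if "openin (subtopology \<tau> supp) V" for V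
    using that open_M closed_M[OF supp_closed] by (auto simp: openin_subtopology)
  show "W \<in> sets lborel" if "openin (top_of_set {0::real<..}) W" for W
    using that by (auto simp: openin_subtopology)
qed

interpretation pair_sigma_finite M lborel
  by unfold_locales

lemma sigma_finite_ext: "sigma_finite_measure ext_measure"
  unfolding ext_measure_def by unfold_locales

lemma emeasure_ext_Times: "A \<in> sets M \<Longrightarrow> C \<in> sets borel \<Longrightarrow>
    emeasure ext_measure (A \<times> C) = emeasure M A * emeasure lborel C"
  unfolding ext_measure_def by (rule lborel.emeasure_pair_measure_Times) auto

lemma emeasure_Int_supp:
  assumes V: "openin \<tau> V"
  shows "emeasure M (V \<inter> supp) = emeasure M V"
  using AE_supp open_M[OF V] closed_M[OF supp_closed] by (intro emeasure_eq_AE) auto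

lemma loc_fin_ext:
  assumes y: "y \<in> topspace ext_top"
  shows "\<exists>U. openin ext_top U \<and> y \<in> U \<and> emeasure ext_measure U < \<infinity>"
proof -
  obtain x s where y': "y = (x, s)" "x \<in> supp" "s > 0" using y by (auto simp: topspace_ext)
  then obtain V where V: "openin \<tau> V" "x \<in> V" "emeasure M V < \<infinity>"
    using loc_fin[of x] by (auto simp: supp_def)
  have "openin ext_top ((V \<inter> supp) \<times> {0<..<s + 1})"
  proof -
    have "openin (subtopology \<tau> supp) (V \<inter> supp)" using V(1) by (auto simp: openin_subtopology)
    moreover have "openin (top_of_set {0<..}) {0<..<s + 1}"
      unfolding openin_subtopology by (intro exI[of _ "{0<..<s+1}"]) auto
    ultimately show ?thesis unfolding ext_top_def by (simp add: openin_prod_Times_iff)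
  qed
  moreover have "y \<in> (V \<inter> supp) \<times> {0<..<s + 1}" using y' V(2) by simp
  moreover have "emeasure ext_measure ((V \<inter> supp) \<times> {0<..<s + 1}) < \<infinity>"
  proof -
    have "emeasure ext_measure ((V \<inter> supp) \<times> {0<..<s + 1}) = emeasure M V * ennreal (s + 1)"
      using open_M[OF V(1)] closed_M[OF supp_closed] y'(3)
      by (subst emeasure_ext_Times) (auto simp: emeasure_Int_supp[OF V(1)])
    then show ?thesis using V(3) by (simp add: ennreal_mult_less_top)
  qed
  ultimately show ?thesis by blast
qed

lemma full_supp_ext:
  assumes U: "openin ext_top U" "U \<noteq> {}"
  shows "emeasure ext_measure U \<noteq> 0"
proof -
  obtain x s where xs: "(x, s) \<in> U" using U(2) by auto
  then obtain V W where VW: "openin (subtopology \<tau> supp) V" "openin (top_of_set {0::real<..}) W"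
      "x \<in> V" "s \<in> W" "V \<times> W \<subseteq> U"
    using U(1) unfolding ext_top_def openin_prod_topology_alt by meson
  obtain V' where V': "openin \<tau> V'" "V = V' \<inter> supp" using VW(1) by (auto simp: openin_subtopology)
  obtain W' where W': "open W'" "W = W' \<inter> {0<..}" using VW(2) by (auto simp: openin_subtopology)
  have Wo: "open W" unfolding W'(2) using W'(1) by auto
  then obtain e where e: "e > 0" "cball s e \<subseteq> W" using VW(4) open_contains_cball by blast
  have "emeasure lborel {s..s + e} \<le> emeasure lborel W"
    using e Wo by (intro emeasure_mono) (auto simp: subset_iff dist_real_def)
  then have "emeasure lborel W \<noteq> 0" using e(1) by auto
  moreover have "emeasure M V \<noteq> 0"
    using VW(3) V' unfolding V'(2) emeasure_Int_supp[OF V'(1)] by (auto simp: supp_def)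
  ultimately have "emeasure ext_measure (V \<times> W) \<noteq> 0"
    using open_M[OF V'(1)] closed_M[OF supp_closed] Wo V'(2)
    by (subst emeasure_ext_Times) auto
  moreover have "emeasure ext_measure (V \<times> W) \<le> emeasure ext_measure U"
    by (rule emeasure_mono[OF VW(5) open_ext[OF U(1)]])
  ultimately show ?thesis by auto
qed

lemma point_null_ext:
  assumes y: "y \<in> topspace ext_top"
  shows "emeasure ext_measure {y} = 0"
proof -
  obtain x s where y': "y = (x, s)" "x \<in> supp" using y by (auto simp: topspace_ext)
  have "{x} \<in> sets M"
    using y'(2) Hausdorff by (intro closed_M) (simp add: closedin_Hausdorff_singleton supp_def)
  then have "emeasure ext_measure ({x} \<times> {s}) = emeasure M {x} * 0"
    by (subst emeasure_ext_Times) auto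
  then show ?thesis by (simp add: y'(1))
qed

lemma continuous_ext_action:
  assumes g: "g \<in> carrier G"
  shows "continuous_map ext_top ext_top (ext_action g)"
proof -
  have f1: "continuous_map ext_top \<tau> fst"
    unfolding ext_top_def
    by (rule continuous_map_into_fulltopology[OF continuous_map_fst])
  have f2: "continuous_map ext_top euclideanreal snd"
    unfolding ext_top_def
    by (rule continuous_map_into_fulltopology[OF continuous_map_snd])
  have c1: "continuous_map ext_top \<tau> (\<lambda>p. T g (fst p))"
    using continuous_map_compose[OF f1 T_cont[OF g]] by (simp add: o_def)
  have c2: "continuous_map ext_top euclideanreal (\<lambda>p. snd p * f g (T g (fst p)))"
    using continuous_map_compose[OF c1 f_cont[OF g]]
    by (intro continuous_map_real_mult f2) (simp add: o_def)
  have c1': "continuous_map ext_top (subtopology \<tau> supp) (\<lambda>p. T g (fst p))"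
    using c1 T_supp[OF g] by (auto simp: continuous_map_in_subtopology topspace_ext)
  have pos: "0 < s * f g (T g x)" if "x \<in> supp" "0 < s" for x s
    using f_pos[OF g, of "T g x"] T_supp[OF g] that by (simp add: supp_def)
  have c2': "continuous_map ext_top (top_of_set {0<..}) (\<lambda>p. snd p * f g (T g (fst p)))"
    using c2 pos by (auto simp: continuous_map_in_subtopology topspace_ext)
  have "continuous_map ext_top ext_top (\<lambda>p. (T g (fst p), snd p * f g (T g (fst p))))"
    using c1' c2' unfolding ext_top_def by (rule continuous_map_pairedI)
  then show ?thesis by (simp add: ext_action_def case_prod_beta')
qed

lemma ext_action_one: "y \<in> topspace ext_top \<Longrightarrow> ext_action \<one>\<^bsub>G\<^esub> y = y"
  using supp_subset by (auto simp: topspace_ext ext_action_def T_one f_one)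

lemma ext_action_mult:
  assumes g: "g \<in> carrier G" and h: "h \<in> carrier G" and y: "y \<in> topspace ext_top"
  shows "ext_action g (ext_action h y) = ext_action (g \<otimes>\<^bsub>G\<^esub> h) y"
proof -
  obtain x s where y': "y = (x, s)" "x \<in> supp" "0 < s" using y by (auto simp: topspace_ext)
  have xM: "x \<in> space M" using y'(2) supp_subset by blast
  have gh: "g \<otimes>\<^bsub>G\<^esub> h \<in> carrier G" using g h by simp
  have gT: "T (inv\<^bsub>G\<^esub> g) (T (g \<otimes>\<^bsub>G\<^esub> h) x) = T h x"
    using T_inv[OF g T_in[OF h xM]] T_mult[OF g h xM] by simp
  have "f (g \<otimes>\<^bsub>G\<^esub> h) (T (g \<otimes>\<^bsub>G\<^esub> h) x) = f h (T h x) * f g (T (g \<otimes>\<^bsub>G\<^esub> h) x)"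
    using cocycle[OF g h T_supp[OF gh y'(2)]] gT by simp
  then show ?thesis by (simp add: y'(1) ext_action_def T_mult g h xM)
qed

text \<open>
  Measurability of \<open>f g (T g x)\<close> in \<open>g\<close> is reduced to that of \<open>f g x\<close> through \<open>f_inv\<close>, where the point
  at which the cocycle is evaluated does not depend on \<open>g\<close>.
\<close>

lemma ext_action_orbit_measurable:
  assumes y: "y \<in> topspace ext_top" and U: "openin ext_top U"
  shows "{g \<in> carrier G. ext_action g y \<in> U} \<in> sets \<Gamma>"
proof -
  obtain x s where y': "y = (x, s)" "x \<in> supp" "0 < s" using y by (auto simp: topspace_ext)
  have xM: "x \<in> space M" using y'(2) supp_subset by blast
  have inv_m: "(\<lambda>g. inv\<^bsub>G\<^esub> g) \<in> \<Gamma> \<rightarrow>\<^sub>M \<Gamma>"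
  proof (rule borel_of_top_measurableI[of _ _ \<tau>G])
    have c: "continuous_map \<tau>G \<tau>G (\<lambda>g. inv\<^bsub>G\<^esub> g)" using polG by (simp add: polish_group_def)
    show "(\<lambda>g. inv\<^bsub>G\<^esub> g) \<in> space \<Gamma> \<rightarrow> topspace \<tau>G" by (auto simp: tsG)
    fix V assume "openin \<tau>G V"
    then have "openin \<tau>G {g \<in> topspace \<tau>G. inv\<^bsub>G\<^esub> g \<in> V}"
      by (rule openin_continuous_map_preimage[OF c])
    moreover have "{g \<in> topspace \<tau>G. inv\<^bsub>G\<^esub> g \<in> V} = (\<lambda>g. inv\<^bsub>G\<^esub> g) -` V \<inter> space \<Gamma>" by auto
    ultimately show "(\<lambda>g. inv\<^bsub>G\<^esub> g) -` V \<inter> space \<Gamma> \<in> sets \<Gamma>" using borel_of_top_openin by metis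
  qed simp
  have "(\<lambda>g. s * (1 / f (inv\<^bsub>G\<^esub> g) x)) \<in> borel_measurable \<Gamma>"
    using measurable_compose[OF inv_m f_group_measurable[OF y'(2)]] by measurable
  then have "(\<lambda>g. s * f g (T g x)) \<in> borel_measurable \<Gamma>"
    by (subst measurable_cong[where g="\<lambda>g. s * (1 / f (inv\<^bsub>G\<^esub> g) x)"])
      (simp_all add: tsG f_inv y'(2))
  then have "(\<lambda>g. ext_action g y) \<in> \<Gamma> \<rightarrow>\<^sub>M ext_measure"
    unfolding ext_measure_def ext_action_def y'(1) prod.case
    by (intro measurable_Pair T_orbit_measurable[OF xM]) simp
  from measurable_sets[OF this open_ext[OF U]]
  have "(\<lambda>g. ext_action g y) -` U \<inter> space \<Gamma> \<in> sets \<Gamma>" .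
  moreover have "(\<lambda>g. ext_action g y) -` U \<inter> space \<Gamma> = {g \<in> carrier G. ext_action g y \<in> U}"
    by (auto simp: tsG)
  ultimately show ?thesis by simp
qed

text \<open>
  Dilating the slice over \<open>x\<close> by \<open>f g (T g x)\<close> divides the length of the preimage slice by this number,
  and integrating a function of \<open>T g x\<close> multiplies it by \<open>f g\<close>; the two factors cancel.
\<close>

lemma ext_action_preserves:
  assumes g: "g \<in> carrier G" and U: "openin ext_top U"
  shows "emeasure ext_measure {y \<in> topspace ext_top. ext_action g y \<in> U} = emeasure ext_measure U"
proof -
  let ?U = "{y \<in> topspace ext_top. ext_action g y \<in> U}"
  have oU: "openin ext_top ?U"
    by (rule openin_continuous_map_preimage[OF continuous_ext_action[OF g] U])
  have Um: "U \<in> sets (M \<Otimes>\<^sub>M lborel)" "?U \<in> sets (M \<Otimes>\<^sub>M lborel)"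
    using open_ext[OF U] open_ext[OF oU] by (simp_all add: ext_measure_def)
  have Usub: "U \<subseteq> supp \<times> {0<..}" using openin_subset[OF U] by (simp add: topspace_ext)
  define h where "h x = emeasure lborel (Pair x -` U)" for x
  have hm [measurable]: "h \<in> borel_measurable M"
    unfolding h_def by (rule lborel.measurable_emeasure_Pair[OF Um(1)])
  note [measurable] = f_measurable[OF g] T_measurable[OF g]
  have fp: "0 < f g x" if "x \<in> space M" for x using f_pos[OF g] that ts by simp
  have slice: "emeasure lborel (Pair x -` ?U) = h (T g x) * ennreal (1 / f g (T g x))"
    if x: "x \<in> supp" for x
  proof -
    define c where "c = f g (T g x)"
    have xM: "x \<in> space M" using x supp_subset by blast
    have c: "0 < c" unfolding c_def by (rule fp[OF T_in[OF g xM]])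
    have "Pair x -` ?U = {s. s * c \<in> Pair (T g x) -` U}"
    proof (rule Set.set_eqI)
      fix s
      have "0 < s * c \<longleftrightarrow> 0 < s" using c by (simp add: zero_less_mult_iff)
      moreover have "(T g x, s * c) \<in> U \<Longrightarrow> 0 < s * c" using Usub by auto
      ultimately show "s \<in> Pair x -` ?U \<longleftrightarrow> s \<in> {s. s * c \<in> Pair (T g x) -` U}"
        using x by (auto simp: topspace_ext ext_action_def c_def)
    qed
    also have "emeasure lborel \<dots> = emeasure lborel (Pair (T g x) -` U) * ennreal (1 / c)"
      using sets_Pair1[OF Um(1)] by (intro emeasure_lborel_scaled c) simp
    finally show ?thesis by (simp add: h_def c_def)
  qed
  have "emeasure ext_measure ?U = (\<integral>\<^sup>+x. emeasure lborel (Pair x -` ?U) \<partial>M)"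
    unfolding ext_measure_def by (rule lborel.emeasure_pair_measure_alt[OF Um(2)])
  also have "\<dots> = (\<integral>\<^sup>+x. h (T g x) * ennreal (1 / f g (T g x)) \<partial>M)"
    using AE_supp by (intro nn_integral_cong_AE, eventually_elim) (rule slice)
  also have "\<dots> = (\<integral>\<^sup>+x. ennreal (f g x) * (h x * ennreal (1 / f g x)) \<partial>M)"
    by (rule nn_integral_T[OF g, of "\<lambda>v. h v * ennreal (1 / f g v)"]) measurable
  also have "\<dots> = (\<integral>\<^sup>+x. h x \<partial>M)"
  proof (rule nn_integral_cong)
    fix x assume x: "x \<in> space M"
    have "ennreal (f g x) * ennreal (1 / f g x) = 1"
      using fp[OF x] by (simp add: ennreal_mult[symmetric])
    then show "ennreal (f g x) * (h x * ennreal (1 / f g x)) = h x"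
      by (simp add: ac_simps)
  qed
  also have "\<dots> = emeasure ext_measure U"
    unfolding ext_measure_def h_def by (rule lborel.emeasure_pair_measure_alt[OF Um(1), symmetric])
  finally show ?thesis .
qed

theorem free_action:
  assumes faith: "faithful_action G M T"
  shows "admits_free_prob_preserving_action G \<tau>G"
proof (rule free_action_of_homeomorphic_action[where A=ext_action and Y=ext_top and \<mu>=ext_measure])
  have ne: "\<exists>x\<in>supp. x \<in> C" if C: "C \<subseteq> space M" "emeasure M C \<noteq> 0" for C
  proof (rule ccontr)
    assume "\<not> ?thesis"
    then have "C \<subseteq> topspace \<tau> - supp" using C(1) ts by blast
    then have "emeasure M C \<le> 0"
      using emeasure_mono[OF _ open_M[OF supp_complement], of C] supp_conull by simp
    then show False using C(2) by simp
  qed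
  show "topspace ext_top \<noteq> {}"
    using ne[of "space M"] M_nonzero by (auto simp: topspace_ext)
  show "\<exists>y\<in>topspace ext_top. ext_action g y \<noteq> y" if g: "g \<in> carrier G" "g \<noteq> \<one>\<^bsub>G\<^esub>" for g
  proof -
    have "emeasure M {x \<in> space M. T g x \<noteq> x} \<noteq> 0"
      using faith g unfolding faithful_action_def by (auto dest: bspec)
    then obtain x where "x \<in> supp" "T g x \<noteq> x" using ne[of "{x \<in> space M. T g x \<noteq> x}"] by blast
    then show ?thesis by (intro bexI[of _ "(x, 1)"]) (auto simp: ext_action_def topspace_ext)
  qed
qed (use group_axioms tsG polish_ext sigma_finite_ext open_ext loc_fin_ext full_supp_ext point_null_ext
      continuous_ext_action ext_action_one ext_action_mult ext_action_orbit_measurable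
      ext_action_preserves in auto)

end


section \<open>Free probability preserving actions\<close>

lemma measure_preserving_continuous_RN:
  assumes "locally_finite_polish_action G \<tau>G M \<tau> T"
  shows "locally_finite_polish_nonsingular_action G \<tau>G M \<tau> T \<and> continuous_RN_cocycle G M \<tau> T"
proof -
  have sp: "spatial_action G \<tau>G M T" and st: "standard_measure_space M"
    and inv: "\<And>g. g \<in> carrier G \<Longrightarrow> distr M M (T g) = M"
    using assms by (simp_all add: locally_finite_polish_action_def spatial_action_def)
  interpret sigma_finite_measure M
    using st unfolding standard_measure_space_def by (auto intro: prob_space_imp_sigma_finite)
  have "AE x in M. 1 = RN_deriv M M x"
    by (rule RN_deriv_unique) (auto simp: density_1)
  then have "AE x in M. RN_deriv M M x = ennreal 1" by eventually_elim simp
  then have "continuous_RN_cocycle G M \<tau> T"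
    unfolding continuous_RN_cocycle_def by (intro ballI exI[of _ "\<lambda>_. 1"]) (simp add: inv)
  moreover have "locally_finite_polish_nonsingular_action G \<tau>G M \<tau> T"
    using assms inv
    by (auto simp: locally_finite_polish_action_def locally_finite_polish_nonsingular_action_def
        nonsingular_spatial_action_def spatial_action_def absolutely_continuous_def)
  ultimately show ?thesis by blast
qed

theorem corollary1p6:
  fixes G :: "('g, 'm) monoid_scheme" and \<tau>G :: "'g topology"
  assumes "polish_group G \<tau>G"
    and "(\<exists>(M :: 'x measure) \<tau> T.
            locally_finite_polish_action G \<tau>G M \<tau> T \<and> faithful_action G M T)
       \<or> (\<exists>(M :: 'x measure) \<tau> T.
            locally_finite_polish_nonsingular_action G \<tau>G M \<tau> T \<and>
            continuous_RN_cocycle G M \<tau> T \<and> faithful_action G M T)"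
  shows "admits_free_prob_preserving_action G \<tau>G"
proof -
  obtain M :: "'x measure" and \<tau> T where act: "locally_finite_polish_nonsingular_action G \<tau>G M \<tau> T"
    and cont: "continuous_RN_cocycle G M \<tau> T" and faith: "faithful_action G M T"
    using assms(2) measure_preserving_continuous_RN by blast
  obtain f :: "'g \<Rightarrow> 'x \<Rightarrow> real" where f: "\<forall>g\<in>carrier G. continuous_map \<tau> euclideanreal (f g) \<and>
      (\<forall>x\<in>topspace \<tau>. 0 < f g x) \<and> (AE x in M. RN_deriv M (distr M M (T g)) x = ennreal (f g x))"
    using bchoice[OF cont[unfolded continuous_RN_cocycle_def]] by blast
  interpret cocycle_action G \<tau>G M \<tau> T f
    using assms(1) act f by unfold_locales auto
  show ?thesis by (rule free_action[OF faith])
qed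

end
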